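(* If $\boldsymbol n\in\mathcal A$ and $Q(\boldsymbol n)\neq0$, then $$\frac12\|\mathcal R(\boldsymbol n)\|_{L^2(\mathbb R^2)}^2\ge b_*=\frac{8\pi\alpha^2}{1-\alpha^2}.$$ Moreover, for $0\le\varepsilon\le2$, $$\mathcal F_\varepsilon(\boldsymbol n)\ge b_*+8\pi\Big(1-\frac\varepsilon2\Big)|Q(\boldsymbol n)|\qquad\text{if }Q(\boldsymbol n)\neq0 .$$
   Context: Let $\boldsymbol e_3=(0,0,1)$ and $\mathcal A=\{\boldsymbol m:\mathbb R^2\to\mathbb S^2:\ \boldsymbol m-\boldsymbol e_3\in H^2(\mathbb R^2;\mathbb R^3)\}$ (each element identified with its uniformly continuous representative, which tends to $\boldsymbol e_3$ at infinity). $Q(\boldsymbol m)=\frac1{4\pi}\int_{\mathbb R^2}\boldsymbol m\cdot(\partial_1\boldsymbol m\times\partial_2\boldsymbol m)\,dx\in\mathbb Z$ is the topological degree. For $0\le\varepsilon\le2$, $$\mathcal F_\varepsilon(\boldsymbol n)=\frac12\int_{\mathbb R^2}\big(|\Delta\boldsymbol n|^2+|\boldsymbol n-\boldsymbol e_3|^2-\varepsilon|\nabla\boldsymbol n|^2\big)dx .$$ The Helmholtz residual is $\mathcal R(\boldsymbol n)=(\Delta+1)(\boldsymbol n-\boldsymbol e_3)$. $J_0,J_1$ are Bessel functions of the first kind, $r_*$ is the first positive zero of $J_1$, $\alpha=-J_0(r_* )\in(0,1)$, and $b_*=\dfrac{8\pi J_0(r_* )^2}{1-J_0(r_* )^2}$.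 *)

theory Defs
  imports "HOL-Analysis.Analysis"
begin

section \<open>Test functions and weak derivatives on the plane\<close>

text \<open>Continuous differentiability of order \<open>k\<close> on the whole space, via iterated directional
  derivatives.\<close>

primrec Ck :: "nat \<Rightarrow> ('a::real_normed_vector \<Rightarrow> 'b::real_normed_vector) \<Rightarrow> bool" where
  "Ck 0 f \<longleftrightarrow> continuous_on UNIV f"
| "Ck (Suc k) f \<longleftrightarrow>
     (\<forall>x. f differentiable (at x)) \<and> (\<forall>v. Ck k (\<lambda>x. frechet_derivative f (at x) v))"

definition test_function :: "(real^2 \<Rightarrow> real) \<Rightarrow> bool" where
  "test_function \<phi> \<longleftrightarrow> (\<forall>k. Ck k \<phi>) \<and> compact (closure {x. \<phi> x \<noteq> 0})"

definition locally_integrable :: "(real^2 \<Rightarrow> 'b::euclidean_space) \<Rightarrow> bool" where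
  "locally_integrable u \<longleftrightarrow>
     u \<in> borel_measurable lborel \<and> (\<forall>K. compact K \<longrightarrow> set_integrable lborel K u)"

text \<open>\<open>g\<close> is a weak partial derivative of \<open>u\<close> in the \<open>i\<close>-th coordinate direction.\<close>

definition has_weak_partial ::
    "2 \<Rightarrow> (real^2 \<Rightarrow> 'b::euclidean_space) \<Rightarrow> (real^2 \<Rightarrow> 'b) \<Rightarrow> bool" where
  "has_weak_partial i u g \<longleftrightarrow> locally_integrable u \<and> locally_integrable g \<and>
     (\<forall>\<phi>. test_function \<phi> \<longrightarrow>
        (LINT x|lborel. frechet_derivative \<phi> (at x) (axis i 1) *\<^sub>R u x)
          = - (LINT x|lborel. \<phi> x *\<^sub>R g x))"

text \<open>Weak derivatives are unique only up to null sets; \<open>SOME\<close> picks a representative, and all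
  quantities below are integrals that do not depend on that choice.\<close>

definition weak_partial :: "2 \<Rightarrow> (real^2 \<Rightarrow> 'b::euclidean_space) \<Rightarrow> real^2 \<Rightarrow> 'b" where
  "weak_partial i u = (SOME g. has_weak_partial i u g)"

definition weak_laplacian :: "(real^2 \<Rightarrow> 'b::euclidean_space) \<Rightarrow> real^2 \<Rightarrow> 'b" where
  "weak_laplacian u x = (\<Sum>i\<in>UNIV. weak_partial i (weak_partial i u) x)"

definition L2 :: "(real^2 \<Rightarrow> 'b::euclidean_space) set" where
  "L2 = {u. u \<in> borel_measurable lborel \<and> integrable lborel (\<lambda>x. (norm (u x))\<^sup>2)}"

definition L2_norm :: "(real^2 \<Rightarrow> 'b::euclidean_space) \<Rightarrow> real" where
  "L2_norm u = sqrt (LINT x|lborel. (norm (u x))\<^sup>2)"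

definition H2 :: "(real^2 \<Rightarrow> 'b::euclidean_space) set" where
  "H2 = {u \<in> L2. \<forall>i. \<exists>g \<in> L2. has_weak_partial i u g \<and>
                     (\<forall>j. \<exists>h \<in> L2. has_weak_partial j g h)}"

section \<open>Admissible maps, degree and energy\<close>

definition e3 :: "real^3" where
  "e3 = vector [0, 0, 1]"

text \<open>Each Sobolev map is represented by its uniformly continuous representative.\<close>

definition admissible :: "(real^2 \<Rightarrow> real^3) set" where
  "admissible = {m. uniformly_continuous_on UNIV m \<and> (\<forall>x. m x \<in> sphere 0 1) \<and>
                    (\<lambda>x. m x - e3) \<in> H2}"

definition top_degree :: "(real^2 \<Rightarrow> real^3) \<Rightarrow> real" where
  "top_degree m = 1 / (4 * pi) *
     (LINT x|lborel. m x \<bullet> cross3 (weak_partial 1 m x) (weak_partial 2 m x))"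

definition energy :: "real \<Rightarrow> (real^2 \<Rightarrow> real^3) \<Rightarrow> real" where
  "energy \<epsilon> n = 1 / 2 *
     (LINT x|lborel. (norm (weak_laplacian n x))\<^sup>2 + (norm (n x - e3))\<^sup>2
                      - \<epsilon> * (\<Sum>i\<in>UNIV. (norm (weak_partial i n x))\<^sup>2))"

definition helmholtz_residual :: "(real^2 \<Rightarrow> real^3) \<Rightarrow> real^2 \<Rightarrow> real^3" where
  "helmholtz_residual n x = weak_laplacian (\<lambda>y. n y - e3) x + (n x - e3)"

section \<open>Bessel functions and the threshold constant\<close>

text \<open>Bessel function of the first kind of integer order \<open>k \<ge> 0\<close>, by its power series.\<close>

definition bessel_J :: "nat \<Rightarrow> real \<Rightarrow> real" where
  "bessel_J k x = (\<Sum>m. (-1) ^ m / (fact m * fact (m + k)) * (x / 2) ^ (2 * m + k))"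

definition r_star :: real where
  "r_star = (LEAST r. 0 < r \<and> bessel_J 1 r = 0)"

definition alpha :: real where
  "alpha = - bessel_J 0 r_star"

definition b_star :: real where
  "b_star = 8 * pi * (bessel_J 0 r_star)\<^sup>2 / (1 - (bessel_J 0 r_star)\<^sup>2)"

end

(*
  Write w = n_3 - 1, which takes values in [-2, 0], and f for the third component of the residual,
  so that (Delta + 1) w = f.

  If n avoids the south pole -e_3, then n stays away from it (n is continuous and tends to e_3 at
  infinity), and there the area form of the sphere has the primitive
  (n_1 dn_2 - n_2 dn_1) / (1 + n_3), so the degree vanishes. Hence Q <> 0 gives a point a with
  w(a) = -2.

  Let R = r_star and let phi solve Bessel's equation on (0, R) with phi(R) = 0 and a
  logarithmic singularity at 0 normalised by (Delta + 1) phi = delta_0. Extended by zero, phi satisfies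
  (Delta + 1) phi = delta_0 + sigma / alpha, where sigma is the uniform probability measure on the
  circle of radius R; the Wronskian with J_0 gives the factor 1 / alpha because J_1(R) = 0.
  Testing with phi(. - a) and using w <= 0 on the circle yields
  2 <= |integral of w d((Delta + 1) phi)| <= ||f|| ||phi||, and Lommel's integral gives
  ||phi||^2 = (1 - alpha^2) / (4 pi alpha^2). This is the first inequality.

  Integration by parts gives F_2(n) = ||Res(n)||^2 / 2, hence
  F_eps(n) = ||Res(n)||^2 / 2 + (1 - eps/2) ||grad n||^2, and ||grad n||^2 >= 8 pi |Q(n)| because the
  integrands satisfy this inequality.
*)

theory Submission
  imports Defs
begin

section \<open>Smooth compactly supported functions\<close>

text \<open>Obstacle: the comparison function phi has a logarithmic pole at the centre and a kink on
  the circle, while the weak equation accepts only compactly supported C^2 functions. So phi enters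
  through a family of C^2 regularisations with parameter k > 0, whose Helmholtz defect is explicit
  and whose errors are O(k). Near the circle the defect grows like 1/k and only its sign is
  controlled; there w <= 0 is combined with phi' < 0 at the zero of phi. Near a, continuity gives
  only w <= -d with d < 2, and d tends to 2 last.

  Since J_0' = - J_1, r_star is the first minimum of J_0. A zero R of phi with J_0(R) < 0 would put
  - J_0(R) in place of alpha, and the larger this number, the smaller the norm of phi.

  In the code phi is a function of t = r^2 and behaves like ln r at 0, which is 2 pi times the
  normalisation by delta_0.

  For the degree, mollifying n leaves the sphere. Stokes' theorem is therefore applied to quotients
  of mollified components, whose denominators stay bounded below, and tangency is used only after
  the limit.\<close>

lemma Ck_SucI:
  assumes "\<And>x. (f has_derivative f' x) (at x)" "\<And>v. Ck k (\<lambda>x. f' x v)"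
  shows "Ck (Suc k) f"
proof -
  have "frechet_derivative f (at x) = f' x" for x
    using frechet_derivative_at[OF assms(1)] by metis
  then show ?thesis using assms by (auto simp: differentiable_def)
qed

lemma Ck_Suc_derivative:
  assumes "Ck (Suc k) f"
  shows "(f has_derivative frechet_derivative f (at x)) (at x)" 
        "Ck k (\<lambda>x. frechet_derivative f (at x) v)"
  using assms by (auto simp: frechet_derivative_works)

lemma Ck_continuous: "Ck k f \<Longrightarrow> continuous_on UNIV f"
  by (cases k) (auto simp: continuous_on_eq_continuous_at intro: differentiable_imp_continuous_within)

lemma Ck_lower: "Ck (Suc k) f \<Longrightarrow> Ck k f"
proof (induction k arbitrary: f)
  case 0
  then show ?case using Ck_continuous[OF 0] by simp
next
  case (Suc k)
  then show ?case by (metis Ck_SucI Ck_Suc_derivative)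
qed

lemma Ck_const: "Ck k (\<lambda>x. c)"
proof (induction k arbitrary: c)
  case (Suc k)
  show ?case by (rule Ck_SucI[where f'="\<lambda>x v. 0"]) (auto intro: Suc)
qed auto

lemma Ck_add: "Ck k f \<Longrightarrow> Ck k g \<Longrightarrow> Ck k (\<lambda>x. f x + g x)"
proof (induction k arbitrary: f g)
  case 0 then show ?case by (auto intro: continuous_intros)
next
  case (Suc k)
  show ?case
    by (rule Ck_SucI[OF has_derivative_add[OF Ck_Suc_derivative(1)[OF Suc.prems(1)] Ck_Suc_derivative(1)[OF Suc.prems(2)]]])
       (intro Suc.IH Ck_Suc_derivative Suc.prems)
qed

lemma Ck_mult:
  fixes f g :: "'a::real_normed_vector \<Rightarrow> real"
  shows "Ck k f \<Longrightarrow> Ck k g \<Longrightarrow> Ck k (\<lambda>x. f x * g x)"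
proof (induction k arbitrary: f g)
  case 0 then show ?case by (auto intro: continuous_intros)
next
  case (Suc k)
  show ?case
    by (rule Ck_SucI[OF has_derivative_mult[OF Ck_Suc_derivative(1)[OF Suc.prems(1)] Ck_Suc_derivative(1)[OF Suc.prems(2)]]])
       (rule Ck_add[OF Suc.IH[OF Ck_lower[OF Suc.prems(1)] Ck_Suc_derivative(2)[OF Suc.prems(2)]]
                      Suc.IH[OF Ck_Suc_derivative(2)[OF Suc.prems(1)] Ck_lower[OF Suc.prems(2)]]])
qed

section \<open>A smooth function vanishing to infinite order at the origin\<close>

definition flat :: "real poly \<Rightarrow> real \<Rightarrow> real" where
  "flat p t = (if t > 0 then poly p (1 / t) * exp (- (1 / t)) else 0)"

text \<open>The derivative of \<open>p (1/t) * exp (-1/t)\<close> is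
  \<open>(1/t)^2 * (p - p') (1/t) * exp (-1/t)\<close>. Carrying the polynomial along closes the
  family under differentiation, so smoothness becomes an induction over all
  \<open>p\<close>.\<close>

definition flat_step :: "real poly \<Rightarrow> real poly" where
  "flat_step p = [:0, 0, 1:] * (p - pderiv p)"

lemma flat_tendsto_0: "((\<lambda>t::real. poly p (1 / t) * exp (- (1 / t))) \<longlongrightarrow> 0) (at_right 0)"
proof -
  have "((\<lambda>s::real. s ^ k / exp s) \<longlongrightarrow> 0) at_top" for k :: nat
    by (rule tendsto_power_div_exp_0)
  then have "((\<lambda>s::real. \<Sum>i\<le>degree p. coeff p i * (s ^ i / exp s)) \<longlongrightarrow> (\<Sum>i\<le>degree p. coeff p i * 0)) at_top"
    by (intro tendsto_intros) 
  then have "((\<lambda>s::real. poly p s * exp (- s)) \<longlongrightarrow> 0) at_top"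
    by (simp add: poly_altdef sum_distrib_right exp_minus divide_inverse mult.assoc)
  then show ?thesis
    by (rule filterlim_compose[of _ _ at_top]) (use filterlim_inverse_at_top_right in \<open>simp add: inverse_eq_divide\<close>)
qed

lemma flat_deriv: "(flat p has_real_derivative flat (flat_step p) t) (at t)"
proof -
  consider "t > 0" | "t < 0" | "t = 0" by linarith
  then show ?thesis
  proof cases
    case 1
    have "((\<lambda>t. poly p (1 / t) * exp (- (1 / t))) has_real_derivative flat (flat_step p) t) (at t)"
      using 1 unfolding flat_def flat_step_def
      by (auto intro!: derivative_eq_intros poly_DERIV DERIV_chain2[of "poly p"] simp: divide_simps power2_eq_square algebra_simps)
    then show ?thesis
      by (rule has_field_derivative_transform_within_open[of _ _ _ "{0<..}"]) (use 1 in \<open>auto simp: flat_def\<close>)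
  next
    case 2
    have "((\<lambda>t. 0) has_real_derivative flat (flat_step p) t) (at t)"
      using 2 by (auto simp: flat_def)
    then show ?thesis
      by (rule has_field_derivative_transform_within_open[of _ _ _ "{..<0}"]) (use 2 in \<open>auto simp: flat_def\<close>)
  next
    case 3
    have "((\<lambda>h. flat p h / h) \<longlongrightarrow> 0) (at_right 0)"
    \<comment> \<open>Dividing by \<open>h\<close> multiplies \<open>p (1/h)\<close> by
      \<open>1/h\<close>, so the difference quotient at 0 is the expression for the polynomial
      \<open>X * p\<close>.\<close>
    proof (rule Lim_transform_eventually[OF flat_tendsto_0[of "[:0,1:] * p"]])
      show "\<forall>\<^sub>F h in at_right 0. poly ([:0, 1:] * p) (1 / h) * exp (- (1 / h)) = flat p h / h"
        by (auto simp: eventually_at_right_field flat_def intro!: exI[of _ 1])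
    qed
    moreover have "((\<lambda>h. flat p h / h) \<longlongrightarrow> 0) (at_left 0)"
      by (rule Lim_transform_eventually[OF tendsto_const[of 0]])
         (auto simp: eventually_at_left_field flat_def intro!: exI[of _ "-1"])
    ultimately have "((\<lambda>h. flat p h / h) \<longlongrightarrow> 0) (at 0)"
      by (simp add: filterlim_split_at)
    then show ?thesis using 3 by (simp add: has_field_derivative_iff flat_def)
  qed
qed

lemma Ck_flat:
  "Ck k (\<lambda>x::real^2. flat p (a + b * x $ i))"
proof (induction k arbitrary: p)
  case 0
  have "continuous_on UNIV (flat p)"
    by (meson DERIV_isCont continuous_at_imp_continuous_on flat_deriv)
  then show ?case
    by (auto intro!: continuous_on_compose2[of UNIV "flat p"] continuous_intros)
next
  case (Suc k)
  have d: "((\<lambda>x::real^2. flat p (a + b * x $ i)) has_derivative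
      (\<lambda>v. b * v $ i * flat (flat_step p) (a + b * x $ i))) (at x)" for x
  proof -
    have "((\<lambda>x::real^2. a + b * x $ i) has_derivative (\<lambda>v. b * v $ i)) (at x)"
      by (auto intro!: derivative_eq_intros bounded_linear.has_derivative[OF bounded_linear_vec_nth])
    from has_derivative_compose[OF this flat_deriv[unfolded has_field_derivative_def]]
    show ?thesis by (simp add: mult.commute)
  qed
  show ?case
    by (rule Ck_SucI[OF d]) (rule Ck_mult[OF Ck_const Suc])
qed

section \<open>Compactly supported C^1 functions and convolution\<close>

definition pd :: "2 \<Rightarrow> (real^2 \<Rightarrow> real) \<Rightarrow> real^2 \<Rightarrow> real" where
  "pd i f x = frechet_derivative f (at x) (axis i 1)"

definition bounded_support :: "(real^2 \<Rightarrow> real) \<Rightarrow> bool" where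
  "bounded_support f \<longleftrightarrow> (\<exists>R. \<forall>x. R < norm x \<longrightarrow> f x = 0)"

text \<open>The radial comparison functions are only of class C^2, so the pairing with weak
  derivatives is extended from \<open>test_function\<close> to this larger class.\<close>

definition C1c :: "(real^2 \<Rightarrow> real) \<Rightarrow> bool" where
  "C1c f \<longleftrightarrow> (\<forall>x. f differentiable (at x)) \<and> (\<forall>i. continuous_on UNIV (pd i f)) \<and> bounded_support f"

definition conv :: "(real^2 \<Rightarrow> real) \<Rightarrow> (real^2 \<Rightarrow> real) \<Rightarrow> real^2 \<Rightarrow> real" where
  "conv f g x = (LBINT y. f (x - y) * g y)"

lemma pd_eq: "(f has_derivative f') (at x) \<Longrightarrow> pd i f x = f' (axis i 1)"
  using frechet_derivative_at unfolding pd_def by metis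

lemma vec2_decomp: "(v::real^2) = v $ 1 *\<^sub>R axis 1 1 + v $ 2 *\<^sub>R axis 2 1"
  by (simp add: vec_eq_iff forall_2 axis_def)

lemma has_derivative_pd:
  assumes "f differentiable (at x)"
  shows "(f has_derivative (\<lambda>v. v $ 1 * pd 1 f x + v $ 2 * pd 2 f x)) (at x)"
proof -
  have d: "(f has_derivative frechet_derivative f (at x)) (at x)"
    using assms frechet_derivative_works by blast
  then have "linear (frechet_derivative f (at x))"
    using has_derivative_linear by blast
  then have "frechet_derivative f (at x) v = v $ 1 * pd 1 f x + v $ 2 * pd 2 f x" for v
    by (subst vec2_decomp[of v]) (simp add: linear_add linear_scale pd_def)
  then have "frechet_derivative f (at x) = (\<lambda>v. v $ 1 * pd 1 f x + v $ 2 * pd 2 f x)" by auto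
  with d show ?thesis by simp
qed

lemma C1c_I:
  assumes "\<And>x. (f has_derivative (\<lambda>v. v $ 1 * f1 x + v $ 2 * f2 x)) (at x)"
    and "continuous_on UNIV f1" "continuous_on UNIV f2" "bounded_support f"
  shows "C1c f" "pd 1 f = f1" "pd 2 f = f2"
proof -
  show 1: "pd 1 f = f1" using pd_eq[OF assms(1)] by (auto simp: axis_def)
  show 2: "pd 2 f = f2" using pd_eq[OF assms(1)] by (auto simp: axis_def)
  show "C1c f" unfolding C1c_def forall_2 1 2 using assms by (auto simp: differentiable_def)
qed

lemma C1c_has_derivative:
  "C1c f \<Longrightarrow> (f has_derivative (\<lambda>v. v $ 1 * pd 1 f x + v $ 2 * pd 2 f x)) (at x)"
  by (simp add: C1c_def has_derivative_pd)

lemma bounded_supportE: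
  assumes "bounded_support f"
  obtains R where "R > 0" "\<And>x. R < norm x \<Longrightarrow> f x = 0"
proof -
  obtain R where "\<forall>x. R < norm x \<longrightarrow> f x = 0" using assms unfolding bounded_support_def by blast
  then show thesis by (intro that[of "max R 1"]) auto
qed

lemma frechet_derivative_outside:
  assumes "\<And>x. R < norm x \<Longrightarrow> f x = 0" "R < norm x"
  shows "frechet_derivative f (at x) v = 0"
proof -
  have "((\<lambda>_. 0) has_derivative (\<lambda>_. 0)) (at x)" by simp
  then have "(f has_derivative (\<lambda>_. 0)) (at x)"
    by (rule has_derivative_transform_within_open[of _ _ _ _ "{x. R < norm x}"])
       (use assms in \<open>auto intro!: open_Collect_less continuous_intros\<close>)
  then show ?thesis using frechet_derivative_at by metis
qed

lemma bounded_support_frechet: "bounded_support f \<Longrightarrow> bounded_support (\<lambda>x. frechet_derivative f (at x) v)"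
  unfolding bounded_support_def using frechet_derivative_outside by metis

lemma bounded_support_pd: "bounded_support f \<Longrightarrow> bounded_support (pd i f)"
  unfolding pd_def by (rule bounded_support_frechet)

lemma bounded_support_mult: "bounded_support f \<Longrightarrow> bounded_support (\<lambda>x. f x * g x)"
  by (auto simp: bounded_support_def)

lemma bounded_support_bounded:
  assumes "continuous_on UNIV f" "bounded_support f"
  obtains B where "B > 0" "\<And>x. \<bar>f x\<bar> \<le> B"
proof -
  obtain R where R: "R > 0" "\<And>x. R < norm x \<Longrightarrow> f x = 0" using bounded_supportE[OF assms(2)] by metis
  have "compact (f ` cball 0 R)"
    by (intro compact_continuous_image continuous_on_subset[OF assms(1)]) auto
  then obtain B where "\<forall>y\<in>f ` cball 0 R. norm y \<le> B" 
    using compact_imp_bounded bounded_iff by metis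
  then have "\<bar>f x\<bar> \<le> max B 1" for x
    using R(2)[of x] by (cases "norm x \<le> R") (auto simp: le_max_iff_disj)
  then show thesis by (intro that[of "max B 1"]) auto
qed

lemma bounded_support_uniformly_continuous:
  assumes "continuous_on UNIV f" "bounded_support f" "e > 0"
  obtains d where "d > 0" "\<And>x y. norm (y - x) < d \<Longrightarrow> \<bar>f y - f x\<bar> < e"
proof -
  obtain R where R: "R > 0" "\<And>x. R < norm x \<Longrightarrow> f x = 0" using bounded_supportE[OF assms(2)] by metis
  have "uniformly_continuous_on (cball 0 (R+1)) f"
    by (intro compact_uniformly_continuous continuous_on_subset[OF assms(1)]) auto
  then obtain d where d: "d > 0" "\<And>x y. x \<in> cball 0 (R+1) \<Longrightarrow> y \<in> cball 0 (R+1) \<Longrightarrow> dist y x < d \<Longrightarrow> dist (f y) (f x) < e"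
    unfolding uniformly_continuous_on_def using \<open>e > 0\<close> by metis
  show thesis
  proof (rule that[of "min d 1"])
    fix x y :: "real^2" assume a: "norm (y - x) < min d 1"
    then have b: "norm y < norm x + 1" "norm x < norm y + 1"
      using norm_triangle_ineq2[of y x] norm_triangle_ineq2[of x y] by (auto simp: norm_minus_commute)
    show "\<bar>f y - f x\<bar> < e"
    proof (cases "x \<in> cball 0 (R+1) \<and> y \<in> cball 0 (R+1)")
      case True then show ?thesis using d(2)[of x y] a by (auto simp: dist_norm)
    next
      case False
      then have "norm x > R" "norm y > R" using b by auto
      then show ?thesis using R(2) \<open>e > 0\<close> by auto
    qed
  qed (use d in auto)
qed

text \<open>Compact support makes the partial derivatives uniformly continuous, so \<open>d\<close>
  does not depend on the base point. This uniformity is what lets the remainder be integrated when a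
  convolution is differentiated.\<close>

lemma C1c_uniform_linearization:
  assumes "C1c f" "e > 0"
  obtains d where "d > 0" "\<And>a b. norm (b - a) < d \<Longrightarrow>
     \<bar>f b - f a - ((b - a) $ 1 * pd 1 f a + (b - a) $ 2 * pd 2 f a)\<bar> \<le> e * norm (b - a)"
proof -
  have c: "continuous_on UNIV (pd i f)" "bounded_support (pd i f)" for i
    using assms bounded_support_pd by (auto simp: C1c_def)
  have e: "e/2 > 0" using assms by auto
  obtain d1 where d1: "d1 > 0" "\<And>x y. norm (y - x) < d1 \<Longrightarrow> \<bar>pd 1 f y - pd 1 f x\<bar> < e/2"
    using bounded_support_uniformly_continuous[OF c e] by metis
  obtain d2 where d2: "d2 > 0" "\<And>x y. norm (y - x) < d2 \<Longrightarrow> \<bar>pd 2 f y - pd 2 f x\<bar> < e/2"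
    using bounded_support_uniformly_continuous[OF c e] by metis
  show thesis
  proof (rule that[of "min d1 d2"])
    fix a b :: "real^2" assume ab: "norm (b - a) < min d1 d2"
    let ?f' = "\<lambda>x (v::real^2). v $ 1 * pd 1 f x + v $ 2 * pd 2 f x"
    have "norm (f b - f a - ?f' a (b - a)) \<le> norm (b - a) * e"
    proof (rule differentiable_bound_linearization[where S="ball a (min d1 d2)"])
      fix t :: real assume "t \<in> {0..1}"
      then have "norm (t *\<^sub>R (b - a)) \<le> 1 * norm (b - a)" unfolding norm_scaleR by (intro mult_right_mono) auto
      then show "a + t *\<^sub>R (b - a) \<in> ball a (min d1 d2)" using ab by (auto simp: dist_norm)
    next
      fix x assume x: "x \<in> ball a (min d1 d2)"
      show "(f has_derivative ?f' x) (at x within ball a (min d1 d2))"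
        using C1c_has_derivative[OF assms(1)] has_derivative_at_withinI by blast
      show "onorm (?f' x - ?f' a) \<le> e"
      proof (rule onorm_le)
        fix v :: "real^2"
        have 1: "\<bar>pd 1 f x - pd 1 f a\<bar> < e/2" "\<bar>pd 2 f x - pd 2 f a\<bar> < e/2"
          using x d1(2)[of x a] d2(2)[of x a] by (auto simp: dist_norm norm_minus_commute)
        have "\<bar>v $ 1\<bar> \<le> norm v" "\<bar>v $ 2\<bar> \<le> norm v" using component_le_norm_cart by auto
        then have "\<bar>v $ 1\<bar> * \<bar>pd 1 f x - pd 1 f a\<bar> + \<bar>v $ 2\<bar> * \<bar>pd 2 f x - pd 2 f a\<bar> \<le> norm v * (e/2) + norm v * (e/2)"
          using 1 by (intro add_mono mult_mono) auto
        moreover have "(?f' x - ?f' a) v = v $ 1 * (pd 1 f x - pd 1 f a) + v $ 2 * (pd 2 f x - pd 2 f a)"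
          by (simp add: algebra_simps)
        moreover have "\<bar>v $ 1 * (pd 1 f x - pd 1 f a) + v $ 2 * (pd 2 f x - pd 2 f a)\<bar> \<le> \<bar>v $ 1\<bar> * \<bar>pd 1 f x - pd 1 f a\<bar> + \<bar>v $ 2\<bar> * \<bar>pd 2 f x - pd 2 f a\<bar>"
          by (metis abs_mult abs_triangle_ineq)
        ultimately show "norm ((?f' x - ?f' a) v) \<le> e * norm v" by (simp add: algebra_simps)
      qed
    qed (use d1 d2 in auto)
    then show "\<bar>f b - f a - ?f' a (b - a)\<bar> \<le> e * norm (b - a)" by (simp add: mult.commute)
  qed (use d1 d2 in auto)
qed

lemma locally_integrable_cball:
  fixes g :: "real^2 \<Rightarrow> real"
  assumes "locally_integrable g"
  shows "integrable lborel (\<lambda>y. indicator (cball a r) y * g y)"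
  using assms unfolding locally_integrable_def set_integrable_def by auto

lemma integrable_bounded_support_scaleR:
  fixes u :: "real^2 \<Rightarrow> 'b::euclidean_space"
  assumes "continuous_on UNIV f" "bounded_support f" "locally_integrable u"
  shows "integrable lborel (\<lambda>y. f y *\<^sub>R u y)"
proof -
  obtain R where R: "R > 0" "\<And>x. R < norm x \<Longrightarrow> f x = 0" using bounded_supportE[OF assms(2)] by metis
  obtain B where B: "B > 0" "\<And>x. \<bar>f x\<bar> \<le> B" using bounded_support_bounded[OF assms(1,2)] by metis
  have [measurable]: "f \<in> borel_measurable borel" using assms(1) by (simp add: borel_measurable_continuous_onI)
  have [measurable]: "u \<in> borel_measurable lborel" using assms(3) by (simp add: locally_integrable_def)
  have i: "integrable lborel (\<lambda>x. indicator (cball 0 R) x *\<^sub>R u x)"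
    using assms(3) unfolding locally_integrable_def set_integrable_def by auto
  show ?thesis
  proof (rule Bochner_Integration.integrable_bound)
    show "integrable lborel (\<lambda>y. B *\<^sub>R (indicator (cball 0 R) y *\<^sub>R u y))"
      by (intro integrable_scaleR_right i)
    show "AE y in lborel. norm (f y *\<^sub>R u y) \<le> norm (B *\<^sub>R (indicator (cball 0 R) y *\<^sub>R u y))"
    proof (rule AE_I2)
      fix y show "norm (f y *\<^sub>R u y) \<le> norm (B *\<^sub>R (indicator (cball 0 R) y *\<^sub>R u y))"
        using R(2)[of y] B(1) B(2)[of y] by (cases "norm y \<le> R") (auto intro!: mult_right_mono)
    qed
  qed measurable
qed

lemma integrable_bounded_support_mult:
  fixes g :: "real^2 \<Rightarrow> real"
  assumes "continuous_on UNIV f" "bounded_support f" "locally_integrable g"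
  shows "integrable lborel (\<lambda>y. f y * g y)"
  using integrable_bounded_support_scaleR[OF assms] by simp

lemma bounded_support_reflect:
  assumes "bounded_support f" shows "bounded_support (\<lambda>y. f (x - y))"
proof -
  obtain R where R: "R > 0" "\<And>x. R < norm x \<Longrightarrow> f x = 0" using bounded_supportE[OF assms] by metis
  have "f (x - y) = 0" if "norm x + R < norm y" for y
    using norm_triangle_ineq2[of y x] that by (intro R(2)) (auto simp: norm_minus_commute)
  then show ?thesis unfolding bounded_support_def by blast
qed

lemma continuous_on_reflect:
  fixes f :: "real^2 \<Rightarrow> real"
  shows "continuous_on UNIV f \<Longrightarrow> continuous_on UNIV (\<lambda>y. f (x - y))"
  by (rule continuous_on_compose2[of UNIV f]) (auto intro: continuous_intros)

lemma integrable_conv: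
  assumes "continuous_on UNIV f" "bounded_support f" "locally_integrable g"
  shows "integrable lborel (\<lambda>y. f (x - y) * g y)"
  using integrable_bounded_support_mult[OF continuous_on_reflect[OF assms(1)] bounded_support_reflect[OF assms(2)] assms(3)] .

lemma C1c_continuous: "C1c f \<Longrightarrow> continuous_on UNIV f"
  unfolding C1c_def by (simp add: continuous_on_eq_continuous_at differentiable_imp_continuous_within)

text \<open>The derivative falls on \<open>f\<close> alone, so local integrability of
  \<open>g\<close> is enough. The first-order remainder of \<open>f\<close> is uniformly small and,
  for increments below 1, vanishes outside the fixed ball \<open>K\<close>, over which
  \<open>g\<close> is integrable.\<close>

lemma conv_has_derivative:
  assumes "C1c f" "locally_integrable g"
  shows "(conv f g has_derivative (\<lambda>v. v $ 1 * conv (pd 1 f) g x + v $ 2 * conv (pd 2 f) g x)) (at x)"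
  unfolding has_derivative_at_alt
proof safe
  show "bounded_linear (\<lambda>v::real^2. v $ 1 * conv (pd 1 f) g x + v $ 2 * conv (pd 2 f) g x)"
    by (intro bounded_linear_add bounded_linear_mult_const bounded_linear_vec_nth)
  fix e :: real assume "e > 0"
  have c: "continuous_on UNIV (pd i f)" "bounded_support (pd i f)" for i
    using assms bounded_support_pd by (auto simp: C1c_def)
  have f: "continuous_on UNIV f" "bounded_support f" using assms C1c_continuous by (auto simp: C1c_def)
  obtain R where R: "R > 0" "\<And>x. R < norm x \<Longrightarrow> f x = 0" using bounded_supportE[OF f(2)] by metis
  define K where "K = cball (0::real^2) (norm x + R + 1)"
  define M where "M = (LBINT y. \<bar>indicator K y * g y\<bar>)"
  have iK: "integrable lborel (\<lambda>y. \<bar>indicator K y * g y\<bar>)" unfolding K_def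
    by (intro integrable_abs locally_integrable_cball assms)
  have "M \<ge> 0" unfolding M_def by simp
  \<comment> \<open>The summand 1 covers the case that \<open>g\<close> vanishes almost everywhere
    on \<open>K\<close>.\<close>
  have "e / (M + 1) > 0" using \<open>M \<ge> 0\<close> \<open>e > 0\<close> by auto
  then obtain d where d: "d > 0" "\<And>a b. norm (b - a) < d \<Longrightarrow>
     \<bar>f b - f a - ((b - a) $ 1 * pd 1 f a + (b - a) $ 2 * pd 2 f a)\<bar> \<le> e / (M + 1) * norm (b - a)"
    using C1c_uniform_linearization[OF assms(1)] by metis
  show "\<exists>d>0. \<forall>y. norm (y - x) < d \<longrightarrow> norm (conv f g y - conv f g x - ((y - x) $ 1 * conv (pd 1 f) g x + (y - x) $ 2 * conv (pd 2 f) g x)) \<le> e * norm (y - x)"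
  proof (intro exI[of _ "min d 1"] conjI allI impI)
    fix z assume z: "norm (z - x) < min d 1"
    let ?r = "\<lambda>y. f (z - y) - f (x - y) - ((z - x) $ 1 * pd 1 f (x - y) + (z - x) $ 2 * pd 2 f (x - y))"
    have i: "integrable lborel (\<lambda>y. ?r y * g y)"
    proof -
      have "integrable lborel (\<lambda>y. f (z - y) * g y - f (x - y) * g y - ((z - x) $ 1 * (pd 1 f (x - y) * g y) + (z - x) $ 2 * (pd 2 f (x - y) * g y)))"
        by (intro Bochner_Integration.integrable_diff Bochner_Integration.integrable_add integrable_mult_right
             integrable_conv[OF f assms(2)] integrable_conv[OF c assms(2)])
      moreover have "f (z - y) * g y - f (x - y) * g y - ((z - x) $ 1 * (pd 1 f (x - y) * g y) + (z - x) $ 2 * (pd 2 f (x - y) * g y)) = ?r y * g y" for y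
        by (simp add: algebra_simps)
      ultimately show ?thesis by simp
    qed
    have "conv f g z - conv f g x - ((z - x) $ 1 * conv (pd 1 f) g x + (z - x) $ 2 * conv (pd 2 f) g x)
       = (LBINT y. f (z - y) * g y - f (x - y) * g y - ((z - x) $ 1 * (pd 1 f (x - y) * g y) + (z - x) $ 2 * (pd 2 f (x - y) * g y)))"
      unfolding conv_def using integrable_conv[OF f assms(2), of z] integrable_conv[OF f assms(2), of x] 
        integrable_conv[OF c assms(2), of 1 x] integrable_conv[OF c assms(2), of 2 x]
      by simp
    also have "\<dots> = (LBINT y. ?r y * g y)"
      by (intro Bochner_Integration.integral_cong) (auto simp: algebra_simps)
    finally have eq: "conv f g z - conv f g x - ((z - x) $ 1 * conv (pd 1 f) g x + (z - x) $ 2 * conv (pd 2 f) g x) = (LBINT y. ?r y * g y)" .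
    have "norm (LBINT y. ?r y * g y) \<le> (LBINT y. norm (?r y * g y))"
      by (rule integral_norm_bound)
    also have "\<dots> \<le> (LBINT y. e / (M + 1) * norm (z - x) * \<bar>indicator K y * g y\<bar>)"
    proof (rule integral_mono)
      show "integrable lborel (\<lambda>y. norm (?r y * g y))" using i by simp
      show "integrable lborel (\<lambda>y. e / (M + 1) * norm (z - x) * \<bar>indicator K y * g y\<bar>)"
        using iK by simp
      fix y
      show "norm (?r y * g y) \<le> e / (M + 1) * norm (z - x) * \<bar>indicator K y * g y\<bar>"
      proof (cases "y \<in> K")
        case True
        have "\<bar>?r y\<bar> \<le> e / (M + 1) * norm (z - x)"
          using d(2)[of "z - y" "x - y"] z by auto
        then have "\<bar>?r y\<bar> * \<bar>g y\<bar> \<le> e / (M + 1) * norm (z - x) * \<bar>g y\<bar>" by (rule mult_right_mono) simp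
        then show ?thesis using True by (simp add: abs_mult)
      next
        case False
        then have y: "norm y > norm x + R + 1" by (auto simp: K_def)
        have zx: "norm z < norm x + 1" using z norm_triangle_ineq2[of z x] by auto
        have 1: "R < norm (z - y)" "R < norm (x - y)"
          using y zx norm_triangle_ineq2[of y z] norm_triangle_ineq2[of y x] by (auto simp: norm_minus_commute)
        then have "?r y = 0" using R(2) frechet_derivative_outside[OF R(2), where x="x - y"] by (simp add: pd_def)
        then show ?thesis using False by simp
      qed
    qed
    also have "\<dots> = e / (M + 1) * norm (z - x) * M" by (simp add: M_def)
    also have "\<dots> = e * norm (z - x) * (M / (M + 1))" by simp
    also have "\<dots> \<le> e * norm (z - x) * 1"
      using \<open>e > 0\<close> \<open>M \<ge> 0\<close> by (intro mult_left_mono) auto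
    finally show "norm (conv f g z - conv f g x - ((z - x) $ 1 * conv (pd 1 f) g x + (z - x) $ 2 * conv (pd 2 f) g x)) \<le> e * norm (z - x)"
      unfolding eq by simp
  qed (use d in auto)
qed

lemma test_functionI: "(\<And>k. Ck k f) \<Longrightarrow> bounded_support f \<Longrightarrow> test_function f"
proof -
  assume a: "\<And>k. Ck k f" "bounded_support f"
  obtain R where R: "R > 0" "\<And>x. R < norm x \<Longrightarrow> f x = 0" using bounded_supportE[OF a(2)] by metis
  have "{x. f x \<noteq> 0} \<subseteq> cball 0 R" using R(2) by force
  then have "bounded {x. f x \<noteq> 0}" using bounded_cball bounded_subset by blast
  then show ?thesis using a unfolding test_function_def by (simp add: compact_closure)
qed

lemma test_function_bounded_support:
  assumes "test_function f" shows "bounded_support f"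
proof -
  have "bounded {x. f x \<noteq> 0}"
    using assms compact_imp_bounded bounded_subset closure_subset unfolding test_function_def by metis
  then obtain R where "\<And>x. f x \<noteq> 0 \<Longrightarrow> norm x \<le> R" unfolding bounded_iff by auto
  then show ?thesis unfolding bounded_support_def by (metis not_less)
qed

lemma test_function_frechet:
  assumes "test_function f" shows "test_function (\<lambda>x. frechet_derivative f (at x) v)"
proof (rule test_functionI)
  show "Ck k (\<lambda>x. frechet_derivative f (at x) v)" for k
    using assms Ck_Suc_derivative(2) unfolding test_function_def by blast
qed (rule bounded_support_frechet[OF test_function_bounded_support[OF assms]])

lemma test_function_pd: "test_function f \<Longrightarrow> test_function (pd i f)"
  unfolding pd_def[abs_def] by (rule test_function_frechet)

lemma test_function_continuous: "test_function f \<Longrightarrow> continuous_on UNIV f"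
  by (rule Ck_continuous[of 0]) (simp only: test_function_def)

lemmas integrable_test_function_scaleR =
  integrable_bounded_support_scaleR[OF test_function_continuous test_function_bounded_support]
lemmas integrable_test_function_mult =
  integrable_bounded_support_mult[OF test_function_continuous test_function_bounded_support]

lemma test_function_C1c: 
  assumes "test_function f" shows "C1c f"
proof -
  have "Ck (Suc 0) f" using assms unfolding test_function_def by blast
  then show ?thesis unfolding C1c_def
    using test_function_continuous[OF test_function_pd[OF assms]] test_function_bounded_support[OF assms]
    by auto
qed

lemma Ck_cmult: 
  fixes f :: "'a::real_normed_vector \<Rightarrow> real"
  shows "Ck k f \<Longrightarrow> Ck k (\<lambda>x. c * f x)"
  using Ck_mult[OF Ck_const] .

text \<open>Partial derivatives of the convolution are convolutions with partial derivatives of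
  \<open>f\<close>, which are again test functions; hence the induction with \<open>f\<close>
  arbitrary.\<close>

lemma Ck_conv:
  assumes "locally_integrable g"
  shows "test_function f \<Longrightarrow> Ck k (conv f g)"
proof (induction k arbitrary: f)
  case 0
  have "continuous (at x) (conv f g)" for x
    using conv_has_derivative[OF test_function_C1c[OF 0] assms] has_derivative_continuous by blast
  then show ?case by (simp add: continuous_on_eq_continuous_at)
next
  case (Suc k)
  show ?case
    by (rule Ck_SucI[OF conv_has_derivative[OF test_function_C1c[OF Suc.prems] assms]])
       (intro Ck_add Ck_cmult Suc.IH test_function_pd Suc.prems)
qed

lemma conv_support:
  assumes "\<And>x. R < norm x \<Longrightarrow> f x = 0" "\<And>x. S < norm x \<Longrightarrow> g x = 0" "R + S < norm x"
  shows "conv f g x = 0"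
proof -
  have "f (x - y) * g y = 0" for y
  proof (cases "S < norm y")
    case False
    then have "R < norm (x - y)" using assms(3) norm_triangle_ineq2[of x y] by linarith
    then show ?thesis using assms(1) by simp
  qed (use assms(2) in simp)
  then have "(\<lambda>y. f (x - y) * g y) = (\<lambda>y. 0)" by blast
  then show ?thesis by (simp add: conv_def)
qed

lemma bounded_support_conv:
  assumes "bounded_support f" "bounded_support g" shows "bounded_support (conv f g)"
proof -
  obtain R S where "\<forall>x. R < norm x \<longrightarrow> f x = 0" "\<forall>x. S < norm x \<longrightarrow> g x = 0"
    using assms unfolding bounded_support_def by auto
  then have "\<forall>x. R + S < norm x \<longrightarrow> conv f g x = 0"
    using conv_support[of R f S g] by simp
  then show ?thesis unfolding bounded_support_def by blast
qed

lemma test_function_conv: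
  assumes "test_function f" "locally_integrable g" "bounded_support g"
  shows "test_function (conv f g)"
  using test_functionI[OF Ck_conv[OF assms(2,1)] bounded_support_conv[OF test_function_bounded_support[OF assms(1)] assms(3)]] .

lemma continuous_locally_integrable:
  fixes f :: "real^2 \<Rightarrow> 'b::euclidean_space"
  assumes "continuous_on UNIV f" shows "locally_integrable f"
  unfolding locally_integrable_def set_integrable_def
proof safe
  show "f \<in> borel_measurable lborel" using assms by (simp add: borel_measurable_continuous_onI)
  fix K :: "(real^2) set" assume "compact K"
  then show "integrable lborel (\<lambda>x. indicator K x *\<^sub>R f x)"
    using borel_integrable_compact[of K f] continuous_on_subset[OF assms] by auto
qed

lemma distr_lborel_reflect: "distr lborel borel (\<lambda>y. x - y) = (lborel :: (real^2) measure)"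
proof -
  have "lborel = density (distr lborel borel (\<lambda>y. x + (-1) *\<^sub>R y)) (\<lambda>_. \<bar>-1::real\<bar>^DIM(real^2))"
    by (rule lborel_affine) simp
  then show ?thesis by (simp add: density_1)
qed

lemma integral_reflect:
  fixes F :: "real^2 \<Rightarrow> real"
  assumes "F \<in> borel_measurable borel"
  shows "(LBINT y. F (x - y)) = (LBINT y. F y)"
  using integral_distr[of "\<lambda>y. x - y" lborel borel F] assms unfolding distr_lborel_reflect by simp

lemma conv_commute:
  assumes [measurable]: "f \<in> borel_measurable borel" "g \<in> borel_measurable borel"
  shows "conv f g x = conv g f x"
proof -
  have "(LBINT y. f (x - (x - y)) * g (x - y)) = (LBINT y. f (x - y) * g y)"
    by (rule integral_reflect) measurable
  then show ?thesis by (simp add: conv_def mult.commute)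
qed

lemma Ck_reflect:
  fixes f :: "'a::real_normed_vector \<Rightarrow> real"
  shows "Ck k f \<Longrightarrow> Ck k (\<lambda>y. f (x - y))"
proof (induction k arbitrary: f)
  case 0 then show ?case by (auto intro!: continuous_on_compose2[of UNIV f] continuous_intros)
next
  case (Suc k)
  have d: "((\<lambda>y. f (x - y)) has_derivative (\<lambda>v. frechet_derivative f (at (x - y)) (-v))) (at y)" for y
    by (rule has_derivative_compose[OF _ Ck_Suc_derivative(1)[OF Suc.prems]]) (auto intro!: derivative_eq_intros)
  show ?case by (rule Ck_SucI[OF d]) (rule Suc.IH[OF Ck_Suc_derivative(2)[OF Suc.prems]])
qed

lemma pd_reflect:
  assumes "C1c f" shows "pd i (\<lambda>y. f (x - y)) y = - pd i f (x - y)"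
proof -
  have "((\<lambda>y. f (x - y)) has_derivative (\<lambda>v. (-v) $ 1 * pd 1 f (x - y) + (-v) $ 2 * pd 2 f (x - y))) (at y)"
    by (rule has_derivative_compose[OF _ C1c_has_derivative[OF assms]]) (auto intro!: derivative_eq_intros)
  from pd_eq[OF this, of i] show ?thesis
    using exhaust_2[of i] by (auto simp: axis_def)
qed

lemma test_function_reflect: "test_function f \<Longrightarrow> test_function (\<lambda>y. f (x - y))"
  by (rule test_functionI[OF Ck_reflect bounded_support_reflect[OF test_function_bounded_support]])
     (auto simp only: test_function_def)

text \<open>The weak derivative is tested with \<open>f (x - y)\<close> as a function of
  \<open>y\<close>; the sign produced by the reflection cancels the one in the definition.\<close>

lemma conv_weak_partial:
  fixes u :: "real^2 \<Rightarrow> real"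
  assumes "test_function f" "has_weak_partial i u g"
  shows "conv (pd i f) u x = conv f g x"
proof -
  have "(LBINT y. pd i (\<lambda>y. f (x - y)) y * u y) = - (LBINT y. f (x - y) * g y)"
    using assms test_function_reflect[OF assms(1), of x] unfolding has_weak_partial_def pd_def by auto
  then show ?thesis by (simp add: pd_reflect[OF test_function_C1c[OF assms(1)]] conv_def)
qed

section \<open>Mollifiers\<close>

lemma flat_1_nonneg: "flat 1 t \<ge> 0" and flat_1_le: "flat 1 t \<le> 1" and flat_1_pos: "t > 0 \<Longrightarrow> flat 1 t > 0"
  by (auto simp: flat_def)

definition bump1 :: "real \<Rightarrow> real \<Rightarrow> real" where
  "bump1 s t = flat 1 (1 + s * t) * flat 1 (1 + (- s) * t)"

text \<open>A tensor product supported in the square of half-side \<open>1/s\<close> about the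
  origin. One family serves two purposes: large \<open>s\<close> gives mollifiers and small
  \<open>s\<close> gives slowly varying cutoffs.\<close>

definition bump :: "real \<Rightarrow> real^2 \<Rightarrow> real" where
  "bump s x = bump1 s (x $ 1) * bump1 s (x $ 2)"

lemma bump_nonneg: "bump s x \<ge> 0"
  unfolding bump_def bump1_def by (intro mult_nonneg_nonneg flat_1_nonneg)

lemma bump_le_1: "bump s x \<le> 1"
  unfolding bump_def bump1_def by (intro mult_le_one mult_nonneg_nonneg flat_1_nonneg flat_1_le)

lemma bump_0: "bump s 0 = bump 1 0" "bump s 0 > 0"
  by (auto simp: bump_def bump1_def intro!: mult_pos_pos flat_1_pos)

lemma bump_scale: "bump s x = bump 1 (s *\<^sub>R x)"
  by (simp add: bump_def bump1_def)

lemma bump_support: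
  assumes "s > 0" "2 / s < norm x" shows "bump s x = 0"
proof -
  have "norm x \<le> \<bar>x $ 1\<bar> + \<bar>x $ 2\<bar>" using norm_le_l1_cart[of x] by (simp add: sum_2)
  then have "\<bar>x $ 1\<bar> > 1 / s \<or> \<bar>x $ 2\<bar> > 1 / s" using assms(2) by linarith
  then obtain i where "\<bar>x $ i\<bar> > 1 / s" by blast
  then have "\<bar>s * x $ i\<bar> > 1" using assms(1) by (simp add: field_simps abs_mult)
  then have "bump1 s (x $ i) = 0" by (auto simp: bump1_def flat_def)
  then show ?thesis using exhaust_2[of i] by (auto simp: bump_def)
qed

lemma test_function_bump:
  assumes "s > 0" shows "test_function (bump s)"
proof (rule test_functionI)
  show "Ck k (bump s)" for k
    unfolding bump_def[abs_def] bump1_def[abs_def] by (intro Ck_mult Ck_flat)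
  show "bounded_support (bump s)" unfolding bounded_support_def using bump_support[OF assms] by blast
qed

lemma pd_product:
  assumes "\<And>t. (A has_real_derivative A' t) (at t)" "\<And>t. (B has_real_derivative B' t) (at t)"
  shows "pd 1 (\<lambda>x. c * (A (x $ 1) * B (x $ 2))) = (\<lambda>x. c * (A' (x $ 1) * B (x $ 2)))"
    and "pd 2 (\<lambda>x. c * (A (x $ 1) * B (x $ 2))) = (\<lambda>x. c * (A (x $ 1) * B' (x $ 2)))"
proof -
  have p: "((\<lambda>y. y $ i) has_derivative (\<lambda>v. v $ i)) (at x)" for x :: "real^2" and i
    by (rule bounded_linear_imp_has_derivative) (rule bounded_linear_vec_nth)
  have "((\<lambda>x. c * (A (x $ 1) * B (x $ 2))) has_derivative 
     (\<lambda>v. c * (A (x $ 1) * (B' (x $ 2) * v $ 2) + (A' (x $ 1) * v $ 1) * B (x $ 2)))) (at x)" for x :: "real^2"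
    by (intro has_derivative_mult_right has_derivative_mult
        has_derivative_compose[OF p assms(1)[unfolded has_field_derivative_def]]
        has_derivative_compose[OF p assms(2)[unfolded has_field_derivative_def]])
  note d = pd_eq[OF this]
  show "pd 1 (\<lambda>x. c * (A (x $ 1) * B (x $ 2))) = (\<lambda>x. c * (A' (x $ 1) * B (x $ 2)))"
    "pd 2 (\<lambda>x. c * (A (x $ 1) * B (x $ 2))) = (\<lambda>x. c * (A (x $ 1) * B' (x $ 2)))"
    unfolding fun_eq_iff d by (auto simp: axis_def)
qed

text \<open>The two derivatives act on different tensor factors, so the symmetry of the mixed
  partials can be read off the formulas. The Jacobian identity for weak derivatives rests on
  it.\<close>

lemma bump_pd_commute: "pd 1 (pd 2 (\<lambda>x. c * bump s x)) = pd 2 (pd 1 (\<lambda>x. c * bump s x))"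
proof -
  have f: "((\<lambda>t. flat p (a + b * t)) has_real_derivative b * flat (flat_step p) (a + b * t)) (at t)" for p a b t
    by (rule DERIV_chain2[OF flat_deriv, THEN DERIV_cong]) (auto intro!: derivative_eq_intros)
  define D where "D t = flat 1 (1 + s * t) * (- s * flat (flat_step 1) (1 + (- s) * t)) 
     + s * flat (flat_step 1) (1 + s * t) * flat 1 (1 + (- s) * t)" for t
  have d: "(bump1 s has_real_derivative D t) (at t)" for t
    unfolding bump1_def[abs_def] D_def by (rule DERIV_mult[OF f f, THEN DERIV_cong]) simp
  have "\<exists>d. (D has_real_derivative d) (at t)" for t
  proof -
    have "(\<lambda>t. flat p (a + b * t)) differentiable (at t)" for p a b
      using f real_differentiable_def by blast
    then have "D differentiable (at t)"
      unfolding D_def[abs_def] by (intro differentiable_add differentiable_mult differentiable_const)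
    then show ?thesis by (simp add: real_differentiable_def)
  qed
  then obtain D2 where D2: "\<And>t. (D has_real_derivative D2 t) (at t)" by metis
  show ?thesis
    unfolding bump_def pd_product[OF d d] pd_product[OF d D2] pd_product[OF D2 d] ..
qed

text \<open>A vanishing integral would make the open set where the continuous non-negative
  \<open>bump s\<close> is non-zero negligible, although it contains 0.\<close>

lemma integral_bump_pos:
  assumes "s > 0" shows "(LBINT x. bump s x) > 0"
proof -
  have c: "continuous_on UNIV (bump s)" using test_function_continuous[OF test_function_bump[OF assms]] .
  have [measurable]: "bump s \<in> borel_measurable borel" using c by (simp add: borel_measurable_continuous_onI)
  have "locally_integrable (\<lambda>x::real^2. 1::real)" by (intro continuous_locally_integrable) simp
  from integrable_bounded_support_mult[OF c test_function_bounded_support[OF test_function_bump[OF assms]] this]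
  have i: "integrable lborel (bump s)" by simp
  have "(LBINT x. bump s x) \<noteq> 0"
  proof
    assume "(LBINT x. bump s x) = 0"
    then have "AE x in lborel. bump s x = 0"
      using integral_nonneg_eq_0_iff_AE[OF i] bump_nonneg by simp
    then have "{x \<in> space lborel. bump s x \<noteq> 0} \<in> null_sets lborel"
      by (subst AE_iff_null_sets) auto
    then have "negligible {x. bump s x \<noteq> 0}"
      unfolding negligible_iff_null_sets by (simp add: null_sets_completionI)
    moreover have "open {x. bump s x \<noteq> 0}"
      using c by (intro open_Collect_neq) auto
    moreover have "0 \<in> {x. bump s x \<noteq> 0}" using bump_0(2)[of s] by auto
    ultimately show False using open_not_negligible by blast
  qed
  moreover have "(LBINT x. bump s x) \<ge> 0" using bump_nonneg by simp
  ultimately show ?thesis by linarith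
qed

definition moll :: "nat \<Rightarrow> real^2 \<Rightarrow> real" where
  "moll k x = inverse (LBINT y. bump (Suc k) y) * bump (Suc k) x"

lemma moll_nonneg: "moll k x \<ge> 0"
  unfolding moll_def using integral_bump_pos[of "Suc k"] bump_nonneg by (intro mult_nonneg_nonneg) auto

lemma moll_support: "2 / Suc k < norm x \<Longrightarrow> moll k x = 0"
  by (simp add: moll_def bump_support)

lemma test_function_moll: "test_function (moll k)"
proof (rule test_functionI)
  have t: "test_function (bump (Suc k))" by (rule test_function_bump) simp
  show "Ck j (moll k)" for j
    using t unfolding moll_def[abs_def] by (intro Ck_cmult) (simp add: test_function_def)
  show "bounded_support (moll k)" unfolding bounded_support_def using moll_support by blast
qed

lemmas moll_continuous = test_function_continuous[OF test_function_moll]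
lemmas moll_bounded_support = test_function_bounded_support[OF test_function_moll]

lemma moll_measurable[measurable]: "moll k \<in> borel_measurable borel"
  using moll_continuous by (simp add: borel_measurable_continuous_onI)

lemma moll_pd_commute: "pd 1 (pd 2 (moll k)) = pd 2 (pd 1 (moll k))"
  unfolding moll_def[abs_def] by (rule bump_pd_commute)

lemma moll_integral: "(LBINT y. moll k y) = 1"
  using integral_bump_pos[of "Suc k"] by (simp add: moll_def)

lemma moll_integral_reflect: "(LBINT y. moll k (x - y)) = 1"
  using moll_integral by (subst integral_reflect) auto

lemma locally_integrable_const: "locally_integrable (\<lambda>x. c :: real)"
  by (rule continuous_locally_integrable) simp

lemma moll_integrable: "integrable lborel (\<lambda>y. moll k (x - y))"
  using integrable_conv[OF moll_continuous moll_bounded_support locally_integrable_const[of 1]] by simp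

lemma conv_moll_uniform:
  assumes "locally_integrable u" "\<And>y. norm (y - x) \<le> 2 / Suc k \<Longrightarrow> \<bar>u y - u x\<bar> \<le> e"
  shows "\<bar>conv (moll k) u x - u x\<bar> \<le> e"
proof -
  have i: "integrable lborel (\<lambda>y. moll k (x - y) * u y)"
    by (rule integrable_conv[OF moll_continuous moll_bounded_support assms(1)])
  have eq: "moll k (x - y) * (u y - u x) = moll k (x - y) * u y - u x * moll k (x - y)" for y
    by (simp add: algebra_simps)
  have i2: "integrable lborel (\<lambda>y. moll k (x - y) * (u y - u x))"
    unfolding eq by (intro Bochner_Integration.integrable_diff i integrable_mult_right moll_integrable)
  have "conv (moll k) u x - u x = (LBINT y. moll k (x - y) * (u y - u x))"
    unfolding eq conv_def using i moll_integrable[of k x] by (simp add: moll_integral_reflect)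
  also have "\<bar>\<dots>\<bar> \<le> (LBINT y. \<bar>moll k (x - y) * (u y - u x)\<bar>)"
    by (rule integral_abs_bound)
  also have "\<dots> \<le> (LBINT y. e * moll k (x - y))"
  proof (rule integral_mono)
    fix y show "\<bar>moll k (x - y) * (u y - u x)\<bar> \<le> e * moll k (x - y)"
    proof (cases "norm (y - x) \<le> 2 / Suc k")
      case True
      then have "\<bar>u y - u x\<bar> * moll k (x - y) \<le> e * moll k (x - y)"
        by (intro mult_right_mono assms moll_nonneg)
      then show ?thesis using moll_nonneg[of k "x - y"] by (simp add: abs_mult mult.commute)
    next
      case False
      then have "moll k (x - y) = 0" by (intro moll_support) (simp add: norm_minus_commute)
      then show ?thesis by simp
    qed
  qed (use i2 moll_integrable[of k x] in auto)
  also have "\<dots> = e" by (simp add: moll_integral_reflect)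
  finally show ?thesis .
qed

section \<open>Mollification of square-integrable functions\<close>

lemma L2_real: "(g :: real^2 \<Rightarrow> real) \<in> L2 \<longleftrightarrow> g \<in> borel_measurable borel \<and> integrable lborel (\<lambda>x. (g x)\<^sup>2)"
  by (simp add: L2_def)

lemma L2_locally_integrable:
  fixes g :: "real^2 \<Rightarrow> real"
  assumes "g \<in> L2" shows "locally_integrable g"
  unfolding locally_integrable_def set_integrable_def
proof safe
  show [measurable]: "g \<in> borel_measurable lborel" using assms by (simp add: L2_real)
  fix K :: "(real^2) set" assume K: "compact K"
  have [measurable]: "K \<in> sets borel" using K by (simp add: borel_compact)
  show "integrable lborel (\<lambda>x. indicator K x *\<^sub>R g x)"
  proof (rule Bochner_Integration.integrable_bound)
    have "integrable lborel (indicator K :: real^2 \<Rightarrow> real)"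
      by (rule integrable_real_indicator) (use K emeasure_compact_finite in auto)
    then show "integrable lborel (\<lambda>x. indicator K x + (g x)\<^sup>2)"
      using assms by (simp add: L2_real)
    show "AE x in lborel. norm (indicator K x *\<^sub>R g x) \<le> norm (indicator K x + (g x)\<^sup>2)"
    proof (rule AE_I2)
      fix x
      have "2 * \<bar>g x\<bar> \<le> 1 + \<bar>g x\<bar>\<^sup>2" using sum_squares_bound[of "1" "\<bar>g x\<bar>"] by simp
      then have "\<bar>g x\<bar> \<le> 1 + (g x)\<^sup>2" by simp
      then show "norm (indicator K x *\<^sub>R g x) \<le> norm (indicator K x + (g x)\<^sup>2)"
        by (cases "x \<in> K") auto
    qed
  qed measurable
qed

lemma L2_add:
  fixes u v :: "real^2 \<Rightarrow> 'b::euclidean_space"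
  assumes "u \<in> L2" "v \<in> L2" shows "(\<lambda>x. u x + v x) \<in> L2"
proof -
  have [measurable]: "u \<in> borel_measurable borel" "v \<in> borel_measurable borel" using assms by (auto simp: L2_def)
  have "integrable lborel (\<lambda>x. (norm (u x + v x))\<^sup>2)"
  proof (rule Bochner_Integration.integrable_bound)
    show "integrable lborel (\<lambda>x. 2 * (norm (u x))\<^sup>2 + 2 * (norm (v x))\<^sup>2)" using assms by (auto simp: L2_def)
    show "AE x in lborel. norm ((norm (u x + v x))\<^sup>2) \<le> norm (2 * (norm (u x))\<^sup>2 + 2 * (norm (v x))\<^sup>2)"
    proof (rule AE_I2)
      fix x
      have "(norm (u x + v x))\<^sup>2 \<le> (norm (u x) + norm (v x))\<^sup>2" by (intro power_mono norm_triangle_ineq) simp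
      also have "\<dots> \<le> 2 * (norm (u x))\<^sup>2 + 2 * (norm (v x))\<^sup>2"
        using sum_squares_bound[of "norm (u x)" "norm (v x)"] by (simp add: power2_sum)
      finally show "norm ((norm (u x + v x))\<^sup>2) \<le> norm (2 * (norm (u x))\<^sup>2 + 2 * (norm (v x))\<^sup>2)" by simp
    qed
  qed measurable
  then show ?thesis by (simp add: L2_def)
qed

lemma L2_cmult: "(f :: real^2 \<Rightarrow> real) \<in> L2 \<Longrightarrow> (\<lambda>x. c * f x) \<in> L2"
  by (auto simp: L2_real power_mult_distrib)

lemma L2_diff:
  fixes f g :: "real^2 \<Rightarrow> real"
  assumes "f \<in> L2" "g \<in> L2" shows "(\<lambda>x. f x - g x) \<in> L2"
  using L2_add[OF assms(1) L2_cmult[OF assms(2), of "-1"]] by simp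

lemma L2_bounded_mult:
  fixes f g :: "real^2 \<Rightarrow> real"
  assumes [measurable]: "f \<in> borel_measurable borel" and "\<And>x. \<bar>f x\<bar> \<le> B" "g \<in> L2"
  shows "(\<lambda>x. f x * g x) \<in> L2"
proof -
  have [measurable]: "g \<in> borel_measurable borel" using assms by (auto simp: L2_real)
  have "integrable lborel (\<lambda>x. (f x * g x)\<^sup>2)"
  proof (rule Bochner_Integration.integrable_bound)
    show "integrable lborel (\<lambda>x. B\<^sup>2 * (g x)\<^sup>2)" using assms by (auto simp: L2_real)
    show "AE x in lborel. norm ((f x * g x)\<^sup>2) \<le> norm (B\<^sup>2 * (g x)\<^sup>2)"
    proof (rule AE_I2)
      fix x have "(f x)\<^sup>2 \<le> B\<^sup>2" using assms(2)[of x] by (simp add: abs_le_square_iff[symmetric])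
      then show "norm ((f x * g x)\<^sup>2) \<le> norm (B\<^sup>2 * (g x)\<^sup>2)"
        by (simp add: power_mult_distrib mult_right_mono)
    qed
  qed measurable
  then show ?thesis by (simp add: L2_real)
qed

lemma L2_mult_integrable:
  fixes f g :: "real^2 \<Rightarrow> real"
  assumes "f \<in> L2" "g \<in> L2" shows "integrable lborel (\<lambda>x. f x * g x)"
proof (rule Bochner_Integration.integrable_bound)
  have [measurable]: "f \<in> borel_measurable borel" "g \<in> borel_measurable borel" using assms by (auto simp: L2_real)
  show "(\<lambda>x. f x * g x) \<in> borel_measurable lborel" by measurable
  show "integrable lborel (\<lambda>x. (f x)\<^sup>2 + (g x)\<^sup>2)" using assms by (auto simp: L2_real)
  show "AE x in lborel. norm (f x * g x) \<le> norm ((f x)\<^sup>2 + (g x)\<^sup>2)"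
  proof (rule AE_I2)
    fix x
    have "2 * \<bar>f x\<bar> * \<bar>g x\<bar> \<le> (f x)\<^sup>2 + (g x)\<^sup>2" using sum_squares_bound[of "\<bar>f x\<bar>" "\<bar>g x\<bar>"] by simp
    moreover have "0 \<le> \<bar>f x\<bar> * \<bar>g x\<bar>" by simp
    ultimately have "\<bar>f x\<bar> * \<bar>g x\<bar> \<le> (f x)\<^sup>2 + (g x)\<^sup>2" by linarith
    then show "norm (f x * g x) \<le> norm ((f x)\<^sup>2 + (g x)\<^sup>2)"
      by (simp add: abs_mult)
  qed
qed

text \<open>The integral of \<open>(s * f + t * g)\<^sup>2\<close> is a non-negative quadratic form
  in \<open>s\<close> and \<open>t\<close>; the inequality comes from its value at
  \<open>s = C\<close>, \<open>t = - B\<close>.\<close>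

lemma L2_Cauchy_Schwarz:
  fixes f g :: "real^2 \<Rightarrow> real"
  assumes "f \<in> L2" "g \<in> L2"
  shows "(LBINT x. f x * g x)\<^sup>2 \<le> (LBINT x. (f x)\<^sup>2) * (LBINT x. (g x)\<^sup>2)"
proof -
  define A B C where "A = (LBINT x. (f x)\<^sup>2)" and "B = (LBINT x. f x * g x)" and "C = (LBINT x. (g x)\<^sup>2)"
  have i: "integrable lborel (\<lambda>x. (f x)\<^sup>2)" "integrable lborel (\<lambda>x. (g x)\<^sup>2)" "integrable lborel (\<lambda>x. f x * g x)"
    using assms L2_mult_integrable by (auto simp: L2_real)
  have q: "0 \<le> s\<^sup>2 * A + 2 * s * t * B + t\<^sup>2 * C" for s t
  proof -
    have "0 \<le> (LBINT x. (s * f x + t * g x)\<^sup>2)" by simp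
    also have "\<dots> = (LBINT x. s\<^sup>2 * (f x)\<^sup>2 + 2 * s * t * (f x * g x) + t\<^sup>2 * (g x)\<^sup>2)"
      by (intro Bochner_Integration.integral_cong) (auto simp: power2_eq_square algebra_simps)
    also have "\<dots> = s\<^sup>2 * A + 2 * s * t * B + t\<^sup>2 * C"
      unfolding A_def B_def C_def using i by simp
    finally show ?thesis .
  qed
  have "A \<ge> 0" "C \<ge> 0" by (auto simp: A_def C_def)
  have "B\<^sup>2 \<le> A * C"
  proof (cases "C = 0")
    case True
    have "B = 0"
    proof (rule ccontr)
      assume "B \<noteq> 0"
      \<comment> \<open>For \<open>C = 0\<close> the form is affine in \<open>t\<close>, and this
        choice of \<open>t\<close> would give it the value -1.\<close>
      then show False using q[of 1 "- (A + 1) / (2 * B)"] True by (simp add: field_simps)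
    qed
    then show ?thesis using True by simp
  next
    case False
    then have "C > 0" using \<open>C \<ge> 0\<close> by simp
    have "0 \<le> C * (A * C - B\<^sup>2)" using q[of C "- B"] by (simp add: power2_eq_square algebra_simps)
    then show ?thesis using \<open>C > 0\<close> by (simp add: zero_le_mult_iff)
  qed
  then show ?thesis by (simp add: A_def B_def C_def)
qed

lemma L2_Cauchy_Schwarz_abs:
  fixes f g :: "real^2 \<Rightarrow> real"
  assumes "f \<in> L2" "g \<in> L2"
  shows "(LBINT x. \<bar>f x * g x\<bar>) \<le> sqrt (LBINT x. (f x)\<^sup>2) * sqrt (LBINT x. (g x)\<^sup>2)"
proof -
  have "(\<lambda>x. \<bar>f x\<bar>) \<in> L2" "(\<lambda>x. \<bar>g x\<bar>) \<in> L2" using assms by (auto simp: L2_real)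
  from L2_Cauchy_Schwarz[OF this] have "(LBINT x. \<bar>f x * g x\<bar>)\<^sup>2 \<le> (LBINT x. (f x)\<^sup>2) * (LBINT x. (g x)\<^sup>2)"
    by (simp add: abs_mult)
  then show ?thesis using real_le_rsqrt real_sqrt_mult by metis
qed

text \<open>Jensen's inequality for the probability density \<open>moll k (x - y)\<close>, followed
  by Tonelli: integrating in \<open>x\<close> first gives total mass 1.\<close>

lemma conv_L2:
  fixes g :: "real^2 \<Rightarrow> real"
  assumes g: "g \<in> L2"
  shows "conv (moll k) g \<in> L2" "(LBINT x. (conv (moll k) g x)\<^sup>2) \<le> (LBINT x. (g x)\<^sup>2)"
proof -
  have lg: "locally_integrable g" using L2_locally_integrable[OF g] .
  have [measurable]: "g \<in> borel_measurable borel" using g by (simp add: L2_real)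
  have ig: "integrable lborel (\<lambda>x. (g x)\<^sup>2)" using g by (simp add: L2_real)
  have "locally_integrable (\<lambda>y. (g y)\<^sup>2)" 
    unfolding locally_integrable_def set_integrable_def
    using integrable_mult_indicator[OF _ ig] by (auto simp: borel_compact)
  note i2 = integrable_conv[OF moll_continuous moll_bounded_support this]
  note i1 = integrable_conv[OF moll_continuous moll_bounded_support lg]
  have "Ck 0 (conv (moll k) g)" by (rule Ck_conv[OF lg test_function_moll])
  then have [measurable]: "conv (moll k) g \<in> borel_measurable borel" by (simp add: borel_measurable_continuous_onI)
  have J: "(conv (moll k) g x)\<^sup>2 \<le> (LBINT y. moll k (x - y) * (g y)\<^sup>2)" for x
  proof -
    let ?c = "conv (moll k) g x"
    \<comment> \<open>Jensen's inequality as non-negativity of a variance: \<open>?c\<close> is the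
      mean of \<open>g\<close> under the density.\<close>
    have "0 \<le> (LBINT y. moll k (x - y) * (g y - ?c)\<^sup>2)"
      using moll_nonneg by simp
    also have "\<dots> = (LBINT y. moll k (x - y) * (g y)\<^sup>2 - 2 * ?c * (moll k (x - y) * g y) + ?c\<^sup>2 * moll k (x - y))"
      by (intro Bochner_Integration.integral_cong) (auto simp: power2_eq_square algebra_simps)
    also have "\<dots> = (LBINT y. moll k (x - y) * (g y)\<^sup>2) - 2 * ?c * ?c + ?c\<^sup>2"
      using i1[of k x] i2[of k x] moll_integrable[of k x] by (simp add: moll_integral_reflect conv_def)
    finally show ?thesis by (simp add: power2_eq_square)
  qed
  have m: "(\<integral>\<^sup>+x. ennreal (moll k (x - y)) \<partial>lborel) = 1" for y
  proof -
    have "(\<integral>\<^sup>+x. ennreal (moll k (x - y)) \<partial>lborel) = (\<integral>\<^sup>+x. ennreal (moll k x) \<partial>lborel)"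
    proof -
      have "(+) (- y) = (\<lambda>x. x - y)" by auto
      then have "distr lborel borel (\<lambda>x. x - y) = lborel" using lborel_distr_plus[of "- y"] by simp
      then show ?thesis
        using nn_integral_distr[of "\<lambda>x. x - y" lborel borel "\<lambda>x. ennreal (moll k x)"] by simp
    qed
    also have "\<dots> = ennreal (LBINT x. moll k x)"
    proof (rule nn_integral_eq_integral)
      have "integrable lborel (\<lambda>x. moll k x * 1)"
        by (rule integrable_bounded_support_mult[OF moll_continuous moll_bounded_support locally_integrable_const])
      then show "integrable lborel (moll k)" by simp
    qed (use moll_nonneg in auto)
    finally show ?thesis by (simp add: moll_integral)
  qed
  have "(\<integral>\<^sup>+x. ennreal ((conv (moll k) g x)\<^sup>2) \<partial>lborel) \<le> (\<integral>\<^sup>+x. (\<integral>\<^sup>+y. ennreal (moll k (x - y) * (g y)\<^sup>2) \<partial>lborel) \<partial>lborel)"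
  proof (rule nn_integral_mono)
    fix x
    have "(\<integral>\<^sup>+y. ennreal (moll k (x - y) * (g y)\<^sup>2) \<partial>lborel) = ennreal (LBINT y. moll k (x - y) * (g y)\<^sup>2)"
      by (rule nn_integral_eq_integral[OF i2]) (use moll_nonneg in auto)
    then show "ennreal ((conv (moll k) g x)\<^sup>2) \<le> (\<integral>\<^sup>+y. ennreal (moll k (x - y) * (g y)\<^sup>2) \<partial>lborel)"
      using J[of x] by (simp add: ennreal_leI)
  qed
  also have "\<dots> = (\<integral>\<^sup>+y. (\<integral>\<^sup>+x. ennreal (moll k (x - y) * (g y)\<^sup>2) \<partial>lborel) \<partial>lborel)"
    by (rule lborel_pair.Fubini') measurable
  also have "\<dots> = (\<integral>\<^sup>+y. ennreal ((g y)\<^sup>2) * (\<integral>\<^sup>+x. ennreal (moll k (x - y)) \<partial>lborel) \<partial>lborel)"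
  proof (rule nn_integral_cong)
    fix y
    have "(\<integral>\<^sup>+x. ennreal (moll k (x - y) * (g y)\<^sup>2) \<partial>lborel) = (\<integral>\<^sup>+x. ennreal ((g y)\<^sup>2) * ennreal (moll k (x - y)) \<partial>lborel)"
      by (intro nn_integral_cong) (simp add: ennreal_mult' moll_nonneg ennreal_mult mult.commute)
    also have "\<dots> = ennreal ((g y)\<^sup>2) * (\<integral>\<^sup>+x. ennreal (moll k (x - y)) \<partial>lborel)"
      by (rule nn_integral_cmult) measurable
    finally show "(\<integral>\<^sup>+x. ennreal (moll k (x - y) * (g y)\<^sup>2) \<partial>lborel) = ennreal ((g y)\<^sup>2) * (\<integral>\<^sup>+x. ennreal (moll k (x - y)) \<partial>lborel)" .
  qed
  also have "\<dots> = (\<integral>\<^sup>+y. ennreal ((g y)\<^sup>2) \<partial>lborel)" by (simp add: m)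
  also have "\<dots> = ennreal (LBINT y. (g y)\<^sup>2)" by (rule nn_integral_eq_integral[OF ig]) auto
  finally have le: "(\<integral>\<^sup>+x. ennreal ((conv (moll k) g x)\<^sup>2) \<partial>lborel) \<le> ennreal (LBINT y. (g y)\<^sup>2)" .
  have i: "integrable lborel (\<lambda>x. (conv (moll k) g x)\<^sup>2)"
    by (rule integrableI_nonneg) (auto intro: le_less_trans[OF le])
  then show "conv (moll k) g \<in> L2" by (simp add: L2_real)
  show "(LBINT x. (conv (moll k) g x)\<^sup>2) \<le> (LBINT x. (g x)\<^sup>2)"
    using le nn_integral_eq_integral[OF i] by (simp add: ennreal_le_iff)
qed

text \<open>Lebesgue measurability already provides continuous functions converging almost
  everywhere. Clipping them to \<open>[-M, M]\<close> and multiplying by a cutoff that is 1 on the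
  ball of radius \<open>R\<close> leaves the limit unchanged and supplies the bounds needed for
  dominated convergence.\<close>

lemma AE_limit_continuous:
  fixes g :: "real^2 \<Rightarrow> real"
  assumes "g \<in> borel_measurable borel" "\<And>x. \<bar>g x\<bar> \<le> M" "\<And>x. R < norm x \<Longrightarrow> g x = 0"
  obtains c where "\<And>n. continuous_on UNIV (c n)" "\<And>n x. \<bar>c n x\<bar> \<le> M" "\<And>n x. R + 1 < norm x \<Longrightarrow> c n x = 0"
    "AE x in lborel. (\<lambda>n. c n x) \<longlonglongrightarrow> g x"
proof -
  have "M \<ge> 0" using assms(2)[of 0] by linarith
  have "g \<in> borel_measurable lebesgue" using assms(1) by (intro measurable_completion) simp
  then have "g measurable_on UNIV" by (rule lebesgue_measurable_imp_measurable_on_real) auto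
  then obtain N h where N: "negligible N" and h: "\<And>n. continuous_on UNIV (h n)"
    and lim: "\<And>x. x \<notin> N \<Longrightarrow> (\<lambda>n. h n x) \<longlonglongrightarrow> g x"
    unfolding measurable_on_def by auto
  define \<theta> where "\<theta> x = max 0 (min 1 (R + 1 - norm x))" for x :: "real^2"
  define c where "c n x = \<theta> x * max (- M) (min M (h n x))" for n x
  have \<theta>: "0 \<le> \<theta> x" "\<theta> x \<le> 1" for x by (auto simp: \<theta>_def)
  show thesis
  proof (rule that[of c])
    show "continuous_on UNIV (c n)" for n
      unfolding c_def[abs_def] \<theta>_def by (intro continuous_intros h)
    show "\<bar>c n x\<bar> \<le> M" for n x
    proof -
      have "\<bar>c n x\<bar> \<le> 1 * M" unfolding c_def abs_mult 
        by (rule mult_mono) (use \<theta>[of x] \<open>M \<ge> 0\<close> in auto)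
      then show ?thesis by simp
    qed
    show "c n x = 0" if "R + 1 < norm x" for n x
      using that by (simp add: c_def \<theta>_def)
    have "AE x in lebesgue. x \<notin> N"
      using N unfolding negligible_iff_null_sets by (rule AE_not_in)
    then have "AE x in lborel. x \<notin> N" by (simp add: AE_completion_iff)
    then show "AE x in lborel. (\<lambda>n. c n x) \<longlonglongrightarrow> g x"
    proof (rule AE_mp, intro AE_I2 impI)
      fix x assume "x \<notin> N"
      then have "(\<lambda>n. c n x) \<longlonglongrightarrow> \<theta> x * max (- M) (min M (g x))"
        unfolding c_def by (intro tendsto_intros lim)
      moreover have "\<theta> x * max (- M) (min M (g x)) = g x"
      proof (cases "R < norm x")
        case True then show ?thesis using assms(3)[of x] \<open>M \<ge> 0\<close> by (simp add: max_def)
      next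
        case False
        then have "\<theta> x = 1" by (auto simp: \<theta>_def)
        then show ?thesis using assms(2)[of x] by (auto simp: abs_le_iff max_def min_def)
      qed
      ultimately show "(\<lambda>n. c n x) \<longlonglongrightarrow> g x" by simp
    qed
  qed
qed

lemma integrable_ball_const: "integrable lborel (\<lambda>x::real^2. B * indicator (cball 0 r) x :: real)"
  by (intro integrable_mult_right integrable_real_indicator) (use emeasure_compact_finite[OF compact_cball] in auto)

lemma power2_sum3_le: "(a + b + c)\<^sup>2 \<le> 3 * a\<^sup>2 + 3 * b\<^sup>2 + 3 * (c::real)\<^sup>2"
proof -
  have "0 \<le> (a - b)\<^sup>2 + (b - c)\<^sup>2 + (a - c)\<^sup>2" by simp
  then show ?thesis by (simp add: power2_eq_square algebra_simps)
qed

lemma bounded_support_L2: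
  fixes g :: "real^2 \<Rightarrow> real"
  assumes [measurable]: "g \<in> borel_measurable borel" and "\<And>x. \<bar>g x\<bar> \<le> M" "\<And>x. R < norm x \<Longrightarrow> g x = 0"
  shows "g \<in> L2"
proof -
  have "integrable lborel (\<lambda>x. (g x)\<^sup>2)"
  proof (rule Bochner_Integration.integrable_bound[OF integrable_ball_const[of "M\<^sup>2" R]])
    show "AE x in lborel. norm ((g x)\<^sup>2) \<le> norm (M\<^sup>2 * indicator (cball 0 R) x)"
    proof (rule AE_I2)
      fix x show "norm ((g x)\<^sup>2) \<le> norm (M\<^sup>2 * indicator (cball 0 R) x)"
        using assms(2)[of x] assms(3)[of x] power_mono[OF assms(2)[of x], of 2]
        by (cases "norm x \<le> R") auto
    qed
  qed measurable
  then show ?thesis by (simp add: L2_real)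
qed

text \<open>Truncation of \<open>g\<close> both in space and in value at level \<open>n\<close>; at
  each point it is exact from some \<open>n\<close> on, and the error is dominated by
  \<open>g\<^sup>2\<close>.\<close>

lemma L2_approx_bounded:
  fixes g :: "real^2 \<Rightarrow> real"
  assumes g: "g \<in> L2" and "e > 0"
  shows "\<exists>h M R. h \<in> borel_measurable borel \<and> (\<forall>x. \<bar>h x\<bar> \<le> M) \<and> (\<forall>x. R < norm x \<longrightarrow> h x = 0)
    \<and> (LBINT x. (h x - g x)\<^sup>2) < e"
proof -
  have [measurable]: "g \<in> borel_measurable borel" using g by (simp add: L2_real)
  define h where "h n x = indicator (cball 0 (real n)) x * max (- real n) (min (real n) (g x))" for n x
  have [measurable]: "h n \<in> borel_measurable borel" for n unfolding h_def[abs_def]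
    by (intro borel_measurable_times borel_measurable_indicator borel_measurable_max borel_measurable_min borel_measurable_const) auto
  have "(\<lambda>n. LBINT x. (h n x - g x)\<^sup>2) \<longlonglongrightarrow> (LINT x|(lborel :: (real^2) measure). 0)"
  proof (rule integral_dominated_convergence[where w="\<lambda>x. (g x)\<^sup>2"])
    show "integrable lborel (\<lambda>x. (g x)\<^sup>2)" using g by (simp add: L2_real)
    show "AE x in lborel. (\<lambda>n. (h n x - g x)\<^sup>2) \<longlonglongrightarrow> 0"
    proof (rule AE_I2)
      fix x
      obtain n0 where n0: "norm x \<le> real n0" "\<bar>g x\<bar> \<le> real n0"
        using real_arch_simple[of "max (norm x) \<bar>g x\<bar>"] by auto
      have "(h n x - g x)\<^sup>2 = 0" if "n \<ge> n0" for n
      proof -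
        have "norm x \<le> real n" "\<bar>g x\<bar> \<le> real n" using n0 that by (auto intro: order_trans)
        then show ?thesis by (auto simp: h_def abs_le_iff max_def min_def)
      qed
      then have "\<forall>\<^sub>F n in sequentially. (h n x - g x)\<^sup>2 = 0" using eventually_sequentially by blast
      then show "(\<lambda>n. (h n x - g x)\<^sup>2) \<longlonglongrightarrow> 0" by (rule tendsto_eventually)
    qed
    show "AE x in lborel. norm ((h n x - g x)\<^sup>2) \<le> (g x)\<^sup>2" for n
    proof (rule AE_I2)
      fix x
      have "\<bar>h n x - g x\<bar> \<le> \<bar>g x\<bar>" by (cases "norm x \<le> real n") (auto simp: h_def max_def min_def)
      then show "norm ((h n x - g x)\<^sup>2) \<le> (g x)\<^sup>2" by (simp add: abs_le_square_iff)
    qed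
  qed measurable
  then have "\<forall>\<^sub>F n in sequentially. (LBINT x. (h n x - g x)\<^sup>2) < e"
    using \<open>e > 0\<close> by (intro order_tendstoD) auto
  then obtain n where n: "(LBINT x. (h n x - g x)\<^sup>2) < e" using eventually_happens'[OF sequentially_bot] by blast
  moreover have "\<bar>h n x\<bar> \<le> real n" for x
    by (cases "norm x \<le> real n") (auto simp: h_def max_def min_def abs_if)
  moreover have "h n x = 0" if "real n < norm x" for x using that by (auto simp: h_def)
  ultimately show ?thesis by (intro exI[of _ "h n"] exI[of _ "real n"]) auto
qed

lemma L2_approx_continuous:
  fixes g :: "real^2 \<Rightarrow> real"
  assumes g: "g \<in> L2" and "e > 0"
  obtains c where "continuous_on UNIV c" "bounded_support c" "c \<in> L2" "(LBINT x. (c x - g x)\<^sup>2) < e"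
proof -
  have e4: "e/4 > 0" using \<open>e > 0\<close> by simp
  obtain h M R where [measurable]: "h \<in> borel_measurable borel" and h: "\<And>x. \<bar>h x\<bar> \<le> M" "\<And>x. R < norm x \<Longrightarrow> h x = 0"
    and hg: "(LBINT x. (h x - g x)\<^sup>2) < e/4"
    using L2_approx_bounded[OF g e4] by blast
  have hL: "h \<in> L2" by (rule bounded_support_L2[OF _ h]) measurable
  obtain c where c: "\<And>n. continuous_on UNIV (c n)" "\<And>n x. \<bar>c n x\<bar> \<le> M" "\<And>n x. R + 1 < norm x \<Longrightarrow> c n x = 0"
    "AE x in lborel. (\<lambda>n. c n x) \<longlonglongrightarrow> h x"
    by (rule AE_limit_continuous[of h M R]) (use h in auto)
  have [measurable]: "c n \<in> borel_measurable borel" for n using c(1) by (simp add: borel_measurable_continuous_onI)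
  have "(\<lambda>n. LBINT x. (c n x - h x)\<^sup>2) \<longlonglongrightarrow> (LINT x|(lborel :: (real^2) measure). 0)"
  proof (rule integral_dominated_convergence[OF _ _ integrable_ball_const[of "(2*M)\<^sup>2" "R+1"]])
    show "AE x in lborel. (\<lambda>n. (c n x - h x)\<^sup>2) \<longlonglongrightarrow> 0"
      using c(4)
    proof (rule AE_mp, intro AE_I2 impI)
      fix x assume "(\<lambda>n. c n x) \<longlonglongrightarrow> h x"
      then have "(\<lambda>n. (c n x - h x)\<^sup>2) \<longlonglongrightarrow> (h x - h x)\<^sup>2" by (intro tendsto_intros)
      then show "(\<lambda>n. (c n x - h x)\<^sup>2) \<longlonglongrightarrow> 0" by simp
    qed
    show "AE x in lborel. norm ((c n x - h x)\<^sup>2) \<le> (2*M)\<^sup>2 * indicator (cball 0 (R+1)) x" for n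
    proof (rule AE_I2)
      fix x
      have "\<bar>c n x - h x\<bar> \<le> 2 * M" using c(2)[of n x] h(1)[of x] by linarith
      then have "\<bar>c n x - h x\<bar>\<^sup>2 \<le> (2 * M)\<^sup>2" by (rule power_mono) auto
      then show "norm ((c n x - h x)\<^sup>2) \<le> (2*M)\<^sup>2 * indicator (cball 0 (R+1)) x"
        using c(3)[of x n] h(2)[of x] by (cases "norm x \<le> R + 1") auto
    qed
  qed measurable
  then have "\<forall>\<^sub>F n in sequentially. (LBINT x. (c n x - h x)\<^sup>2) < e/4"
    using \<open>e > 0\<close> by (intro order_tendstoD) auto
  then obtain n where n: "(LBINT x. (c n x - h x)\<^sup>2) < e/4" using eventually_happens'[OF sequentially_bot] by blast
  have cL: "c n \<in> L2" by (rule bounded_support_L2[OF _ c(2) c(3)]) measurable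
  have i: "integrable lborel (\<lambda>x. (c n x - h x)\<^sup>2)" "integrable lborel (\<lambda>x. (h x - g x)\<^sup>2)" "integrable lborel (\<lambda>x. (c n x - g x)\<^sup>2)"
    using L2_diff[OF cL hL] L2_diff[OF hL g] L2_diff[OF cL g] by (auto simp: L2_real)
  have "(LBINT x. (c n x - g x)\<^sup>2) \<le> (LBINT x. 2 * (c n x - h x)\<^sup>2 + 2 * (h x - g x)\<^sup>2)"
  proof (rule integral_mono)
    fix x
    have "0 \<le> ((c n x - h x) - (h x - g x))\<^sup>2" by simp
    then show "(c n x - g x)\<^sup>2 \<le> 2 * (c n x - h x)\<^sup>2 + 2 * (h x - g x)\<^sup>2"
      by (simp add: power2_eq_square algebra_simps)
  qed (use i in auto)
  also have "\<dots> = 2 * (LBINT x. (c n x - h x)\<^sup>2) + 2 * (LBINT x. (h x - g x)\<^sup>2)"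
    using i by simp
  also have "\<dots> < e" using n hg by simp
  finally have "(LBINT x. (c n x - g x)\<^sup>2) < e" .
  moreover have "bounded_support (c n)" unfolding bounded_support_def using c(3) by blast
  ultimately show thesis using that[of "c n"] c(1) cL by auto
qed

lemma conv_diff_left:
  assumes "continuous_on UNIV f" "bounded_support f" "locally_integrable g" "locally_integrable h"
  shows "conv f (\<lambda>x. g x - h x) x = conv f g x - conv f h x"
  unfolding conv_def right_diff_distrib
  by (rule Bochner_Integration.integral_diff[OF integrable_conv[OF assms(1,2,3)] integrable_conv[OF assms(1,2,4)]])

lemma conv_moll_tendsto_uniform:
  assumes "continuous_on UNIV c" "bounded_support c" "e > 0"
  shows "\<forall>\<^sub>F k in sequentially. \<forall>x. \<bar>conv (moll k) c x - c x\<bar> \<le> e"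
proof -
  obtain d where d: "d > 0" "\<And>x y. norm (y - x) < d \<Longrightarrow> \<bar>c y - c x\<bar> < e"
    using bounded_support_uniformly_continuous[OF assms] by metis
  have "(\<lambda>k. 2 / real (Suc k)) \<longlonglongrightarrow> 0"
    by (rule LIMSEQ_Suc) (rule lim_const_over_n)
  then have "\<forall>\<^sub>F k in sequentially. 2 / real (Suc k) < d" using d(1) by (rule order_tendstoD)
  then show ?thesis
  proof (rule eventually_mono, intro allI)
    fix k x assume k: "2 / real (Suc k) < d"
    show "\<bar>conv (moll k) c x - c x\<bar> \<le> e"
    proof (rule conv_moll_uniform[OF continuous_locally_integrable[OF assms(1)]])
      fix y assume "norm (y - x) \<le> 2 / real (Suc k)"
      then show "\<bar>c y - c x\<bar> \<le> e" using d(2)[of y x] k by linarith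
    qed
  qed
qed

lemma conv_moll_support:
  assumes "\<And>x. R < norm x \<Longrightarrow> c x = 0" "R + 2 < norm x"
  shows "conv (moll k) c x = 0"
proof (rule conv_support[of 2 _ R])
  show "moll k x = 0" if "2 < norm x" for x
  proof (rule moll_support)
    have "2 / real (Suc k) \<le> 2" by (simp add: field_simps)
    then show "2 / real (Suc k) < norm x" using that by linarith
  qed
qed (use assms in auto)

text \<open>Density argument: for a continuous \<open>c\<close> of compact support the convergence
  is uniform on a fixed ball, and the contraction property of mollification transfers it to
  \<open>g\<close>.\<close>

lemma conv_moll_L2_tendsto:
  fixes g :: "real^2 \<Rightarrow> real"
  assumes g: "g \<in> L2"
  shows "(\<lambda>k. LBINT x. (conv (moll k) g x - g x)\<^sup>2) \<longlonglongrightarrow> 0"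
proof (rule tendstoI)
  fix e :: real assume "e > 0"
  have e12: "e/12 > 0" using \<open>e > 0\<close> by simp
  obtain c where c: "continuous_on UNIV c" "bounded_support c" "c \<in> L2" and cg: "(LBINT x. (c x - g x)\<^sup>2) < e/12"
    by (rule L2_approx_continuous[OF g e12])
  obtain R where R: "R > 0" "\<And>x. R < norm x \<Longrightarrow> c x = 0" using bounded_supportE[OF c(2)] by metis
  define V where "V = measure lborel (cball (0::real^2) (R + 2))"
  have "V \<ge> 0" by (simp add: V_def)
  define d where "d = sqrt (e / (12 * (V + 1)))"
  have d: "d > 0" "d\<^sup>2 * V \<le> e/12" using \<open>e > 0\<close> \<open>V \<ge> 0\<close> by (auto simp: d_def field_simps)
  have lc: "locally_integrable c" and lg: "locally_integrable g" using c g L2_locally_integrable by auto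
  from conv_moll_tendsto_uniform[OF c(1,2) d(1)]
  show "\<forall>\<^sub>F k in sequentially. dist (LBINT x. (conv (moll k) g x - g x)\<^sup>2) 0 < e"
  proof (rule eventually_mono)
    fix k assume k: "\<forall>x. \<bar>conv (moll k) c x - c x\<bar> \<le> d"
    let ?m = "conv (moll k)"
    have D: "(\<lambda>x. c x - g x) \<in> L2" using L2_diff c(3) g by blast
    have L: "?m c \<in> L2" "?m g \<in> L2" "?m (\<lambda>x. c x - g x) \<in> L2" using conv_L2(1) c g D by auto
    have i: "integrable lborel (\<lambda>x. (?m g x - g x)\<^sup>2)" "integrable lborel (\<lambda>x. (?m c x - c x)\<^sup>2)"
      "integrable lborel (\<lambda>x. (c x - g x)\<^sup>2)" "integrable lborel (\<lambda>x. (?m (\<lambda>x. c x - g x) x)\<^sup>2)"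
      using L2_diff[OF L(2) g] L2_diff[OF L(1) c(3)] D L(3) by (auto simp: L2_real)
    have "(LBINT x. (?m g x - g x)\<^sup>2) \<le> (LBINT x. 3 * (?m (\<lambda>x. c x - g x) x)\<^sup>2 + 3 * (?m c x - c x)\<^sup>2 + 3 * (c x - g x)\<^sup>2)"
    proof (rule integral_mono)
      fix x
      \<comment> \<open>Each of the three squared terms integrates to at most e/12, the first by
        contraction and the second by the choice of \<open>d\<close>; with the factor 3 the sum
        stays below e.\<close>
      have eq: "?m g x - g x = - ?m (\<lambda>x. c x - g x) x + (?m c x - c x) + (c x - g x)"
        by (simp add: conv_diff_left[OF moll_continuous moll_bounded_support lc lg])
      show "(?m g x - g x)\<^sup>2 \<le> 3 * (?m (\<lambda>x. c x - g x) x)\<^sup>2 + 3 * (?m c x - c x)\<^sup>2 + 3 * (c x - g x)\<^sup>2"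
        unfolding eq using power2_sum3_le[of "- ?m (\<lambda>x. c x - g x) x" "?m c x - c x" "c x - g x"]
        by (simp only: power2_minus)
    qed (use i in auto)
    also have "\<dots> = 3 * (LBINT x. (?m (\<lambda>x. c x - g x) x)\<^sup>2) + 3 * (LBINT x. (?m c x - c x)\<^sup>2) + 3 * (LBINT x. (c x - g x)\<^sup>2)"
      using i by simp
    also have "(LBINT x. (?m (\<lambda>x. c x - g x) x)\<^sup>2) \<le> (LBINT x. (c x - g x)\<^sup>2)"
      by (rule conv_L2(2)[OF D])
    also have "(LBINT x. (?m c x - c x)\<^sup>2) \<le> (LBINT x. d\<^sup>2 * indicator (cball (0::real^2) (R + 2)) x)"
    proof (rule integral_mono[OF i(2) integrable_ball_const])
      fix x
      show "(?m c x - c x)\<^sup>2 \<le> d\<^sup>2 * indicator (cball 0 (R + 2)) x"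
      proof (cases "norm x \<le> R + 2")
        case True
        have "\<bar>?m c x - c x\<bar>\<^sup>2 \<le> d\<^sup>2" using k by (intro power_mono) auto
        then show ?thesis using True by simp
      next
        case False
        then show ?thesis using R(2)[of x] conv_moll_support[OF R(2), where x=x and k=k] by auto
      qed
    qed
    also have "\<dots> = d\<^sup>2 * V" by (simp add: V_def)
    finally have "(LBINT x. (?m g x - g x)\<^sup>2) \<le> 3 * (e/12) + 3 * (e/12) + 3 * (LBINT x. (c x - g x)\<^sup>2)"
      using d(2) cg by simp
    also have "\<dots> < e" using cg \<open>e > 0\<close> by simp
    finally show "dist (LBINT x. (?m g x - g x)\<^sup>2) 0 < e" by simp
  qed
qed

section \<open>Weak derivatives\<close>

text \<open>For the second fact the derivative is put on \<open>f\<close>, for the third on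
  \<open>moll k\<close>, whose mixed partials are known to commute. For \<open>f\<close> itself
  second derivatives need not exist.\<close>

lemma conv_moll_C1c:
  assumes "C1c f"
  shows "test_function (conv (moll k) f)" "pd i (conv (moll k) f) = conv (moll k) (pd i f)"
    "pd 1 (pd 2 (conv (moll k) f)) = pd 2 (pd 1 (conv (moll k) f))"
proof -
  have c: "continuous_on UNIV f" "bounded_support f" "continuous_on UNIV (pd i f)" "bounded_support (pd i f)" for i
    using assms C1c_continuous bounded_support_pd by (auto simp: C1c_def)
  have [measurable]: "f \<in> borel_measurable borel" "pd i f \<in> borel_measurable borel" for i
    using c by (auto simp: borel_measurable_continuous_onI)
  have lf: "locally_integrable f" using c continuous_locally_integrable by auto
  show t: "test_function (conv (moll k) f)"
    by (rule test_function_conv[OF test_function_moll lf c(2)])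
  have eq: "conv (moll k) f = conv f (moll k)" by (rule ext, rule conv_commute) auto
  have "pd i (conv f (moll k)) x = conv (pd i f) (moll k) x" for x
    using pd_eq[OF conv_has_derivative[OF assms continuous_locally_integrable[OF moll_continuous[of k]], of x], of i] exhaust_2[of i]
    by (auto simp: axis_def)
  then show "pd i (conv (moll k) f) = conv (moll k) (pd i f)"
    unfolding eq by (auto simp: fun_eq_iff conv_commute)
  have p: "pd i (conv g f) = conv (pd i g) f" if "test_function g" for i g
  proof
    fix x show "pd i (conv g f) x = conv (pd i g) f x"
      using pd_eq[OF conv_has_derivative[OF test_function_C1c[OF that] lf, of x], of i] exhaust_2[of i]
      by (auto simp: axis_def)
  qed
  show "pd 1 (pd 2 (conv (moll k) f)) = pd 2 (pd 1 (conv (moll k) f))"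
    by (simp add: p test_function_moll test_function_pd moll_pd_commute)
qed

lemma conv_moll_integral_tendsto:
  assumes "continuous_on UNIV c" "bounded_support c" "locally_integrable u"
  shows "(\<lambda>k. LBINT x. conv (moll k) c x * u x) \<longlonglongrightarrow> (LBINT x. c x * u x)"
proof (rule tendstoI)
  fix e :: real assume "e > 0"
  obtain R where R: "R > 0" "\<And>x. R < norm x \<Longrightarrow> c x = 0" using bounded_supportE[OF assms(2)] by metis
  define V where "V = (LBINT x. \<bar>indicator (cball 0 (R + 2)) x * u x\<bar>)"
  have iV: "integrable lborel (\<lambda>x. \<bar>indicator (cball 0 (R + 2)) x * u x\<bar>)"
    by (intro integrable_abs locally_integrable_cball assms)
  have "V \<ge> 0" by (simp add: V_def)
  define d where "d = e / (V + 1)"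
  have d: "d > 0" using \<open>e > 0\<close> \<open>V \<ge> 0\<close> by (simp add: d_def)
  have dV: "d * V < e"
  proof -
    have "d * V < d * (V + 1)" using d by simp
    also have "\<dots> = e" using \<open>V \<ge> 0\<close> by (simp add: d_def)
    finally show ?thesis .
  qed
  from conv_moll_tendsto_uniform[OF assms(1,2) d]
  show "\<forall>\<^sub>F k in sequentially. dist (LBINT x. conv (moll k) c x * u x) (LBINT x. c x * u x) < e"
  proof (rule eventually_mono)
    fix k assume k: "\<forall>x. \<bar>conv (moll k) c x - c x\<bar> \<le> d"
    have t: "test_function (conv (moll k) c)"
      by (rule test_function_conv[OF test_function_moll continuous_locally_integrable[OF assms(1)] assms(2)])
    have i: "integrable lborel (\<lambda>x. c x * u x)" "integrable lborel (\<lambda>x. conv (moll k) c x * u x)"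
      by (rule integrable_bounded_support_mult[OF assms])
         (rule integrable_test_function_mult[OF t t assms(3)])
    have "\<bar>(LBINT x. conv (moll k) c x * u x) - (LBINT x. c x * u x)\<bar> = \<bar>LBINT x. conv (moll k) c x * u x - c x * u x\<bar>"
      using i by simp
    also have "\<dots> \<le> (LBINT x. \<bar>conv (moll k) c x * u x - c x * u x\<bar>)" by (rule integral_abs_bound)
    also have "\<dots> \<le> (LBINT x. d * \<bar>indicator (cball 0 (R + 2)) x * u x\<bar>)"
    proof (rule integral_mono)
      fix x show "\<bar>conv (moll k) c x * u x - c x * u x\<bar> \<le> d * \<bar>indicator (cball 0 (R + 2)) x * u x\<bar>"
      proof (cases "norm x \<le> R + 2")
        case True
        have "\<bar>conv (moll k) c x - c x\<bar> * \<bar>u x\<bar> \<le> d * \<bar>u x\<bar>" using k by (intro mult_right_mono) auto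
        then show ?thesis using True by (simp add: abs_mult flip: left_diff_distrib)
      next
        case False
        then show ?thesis using R(2)[of x] conv_moll_support[OF R(2), where x=x and k=k] by auto
      qed
    qed (use i iV in auto)
    also have "\<dots> = d * V" by (simp add: V_def)
    finally show "dist (LBINT x. conv (moll k) c x * u x) (LBINT x. c x * u x) < e"
      using dV by (simp add: dist_real_def)
  qed
qed

text \<open>Mollifying \<open>f\<close> gives genuine test functions; these and their partial
  derivatives converge uniformly with supports in a common ball.\<close>

lemma weak_partial_C1c:
  fixes u :: "real^2 \<Rightarrow> real"
  assumes w: "has_weak_partial i u g" and f: "C1c f"
  shows "(LBINT x. pd i f x * u x) = - (LBINT x. f x * g x)"
proof -
  have c: "continuous_on UNIV f" "bounded_support f" "continuous_on UNIV (pd i f)" "bounded_support (pd i f)"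
    using f C1c_continuous bounded_support_pd by (auto simp: C1c_def)
  have l: "locally_integrable u" "locally_integrable g" using w by (auto simp: has_weak_partial_def)
  have "(LBINT x. conv (moll k) (pd i f) x * u x) = - (LBINT x. conv (moll k) f x * g x)" for k
  proof -
    have "(LBINT x. pd i (conv (moll k) f) x * u x) = - (LBINT x. conv (moll k) f x * g x)"
      using w conv_moll_C1c(1)[OF f, of k] unfolding has_weak_partial_def pd_def by auto
    then show ?thesis by (simp add: conv_moll_C1c(2)[OF f])
  qed
  then have "(\<lambda>k. LBINT x. conv (moll k) (pd i f) x * u x) \<longlonglongrightarrow> - (LBINT x. f x * g x)"
    using tendsto_minus[OF conv_moll_integral_tendsto[OF c(1,2) l(2)]] by simp
  then show ?thesis
    using LIMSEQ_unique conv_moll_integral_tendsto[OF c(3,4) l(1)] by blast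
qed

text \<open>The integral of \<open>df \<and> db\<close> vanishes. After mollifying \<open>f\<close>,
  both sides equal minus the integral of \<open>b\<close> against the mixed second derivative of
  \<open>f\<close>, so only first weak derivatives of \<open>b\<close> are involved.\<close>

lemma C1c_jacobian:
  fixes b :: "real^2 \<Rightarrow> real"
  assumes w: "has_weak_partial 1 b b1" "has_weak_partial 2 b b2" and f: "C1c f"
  shows "(LBINT x. pd 1 f x * b2 x) = (LBINT x. pd 2 f x * b1 x)"
proof -
  have c: "continuous_on UNIV (pd i f)" "bounded_support (pd i f)" for i
    using f C1c_continuous bounded_support_pd by (auto simp: C1c_def)
  have l: "locally_integrable b1" "locally_integrable b2" using w by (auto simp: has_weak_partial_def)
  have "(LBINT x. conv (moll k) (pd 1 f) x * b2 x) = (LBINT x. conv (moll k) (pd 2 f) x * b1 x)" for k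
  proof -
    let ?f = "conv (moll k) f"
    have t: "test_function (pd i ?f)" for i by (rule test_function_pd[OF conv_moll_C1c(1)[OF f]])
    have "(LBINT x. pd 1 (pd 2 ?f) x * b x) = - (LBINT x. pd 2 ?f x * b1 x)"
      using weak_partial_C1c[OF w(1) test_function_C1c[OF t]] .
    moreover have "(LBINT x. pd 2 (pd 1 ?f) x * b x) = - (LBINT x. pd 1 ?f x * b2 x)"
      using weak_partial_C1c[OF w(2) test_function_C1c[OF t]] .
    ultimately show ?thesis using conv_moll_C1c(3)[OF f, of k] by (simp add: conv_moll_C1c(2)[OF f])
  qed
  then have "(\<lambda>k. LBINT x. conv (moll k) (pd 1 f) x * b2 x) \<longlonglongrightarrow> (LBINT x. pd 2 f x * b1 x)"
    using conv_moll_integral_tendsto[OF c l(1)] by simp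
  then show ?thesis
    using LIMSEQ_unique conv_moll_integral_tendsto[OF c l(2)] by blast
qed

text \<open>The convolution of \<open>f\<close> with the constant 1 is a constant function; its
  derivative is 0 and also the integral of \<open>pd i f\<close>.\<close>

lemma C1c_integral_pd:
  assumes "C1c f" shows "(LBINT x. pd i f x) = 0"
proof -
  have c: "continuous_on UNIV f" "bounded_support f" "continuous_on UNIV (pd i f)" "bounded_support (pd i f)" for i
    using assms C1c_continuous bounded_support_pd by (auto simp: C1c_def)
  have [measurable]: "f \<in> borel_measurable borel" "pd i f \<in> borel_measurable borel" for i
    using c by (auto simp: borel_measurable_continuous_onI)
  have e: "conv g (\<lambda>x. 1) = (\<lambda>x. LBINT y. g y)" if "g \<in> borel_measurable borel" for g
    using integral_reflect[OF that] by (auto simp: conv_def)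
  have "pd i (conv f (\<lambda>x. 1)) 0 = conv (pd i f) (\<lambda>x. 1) 0"
    using pd_eq[OF conv_has_derivative[OF assms locally_integrable_const[of 1], of 0], of i] exhaust_2[of i]
    by (auto simp: axis_def)
  moreover have "pd i (\<lambda>x. a) 0 = 0" for a by (subst pd_eq[of _ "\<lambda>_. 0"]) auto
  ultimately show ?thesis by (simp add: e)
qed

text \<open>The fundamental lemma of the calculus of variations. It is extended from smooth to
  continuous test functions by mollification, and then to the sign of \<open>d\<close> on a ball by
  dominated convergence.\<close>

lemma weak_zero_AE:
  fixes d :: "real^2 \<Rightarrow> real"
  assumes l: "locally_integrable d" and z: "\<And>f. test_function f \<Longrightarrow> (LBINT x. f x * d x) = 0"
  shows "AE x in lborel. d x = 0"
proof -
  have [measurable]: "d \<in> borel_measurable borel" using l by (simp add: locally_integrable_def)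
  have zc: "(LBINT x. c x * d x) = 0" if c: "continuous_on UNIV c" "bounded_support c" for c
  proof -
    have "(LBINT x. conv (moll k) c x * d x) = 0" for k
      by (rule z, rule test_function_conv[OF test_function_moll continuous_locally_integrable[OF c(1)] c(2)])
    then show ?thesis using conv_moll_integral_tendsto[OF c l] by (simp add: LIMSEQ_const_iff)
  qed
  have "AE x in lborel. indicator (cball 0 (real n)) x * d x = 0" for n
  proof -
    define h where "h x = indicator (cball 0 (real n)) x * (if 0 \<le> d x then 1 else -1 :: real)" for x
    have hb: "\<bar>h x\<bar> \<le> 1" for x by (auto simp: h_def indicator_def)
    have hm: "h \<in> borel_measurable borel" unfolding h_def[abs_def]
      by (intro borel_measurable_times borel_measurable_indicator) auto
    have hs: "h x = 0" if "real n < norm x" for x using that by (simp add: h_def)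
    obtain c where c: "\<And>m. continuous_on UNIV (c m)" "\<And>m x. \<bar>c m x\<bar> \<le> 1" "\<And>m x. real n + 1 < norm x \<Longrightarrow> c m x = 0"
      "AE x in lborel. (\<lambda>m. c m x) \<longlonglongrightarrow> h x"
      by (rule AE_limit_continuous[of h 1 "real n"]) (use hm hb hs in auto)
    have [measurable]: "c m \<in> borel_measurable borel" for m using c(1) by (simp add: borel_measurable_continuous_onI)
    note hm[measurable]
    have "(\<lambda>m. LBINT x. c m x * d x) \<longlonglongrightarrow> (LBINT x. h x * d x)"
    proof (rule integral_dominated_convergence)
      show "integrable lborel (\<lambda>x. \<bar>indicator (cball 0 (real n + 1)) x * d x\<bar>)"
        by (intro integrable_abs locally_integrable_cball l)
      show "AE x in lborel. (\<lambda>m. c m x * d x) \<longlonglongrightarrow> h x * d x"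
        using c(4) by eventually_elim (intro tendsto_intros)
      show "AE x in lborel. norm (c m x * d x) \<le> \<bar>indicator (cball 0 (real n + 1)) x * d x\<bar>" for m
      proof (rule AE_I2)
        fix x
        have "\<bar>c m x\<bar> * \<bar>d x\<bar> \<le> 1 * \<bar>d x\<bar>" by (intro mult_right_mono c) auto
        then show "norm (c m x * d x) \<le> \<bar>indicator (cball 0 (real n + 1)) x * d x\<bar>"
          using c(3)[of x m] by (cases "norm x \<le> real n + 1") (auto simp: abs_mult)
      qed
    qed measurable
    moreover have "bounded_support (c m)" for m unfolding bounded_support_def using c(3) by blast
    ultimately have "(LBINT x. h x * d x) = 0" using zc c(1) by (simp add: LIMSEQ_const_iff)
    moreover have hd: "h x * d x = \<bar>indicator (cball 0 (real n)) x * d x\<bar>" for x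
      by (auto simp: h_def abs_mult)
    ultimately have "(LBINT x. \<bar>indicator (cball 0 (real n)) x * d x\<bar>) = 0" by simp
    moreover have "integrable lborel (\<lambda>x. \<bar>indicator (cball 0 (real n)) x * d x\<bar>)"
      by (intro integrable_abs locally_integrable_cball l)
    ultimately have "AE x in lborel. \<bar>indicator (cball 0 (real n)) x * d x\<bar> = 0"
      using integral_nonneg_eq_0_iff_AE[of lborel "\<lambda>x. \<bar>indicator (cball 0 (real n)) x * d x\<bar>"] by simp
    then show ?thesis by eventually_elim simp
  qed
  then have "AE x in lborel. \<forall>n::nat. indicator (cball 0 (real n)) x * d x = 0"
    unfolding AE_all_countable by blast
  then show ?thesis
  proof eventually_elim
    fix x assume a: "\<forall>n::nat. indicator (cball 0 (real n)) x * d x = 0"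
    obtain n where "norm x \<le> real n" using real_arch_simple by blast
    then show "d x = 0" using a[rule_format, of n] by simp
  qed
qed

lemma weak_partial_unique:
  fixes u :: "real^2 \<Rightarrow> real"
  assumes "has_weak_partial i u g" "has_weak_partial i u h"
  shows "AE x in lborel. g x = h x"
proof -
  have l: "locally_integrable g" "locally_integrable h" using assms by (auto simp: has_weak_partial_def)
  have "locally_integrable (\<lambda>x. g x - h x)"
    using l unfolding locally_integrable_def set_integrable_def by (auto simp: right_diff_distrib)
  moreover have "(LBINT x. f x * (g x - h x)) = 0" if "test_function f" for f
    using integrable_test_function_mult[OF that that l(1)]
       integrable_test_function_mult[OF that that l(2)]
       weak_partial_C1c[OF assms(1) test_function_C1c[OF that]] weak_partial_C1c[OF assms(2) test_function_C1c[OF that]]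
    by (simp add: right_diff_distrib)
  ultimately have "AE x in lborel. g x - h x = 0" by (rule weak_zero_AE)
  then show ?thesis by eventually_elim simp
qed

text \<open>The common tool for all limits of integrals of products: the bounded factor is handled
  by dominated convergence, the L^2-convergent one by Cauchy-Schwarz, and the last factor is fixed.
  No pointwise convergence of derivatives is asked for.\<close>

lemma L2_limit_product:
  fixes \<theta> :: "nat \<Rightarrow> real^2 \<Rightarrow> real"
  assumes [measurable]: "\<And>k. \<theta> k \<in> borel_measurable borel"
    and b: "\<And>k x. \<bar>\<theta> k x\<bar> \<le> B" and l: "\<And>x. (\<lambda>k. \<theta> k x) \<longlonglongrightarrow> \<theta>' x"
    and f: "\<And>k. f k \<in> L2" "f' \<in> L2" "(\<lambda>k. LBINT x. (f k x - f' x)\<^sup>2) \<longlonglongrightarrow> 0" and g: "g \<in> L2"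
  shows "(\<lambda>k. LBINT x. \<theta> k x * (f k x * g x)) \<longlonglongrightarrow> (LBINT x. \<theta>' x * (f' x * g x))"
proof -
  have [measurable]: "f k \<in> borel_measurable borel" "f' \<in> borel_measurable borel" "g \<in> borel_measurable borel" for k
    using f g by (auto simp: L2_real)
  have [measurable]: "\<theta>' \<in> borel_measurable borel"
    by (rule borel_measurable_LIMSEQ_real[OF l]) auto
  have B: "B \<ge> 0" using b[of 0 0] by linarith
  have D: "(\<lambda>x. f k x - f' x) \<in> L2" for k using L2_diff f by blast
  have i1: "integrable lborel (\<lambda>x. \<theta> k x * ((f k x - f' x) * g x))" for k
  proof -
    have "integrable lborel (\<lambda>x. (\<theta> k x * (f k x - f' x)) * g x)"
      by (rule L2_mult_integrable[OF L2_bounded_mult[OF _ b D] g]) auto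
    then show ?thesis by (simp add: mult.assoc)
  qed
  have i2: "integrable lborel (\<lambda>x. \<theta> k x * (f' x * g x))" for k
  proof -
    have "integrable lborel (\<lambda>x. (\<theta> k x * f' x) * g x)"
      by (rule L2_mult_integrable[OF L2_bounded_mult[OF _ b f(2)] g]) auto
    then show ?thesis by (simp add: mult.assoc)
  qed
  have 1: "(\<lambda>k. LBINT x. \<theta> k x * ((f k x - f' x) * g x)) \<longlonglongrightarrow> 0"
  proof (rule Lim_null_comparison)
    have "(\<lambda>k. B * (sqrt (LBINT x. (f k x - f' x)\<^sup>2) * sqrt (LBINT x. (g x)\<^sup>2))) \<longlonglongrightarrow> B * (sqrt 0 * sqrt (LBINT x. (g x)\<^sup>2))"
      by (intro tendsto_intros f(3))
    then show "(\<lambda>k. B * (sqrt (LBINT x. (f k x - f' x)\<^sup>2) * sqrt (LBINT x. (g x)\<^sup>2))) \<longlonglongrightarrow> 0" by simp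
    show "\<forall>\<^sub>F k in sequentially. norm (LBINT x. \<theta> k x * ((f k x - f' x) * g x))
        \<le> B * (sqrt (LBINT x. (f k x - f' x)\<^sup>2) * sqrt (LBINT x. (g x)\<^sup>2))"
    proof (rule always_eventually, rule allI)
      fix k
      have "norm (LBINT x. \<theta> k x * ((f k x - f' x) * g x)) \<le> (LBINT x. norm (\<theta> k x * ((f k x - f' x) * g x)))"
        by (rule integral_norm_bound)
      also have "\<dots> \<le> (LBINT x. B * \<bar>(f k x - f' x) * g x\<bar>)"
      proof (rule integral_mono)
        show "integrable lborel (\<lambda>x. B * \<bar>(f k x - f' x) * g x\<bar>)"
          by (intro integrable_mult_right integrable_abs L2_mult_integrable[OF D g])
        show "norm (\<theta> k x * ((f k x - f' x) * g x)) \<le> B * \<bar>(f k x - f' x) * g x\<bar>" for x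
          unfolding real_norm_def abs_mult[of "\<theta> k x"] by (intro mult_right_mono b) auto
      qed (use i1 in auto)
      also have "\<dots> = B * (LBINT x. \<bar>(f k x - f' x) * g x\<bar>)" by simp
      also have "\<dots> \<le> B * (sqrt (LBINT x. (f k x - f' x)\<^sup>2) * sqrt (LBINT x. (g x)\<^sup>2))"
        by (intro mult_left_mono L2_Cauchy_Schwarz_abs[OF D g] B)
      finally show "norm (LBINT x. \<theta> k x * ((f k x - f' x) * g x))
        \<le> B * (sqrt (LBINT x. (f k x - f' x)\<^sup>2) * sqrt (LBINT x. (g x)\<^sup>2))" .
    qed
  qed
  have 2: "(\<lambda>k. LBINT x. \<theta> k x * (f' x * g x)) \<longlonglongrightarrow> (LBINT x. \<theta>' x * (f' x * g x))"
  proof (rule integral_dominated_convergence)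
    show "integrable lborel (\<lambda>x. B * \<bar>f' x * g x\<bar>)"
      by (intro integrable_mult_right integrable_abs L2_mult_integrable[OF f(2) g])
    show "AE x in lborel. (\<lambda>k. \<theta> k x * (f' x * g x)) \<longlonglongrightarrow> \<theta>' x * (f' x * g x)"
      by (intro AE_I2 tendsto_intros l)
    show "AE x in lborel. norm (\<theta> k x * (f' x * g x)) \<le> B * \<bar>f' x * g x\<bar>" for k
    proof (rule AE_I2)
      fix x show "norm (\<theta> k x * (f' x * g x)) \<le> B * \<bar>f' x * g x\<bar>"
        unfolding real_norm_def abs_mult[of "\<theta> k x"] by (intro mult_right_mono b) auto
    qed
  qed measurable
  have "(LBINT x. \<theta> k x * (f k x * g x)) = (LBINT x. \<theta> k x * ((f k x - f' x) * g x)) + (LBINT x. \<theta> k x * (f' x * g x))" for k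
  proof -
    have "(LBINT x. \<theta> k x * (f k x * g x)) = (LBINT x. \<theta> k x * ((f k x - f' x) * g x) + \<theta> k x * (f' x * g x))"
      by (intro Bochner_Integration.integral_cong) (auto simp: algebra_simps)
    then show ?thesis using i1 i2 by simp
  qed
  then show ?thesis using tendsto_add[OF 1 2] by simp
qed

text \<open>Discharges the convergence premise of \<open>L2_limit_product\<close> when that factor
  does not vary with \<open>k\<close>.\<close>

lemma L2_limit_const: "(\<lambda>k::nat. LBINT x. (f x - f x)\<^sup>2 :: real) \<longlonglongrightarrow> 0"
  by simp

lemma conv_moll_tendsto:
  assumes "continuous_on UNIV u"
  shows "(\<lambda>k. conv (moll k) u x) \<longlonglongrightarrow> u x"
proof (rule tendstoI)
  fix e :: real assume "e > 0"
  then have e2: "e/2 > 0" by simp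
  have "isCont u x" using assms by (simp add: continuous_on_eq_continuous_at)
  then obtain d where d: "d > 0" "\<And>y. norm (y - x) < d \<Longrightarrow> \<bar>u y - u x\<bar> < e/2"
    using e2 unfolding continuous_at_eps_delta dist_norm real_norm_def by metis
  have "(\<lambda>k. 2 / real (Suc k)) \<longlonglongrightarrow> 0"
    by (rule LIMSEQ_Suc) (rule lim_const_over_n)
  then have "\<forall>\<^sub>F k in sequentially. 2 / real (Suc k) < d" using d(1) by (rule order_tendstoD)
  then show "\<forall>\<^sub>F k in sequentially. dist (conv (moll k) u x) (u x) < e"
  proof (rule eventually_mono)
    fix k assume k: "2 / real (Suc k) < d"
    have "\<bar>conv (moll k) u x - u x\<bar> \<le> e/2"
    proof (rule conv_moll_uniform[OF continuous_locally_integrable[OF assms(1)]])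
      fix y assume "norm (y - x) \<le> 2 / real (Suc k)"
      then show "\<bar>u y - u x\<bar> \<le> e/2" using d(2)[of y] k by linarith
    qed
    then show "dist (conv (moll k) u x) (u x) < e" using \<open>e > 0\<close> by (simp add: dist_real_def)
  qed
qed

text \<open>Averaging preserves lower bounds. Applied to the third component, it keeps the mollified
  denominator \<open>1 + n3\<close> away from zero.\<close>

lemma conv_moll_ge:
  assumes "locally_integrable u" "\<And>y. a \<le> u y"
  shows "a \<le> conv (moll k) u x"
proof -
  have "a = (LBINT y. a * moll k (x - y))" by (simp add: moll_integral_reflect)
  also have "\<dots> \<le> (LBINT y. moll k (x - y) * u y)"
  proof (rule integral_mono)
    show "integrable lborel (\<lambda>y. moll k (x - y) * u y)" by (rule integrable_conv[OF moll_continuous moll_bounded_support assms(1)])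
    show "a * moll k (x - y) \<le> moll k (x - y) * u y" for y
      using mult_left_mono[OF assms(2) moll_nonneg] by (simp add: mult.commute)
  qed (simp add: moll_integrable)
  finally show ?thesis by (simp add: conv_def)
qed

lemma conv_moll_bounded:
  assumes "locally_integrable u" "\<And>y. \<bar>u y\<bar> \<le> a"
  shows "\<bar>conv (moll k) u x\<bar> \<le> a"
proof -
  have "- a \<le> u y" for y using assms(2)[of y] by linarith
  then have 1: "- a \<le> conv (moll k) u x" by (rule conv_moll_ge[OF assms(1)])
  have l: "locally_integrable (\<lambda>y. - u y)"
    using assms(1) unfolding locally_integrable_def set_integrable_def by auto
  have "- a \<le> - u y" for y using assms(2)[of y] by linarith
  then have "- a \<le> conv (moll k) (\<lambda>y. - u y) x" by (rule conv_moll_ge[OF l])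
  moreover have "conv (moll k) (\<lambda>y. - u y) x = - conv (moll k) u x" by (simp add: conv_def)
  ultimately show ?thesis using 1 by linarith
qed

lemma conv_moll_has_derivative:
  fixes u :: "real^2 \<Rightarrow> real"
  assumes "has_weak_partial 1 u u1" "has_weak_partial 2 u u2"
  shows "(conv (moll k) u has_derivative (\<lambda>v. v $ 1 * conv (moll k) u1 x + v $ 2 * conv (moll k) u2 x)) (at x)"
proof -
  have "locally_integrable u" using assms by (simp add: has_weak_partial_def)
  from conv_has_derivative[OF test_function_C1c[OF test_function_moll] this, of k x]
  show ?thesis unfolding conv_weak_partial[OF test_function_moll assms(1)] conv_weak_partial[OF test_function_moll assms(2)] .
qed

lemma conv_moll_continuous: "locally_integrable u \<Longrightarrow> continuous_on UNIV (conv (moll k) u)"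
  using Ck_conv[OF _ test_function_moll, of u 0] by simp

lemma C1c_mult:
  assumes "C1c f" and d: "\<And>x. (g has_derivative (\<lambda>v. v $ 1 * g1 x + v $ 2 * g2 x)) (at x)"
    and "continuous_on UNIV g1" "continuous_on UNIV g2"
  shows "C1c (\<lambda>x. f x * g x)" 
    "pd 1 (\<lambda>x. f x * g x) = (\<lambda>x. pd 1 f x * g x + f x * g1 x)"
    "pd 2 (\<lambda>x. f x * g x) = (\<lambda>x. pd 2 f x * g x + f x * g2 x)"
proof -
  have cf: "continuous_on UNIV f" "continuous_on UNIV (pd i f)" for i
    using assms C1c_continuous by (auto simp: C1c_def)
  have cg: "continuous_on UNIV g"
    using d has_derivative_continuous by (fastforce simp: continuous_on_eq_continuous_at)
  have D: "((\<lambda>x. f x * g x) has_derivative (\<lambda>v. v $ 1 * (pd 1 f x * g x + f x * g1 x) + v $ 2 * (pd 2 f x * g x + f x * g2 x))) (at x)" for x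
    by (rule has_derivative_eq_rhs[OF has_derivative_mult[OF C1c_has_derivative[OF assms(1)] d]])
       (auto simp: fun_eq_iff algebra_simps)
  have b: "bounded_support (\<lambda>x. f x * g x)" using assms(1) bounded_support_mult by (auto simp: C1c_def)
  note * = C1c_I[OF D _ _ b]
  show "C1c (\<lambda>x. f x * g x)" "pd 1 (\<lambda>x. f x * g x) = (\<lambda>x. pd 1 f x * g x + f x * g1 x)"
    "pd 2 (\<lambda>x. f x * g x) = (\<lambda>x. pd 2 f x * g x + f x * g2 x)"
    by (rule *; intro continuous_intros cf cg assms)+
qed

lemma C1c_L2:
  assumes "C1c f" shows "f \<in> L2" "pd i f \<in> L2"
proof -
  have L: "g \<in> L2" if a: "continuous_on UNIV g" "bounded_support g" for g
  proof -
    obtain R where R: "R > 0" "\<And>x. R < norm x \<Longrightarrow> g x = 0" using bounded_supportE[OF a(2)] by metis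
    obtain B where B: "B > 0" "\<And>x. \<bar>g x\<bar> \<le> B" using bounded_support_bounded[OF a] by metis
    show ?thesis by (rule bounded_support_L2[OF _ B(2) R(2)]) (use a in \<open>auto simp: borel_measurable_continuous_onI\<close>)
  qed
  show "f \<in> L2" "pd i f \<in> L2"
    using assms C1c_continuous bounded_support_pd by (auto intro!: L simp: C1c_def)
qed

text \<open>Once \<open>p\<close> is mollified, \<open>f\<close> times it is a C^1 test function for
  the weak derivative of \<open>v\<close>. In the limit every integral has a bounded factor, a
  strongly convergent one and a fixed one.\<close>

lemma weak_product_rule:
  fixes v p :: "real^2 \<Rightarrow> real"
  assumes v: "v \<in> L2" "has_weak_partial i v v'" "v' \<in> L2" and p: "p \<in> L2"
    and q: "has_weak_partial 1 p (q 1)" "has_weak_partial 2 p (q 2)" "\<And>i. q i \<in> L2"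
    and f: "C1c f"
  shows "(LBINT x. pd i f x * (p x * v x)) + (LBINT x. f x * (q i x * v x))
     = - (LBINT x. f x * (p x * v' x))"
proof -
  let ?m = "\<lambda>k. conv (moll k)"
  have l: "locally_integrable (q i)" for i using q(3) by (rule L2_locally_integrable)
  have cf: "continuous_on UNIV f" "bounded_support f" "continuous_on UNIV (pd i f)" "bounded_support (pd i f)"
    using f C1c_continuous bounded_support_pd by (auto simp: C1c_def)
  obtain B where B: "\<And>x. \<bar>f x\<bar> \<le> B" using bounded_support_bounded[OF cf(1,2)] by metis
  obtain D where D: "\<And>x. \<bar>pd i f x\<bar> \<le> D" using bounded_support_bounded[OF cf(3,4)] by metis
  have bm: "f \<in> borel_measurable borel" "pd i f \<in> borel_measurable borel"
    using cf by (auto simp: borel_measurable_continuous_onI)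
  note cm = C1c_mult[OF f conv_moll_has_derivative[OF q(1,2)] conv_moll_continuous[OF l] conv_moll_continuous[OF l]]
  have pdi: "pd i (\<lambda>x. f x * ?m k p x) = (\<lambda>x. pd i f x * ?m k p x + f x * ?m k (q i) x)" for k
    using cm(2,3) exhaust_2[of i] by auto
  have i1: "integrable lborel (\<lambda>x. pd i f x * ?m k p x * v x)" for k
    by (rule L2_mult_integrable[OF L2_bounded_mult[OF bm(2) D conv_L2(1)[OF p]] v(1)])
  have i2: "integrable lborel (\<lambda>x. f x * ?m k (q i) x * v x)" for k
    by (rule L2_mult_integrable[OF L2_bounded_mult[OF bm(1) B conv_L2(1)[OF q(3)]] v(1)])
  have "(LBINT x. pd i f x * (?m k p x * v x)) + (LBINT x. f x * (?m k (q i) x * v x))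
     = - (LBINT x. f x * (?m k p x * v' x))" for k
  proof -
    have "(LBINT x. pd i f x * ?m k p x * v x + f x * ?m k (q i) x * v x) = - (LBINT x. f x * ?m k p x * v' x)"
      using weak_partial_C1c[OF v(2) cm(1), of k] unfolding pdi by (simp add: distrib_right)
    then show ?thesis using i1[of k] i2[of k] by (simp add: mult.assoc)
  qed
  moreover have "(\<lambda>k. (LBINT x. pd i f x * (?m k p x * v x)) + (LBINT x. f x * (?m k (q i) x * v x))) \<longlonglongrightarrow>
      (LBINT x. pd i f x * (p x * v x)) + (LBINT x. f x * (q i x * v x))"
    by (intro tendsto_add L2_limit_product[OF bm(2) D tendsto_const conv_L2(1)[OF p] p conv_moll_L2_tendsto[OF p] v(1)]
        L2_limit_product[OF bm(1) B tendsto_const conv_L2(1)[OF q(3)] q(3) conv_moll_L2_tendsto[OF q(3)] v(1)])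
  moreover have "(\<lambda>k. - (LBINT x. f x * (?m k p x * v' x))) \<longlonglongrightarrow> - (LBINT x. f x * (p x * v' x))"
    by (intro tendsto_minus L2_limit_product[OF bm(1) B tendsto_const conv_L2(1)[OF p] p conv_moll_L2_tendsto[OF p] v(3)])
  ultimately show ?thesis using LIMSEQ_unique by (simp only:)
qed

section \<open>Sphere-valued maps avoiding the south pole\<close>

text \<open>The left-hand side is the pullback of the exterior derivative of
  \<open>(n1 dn2 - n2 dn1) / (1 + n3)\<close>, a primitive of the area form away from the south pole.\<close>

lemma area_form_identity:
  fixes n1 n2 n3 p1 p2 p3 q1 q2 q3 :: real
  assumes n: "n1\<^sup>2 + n2\<^sup>2 + n3\<^sup>2 = 1" and M: "1 + n3 > 0"
    and p: "n1 * p1 + n2 * p2 + n3 * p3 = 0" and q: "n1 * q1 + n2 * q2 + n3 * q3 = 0"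
  shows "(p1 / (1 + n3) - n1 * p3 / (1 + n3)\<^sup>2) * q2 - (q1 / (1 + n3) - n1 * q3 / (1 + n3)\<^sup>2) * p2
     - ((p2 / (1 + n3) - n2 * p3 / (1 + n3)\<^sup>2) * q1 - (q2 / (1 + n3) - n2 * q3 / (1 + n3)\<^sup>2) * p1)
     = n1 * (p2 * q3 - p3 * q2) + n2 * (p3 * q1 - p1 * q3) + n3 * (p1 * q2 - p2 * q1)" (is "?E = ?L")
proof -
  define c1 c2 c3 where "c1 = p2 * q3 - p3 * q2" and "c2 = p3 * q1 - p1 * q3" and "c3 = p1 * q2 - p2 * q1"
  define M where "M = 1 + n3"
  have M0: "M \<noteq> 0" using M by (simp add: M_def)
  \<comment> \<open>The vector \<open>(c1, c2, c3)\<close> is the cross product of the two tangent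
    vectors and hence parallel to \<open>n\<close>. This equation and the next are two components of
    the vanishing of its cross product with \<open>n\<close>; then the vector is \<open>L\<close>
    times \<open>n\<close>.\<close>
  have 1: "n3 * c1 = n1 * c3"
  proof -
    have "n3 * c1 - n1 * c3 = p2 * (n1 * q1 + n2 * q2 + n3 * q3) - q2 * (n1 * p1 + n2 * p2 + n3 * p3)"
      unfolding c1_def c3_def by (simp add: algebra_simps)
    then show ?thesis using p q by simp
  qed
  have 2: "n3 * c2 = n2 * c3"
  proof -
    have "n3 * c2 - n2 * c3 = q1 * (n1 * p1 + n2 * p2 + n3 * p3) - p1 * (n1 * q1 + n2 * q2 + n3 * q3)"
      unfolding c2_def c3_def by (simp add: algebra_simps)
    then show ?thesis using p q by simp
  qed
  define L where "L = n1 * c1 + n2 * c2 + n3 * c3"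
  have c3: "c3 = n3 * L"
  proof -
    have "n3 * L = n1 * (n3 * c1) + n2 * (n3 * c2) + n3\<^sup>2 * c3"
      unfolding L_def by (simp add: algebra_simps power2_eq_square)
    also have "\<dots> = (n1\<^sup>2 + n2\<^sup>2 + n3\<^sup>2) * c3" unfolding 1 2 by (simp add: algebra_simps power2_eq_square)
    finally show ?thesis using n by simp
  qed
  have h: "n1 * c1 + n2 * c2 = L * ((1 - n3) * M)"
  proof -
    have "n1 * c1 + n2 * c2 = L - n3 * c3" by (simp add: L_def)
    then show ?thesis unfolding c3 M_def by (simp add: algebra_simps)
  qed
  have "?E = 2 * c3 / M + (n1 * c1 + n2 * c2) / M\<^sup>2"
    unfolding M_def[symmetric] c1_def c2_def c3_def using M0 by (simp add: field_simps power2_eq_square)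
  also have "\<dots> = L * (2 * n3 + (1 - n3)) / M" 
    unfolding h c3 using M0 by (simp add: field_simps power2_eq_square)
  also have "2 * n3 + (1 - n3) = M" by (simp add: M_def)
  finally show ?thesis using M0 by (simp add: L_def c1_def c2_def c3_def)
qed

section \<open>Cutoff functions with vanishing gradient\<close>

lemma bump_gradient_bound:
  obtains C where "C > 0" "\<And>s x i. 0 < s \<Longrightarrow> \<bar>pd i (bump s) x\<bar> \<le> s * C"
proof -
  have t: "test_function (bump 1)" by (rule test_function_bump) simp
  have "\<exists>C>0. \<forall>x. \<bar>pd i (bump 1) x\<bar> \<le> C" for i
    by (rule bounded_support_bounded[OF test_function_continuous[OF test_function_pd[OF t]] test_function_bounded_support[OF test_function_pd[OF t]], of i]) blast
  then obtain C where C: "\<And>i. C i > 0" "\<And>i x. \<bar>pd i (bump 1) x\<bar> \<le> C i" by metis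
  have s: "pd i (bump s) x = s * pd i (bump 1) (s *\<^sub>R x)" for i s x
  proof -
    have "((\<lambda>x. bump 1 (s *\<^sub>R x)) has_derivative (\<lambda>v. (s *\<^sub>R v) $ 1 * pd 1 (bump 1) (s *\<^sub>R x) + (s *\<^sub>R v) $ 2 * pd 2 (bump 1) (s *\<^sub>R x))) (at x)"
      by (rule has_derivative_compose[OF _ C1c_has_derivative[OF test_function_C1c[OF t]]]) (auto intro!: derivative_eq_intros)
    then have "(bump s has_derivative (\<lambda>v. (s *\<^sub>R v) $ 1 * pd 1 (bump 1) (s *\<^sub>R x) + (s *\<^sub>R v) $ 2 * pd 2 (bump 1) (s *\<^sub>R x))) (at x)"
      by (subst bump_scale[abs_def]) 
    from pd_eq[OF this, of i] show ?thesis using exhaust_2[of i] by (auto simp: axis_def)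
  qed
  show thesis
  proof (rule that[of "C 1 + C 2"])
    show "C 1 + C 2 > 0" using C by (simp add: add_pos_pos)
    fix s :: real and x i assume "0 < s"
    have "\<bar>pd i (bump 1) (s *\<^sub>R x)\<bar> \<le> C i" using C by blast
    also have "\<dots> \<le> C 1 + C 2" using exhaust_2[of i] C(1)[of 1] C(1)[of 2] by auto
    finally show "\<bar>pd i (bump s) x\<bar> \<le> s * (C 1 + C 2)"
      using \<open>0 < s\<close> by (subst s) (simp add: abs_mult)
  qed
qed

text \<open>These functions tend pointwise to the constant \<open>bump 1 0\<close>, which is not 1;
  the constant is divided out once the limit has been taken.\<close>

definition cutoff :: "nat \<Rightarrow> real^2 \<Rightarrow> real" where
  "cutoff k = bump (1 / real (Suc k))"

lemma cutoff_C1c: "C1c (cutoff k)"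
  unfolding cutoff_def by (intro test_function_C1c test_function_bump) simp

lemma cutoff_measurable: "cutoff k \<in> borel_measurable borel" "pd i (cutoff k) \<in> borel_measurable borel"
  using C1c_L2[OF cutoff_C1c] by (auto simp: L2_real)

lemma cutoff_bounded: "\<bar>cutoff k x\<bar> \<le> 1"
  using bump_nonneg bump_le_1 by (simp add: cutoff_def)

lemma scale_tendsto_0: "(\<lambda>k. 1 / real (Suc k)) \<longlonglongrightarrow> 0"
  by (rule LIMSEQ_Suc) (rule lim_const_over_n)

lemma cutoff_tendsto: "(\<lambda>k. cutoff k x) \<longlonglongrightarrow> bump 1 0"
proof -
  have "isCont (bump 1) 0"
    using test_function_continuous[OF test_function_bump[of 1]] by (simp add: continuous_on_eq_continuous_at)
  moreover have "(\<lambda>k. (1 / real (Suc k)) *\<^sub>R x) \<longlonglongrightarrow> 0 *\<^sub>R x"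
    by (intro tendsto_scaleR tendsto_const scale_tendsto_0)
  ultimately have "(\<lambda>k. bump 1 ((1 / real (Suc k)) *\<^sub>R x)) \<longlonglongrightarrow> bump 1 0"
    by (intro isCont_tendsto_compose[of 0 "bump 1"]) auto
  then show ?thesis unfolding cutoff_def by (subst bump_scale)
qed

lemma cutoff_pd_bounded: "\<exists>C. \<forall>i k x. \<bar>pd i (cutoff k) x\<bar> \<le> C"
  and cutoff_pd_tendsto: "(\<lambda>k. pd i (cutoff k) x) \<longlonglongrightarrow> 0"
proof -
  obtain C where C: "C > 0" "\<And>s x i. 0 < s \<Longrightarrow> \<bar>pd i (bump s) x\<bar> \<le> s * C" by (rule bump_gradient_bound) blast
  have b: "\<bar>pd i (cutoff k) x\<bar> \<le> 1 / real (Suc k) * C" for i k x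
    unfolding cutoff_def by (rule C(2)) simp
  have "1 / real (Suc k) * C \<le> 1 * C" for k using C(1) by (intro mult_right_mono) auto
  then show "\<exists>C. \<forall>i k x. \<bar>pd i (cutoff k) x\<bar> \<le> C" using b order_trans by (metis mult_1)
  show "(\<lambda>k. pd i (cutoff k) x) \<longlonglongrightarrow> 0"
    by (rule Lim_null_comparison[OF _ tendsto_mult_left_zero[OF scale_tendsto_0, of C]])
       (rule always_eventually, use b in auto)
qed

text \<open>Coordinates of a sphere-valued map: \<open>N j\<close> are its components and
  \<open>P i j\<close> the weak derivative of \<open>N j\<close> in direction \<open>i\<close>. The
  third component tends to 1 at infinity, so integrability is required of
  \<open>N 3 x - 1\<close>.\<close>

locale sphere_map =
  fixes N :: "3 \<Rightarrow> real^2 \<Rightarrow> real" and P :: "2 \<Rightarrow> 3 \<Rightarrow> real^2 \<Rightarrow> real"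
  assumes N_continuous: "continuous_on UNIV (N j)"
    and sphere: "(N 1 x)\<^sup>2 + (N 2 x)\<^sup>2 + (N 3 x)\<^sup>2 = 1"
    and L2_N1: "N 1 \<in> L2" and L2_N2: "N 2 \<in> L2" and L2_N3: "(\<lambda>x. N 3 x - 1) \<in> L2"
    and L2_P: "P i j \<in> L2"
    and weak: "has_weak_partial i (N j) (P i j)"
begin

lemma N_le_1: "\<bar>N j x\<bar> \<le> 1"
proof -
  have "(N j x)\<^sup>2 \<le> 1" using sphere[of x] exhaust_3[of j] by (smt (verit) zero_le_power2)
  then show ?thesis by (simp add: abs_square_le_1)
qed

lemma N_measurable[measurable]: "N j \<in> borel_measurable borel"
  using N_continuous by (simp add: borel_measurable_continuous_onI)

lemma P_measurable[measurable]: "P i j \<in> borel_measurable borel"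
  using L2_P by (simp add: L2_real)

lemma locally_integrable_N: "locally_integrable (N j)"
  using N_continuous by (rule continuous_locally_integrable)

lemma locally_integrable_P: "locally_integrable (P i j)"
  using L2_P by (rule L2_locally_integrable)

lemma weak_N3: "has_weak_partial i (\<lambda>x. N 3 x - 1) (P i 3)"
  unfolding has_weak_partial_def
proof (intro conjI allI impI)
  show "locally_integrable (\<lambda>x. N 3 x - 1)" using L2_N3 by (rule L2_locally_integrable)
  show "locally_integrable (P i 3)" by (rule locally_integrable_P)
  fix f assume f: "test_function f"
  note t = test_function_pd[OF f, of i]
  have i: "integrable lborel (\<lambda>x. pd i f x * N 3 x)" "integrable lborel (\<lambda>x. pd i f x * 1)"
    by (rule integrable_bounded_support_mult[OF test_function_continuous[OF t] test_function_bounded_support[OF t]];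
        rule locally_integrable_N locally_integrable_const)+
  have "(LBINT x. pd i f x * (N 3 x - 1)) = (LBINT x. pd i f x * N 3 x) - (LBINT x. pd i f x)"
    using i by (simp add: right_diff_distrib)
  also have "\<dots> = - (LBINT x. f x * P i 3 x)"
    using weak_partial_C1c[OF weak test_function_C1c[OF f]] C1c_integral_pd[OF test_function_C1c[OF f]] by simp
  finally show "(LBINT x. frechet_derivative f (at x) (axis i 1) *\<^sub>R (N 3 x - 1)) = - (LBINT x. f x *\<^sub>R P i 3 x)"
    by (simp add: pd_def)
qed

text \<open>The weak form of differentiating \<open>|n|^2 = 1\<close>: the product rule with both
  factors equal identifies the weak derivative of each square, and a function orthogonal to all test
  functions vanishes almost everywhere.\<close>

lemma tangent: "AE x in lborel. N 1 x * P i 1 x + N 2 x * P i 2 x + N 3 x * P i 3 x = 0"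
proof (rule weak_zero_AE)
  have L: "(\<lambda>x. N j x * P i j x) \<in> L2" for j
    by (rule L2_bounded_mult[OF N_measurable N_le_1 L2_P])
  show "locally_integrable (\<lambda>x. N 1 x * P i 1 x + N 2 x * P i 2 x + N 3 x * P i 3 x)"
    by (intro L2_locally_integrable L2_add L)
  fix f assume f: "test_function f"
  note f1 = test_function_C1c[OF f]
  have iP: "integrable lborel (\<lambda>x. f x * (N j x * P i j x))" for j
    by (rule L2_mult_integrable[OF C1c_L2(1)[OF f1] L])
  have iP3: "integrable lborel (\<lambda>x. f x * P i 3 x)"
    by (rule L2_mult_integrable[OF C1c_L2(1)[OF f1] L2_P])
  have i2: "integrable lborel (\<lambda>x. pd i f x * (u x)\<^sup>2)" if "u \<in> L2" "\<And>x. \<bar>u x\<bar> \<le> 2" for u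
    using L2_mult_integrable[OF L2_bounded_mult[OF _ that(2) that(1)] C1c_L2(2)[OF f1]] that(1)
    by (simp add: power2_eq_square mult_ac L2_real) 
  have b: "\<bar>N j x\<bar> \<le> 2" "\<bar>N j x - 1\<bar> \<le> 2" for j x using N_le_1[of j x] by linarith+
  have sq: "(LBINT x. pd i f x * (u x)\<^sup>2) = - 2 * (LBINT x. f x * (u x * Q i x))"
    if "u \<in> L2" "\<And>i. has_weak_partial i u (Q i)" "\<And>i. Q i \<in> L2" for u Q
    using weak_product_rule[OF that(1) that(2)[of i] that(3)[of i] that(1) that(2) that(2,3) f1] by (simp add: power2_eq_square mult_ac)
  have s: "(LBINT x. pd i f x * (N j x)\<^sup>2) = - 2 * (LBINT x. f x * (N j x * P i j x))" if "N j \<in> L2" for j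
    by (rule sq[OF that weak L2_P])
  have s3: "(LBINT x. pd i f x * (N 3 x - 1)\<^sup>2) = - 2 * (LBINT x. f x * ((N 3 x - 1) * P i 3 x))"
    by (rule sq[OF L2_N3 weak_N3 L2_P])
  have w3: "(LBINT x. pd i f x * (N 3 x - 1)) = - (LBINT x. f x * P i 3 x)"
    by (rule weak_partial_C1c[OF weak_N3 f1])
  have i3: "integrable lborel (\<lambda>x. pd i f x * (N 3 x - 1))"
    by (rule L2_mult_integrable[OF C1c_L2(2)[OF f1] L2_N3])
  \<comment> \<open>The sphere equation rewritten so that only the square-integrable functions
    \<open>N 1\<close>, \<open>N 2\<close> and \<open>N 3 - 1\<close> occur, to which the product
    rule applies.\<close>
  have "- 2 * (N 3 x - 1) = (N 1 x)\<^sup>2 + (N 2 x)\<^sup>2 + (N 3 x - 1)\<^sup>2" for x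
    using sphere[of x] by (simp add: power2_eq_square algebra_simps)
  then have "- 2 * (pd i f x * (N 3 x - 1)) = pd i f x * (N 1 x)\<^sup>2 + pd i f x * (N 2 x)\<^sup>2 + pd i f x * (N 3 x - 1)\<^sup>2" for x
    by (metis (no_types, lifting) distrib_left mult.left_commute)
  then have "(LBINT x. - 2 * (pd i f x * (N 3 x - 1))) =
     (LBINT x. pd i f x * (N 1 x)\<^sup>2 + pd i f x * (N 2 x)\<^sup>2 + pd i f x * (N 3 x - 1)\<^sup>2)" by presburger
  also have "\<dots> = (LBINT x. pd i f x * (N 1 x)\<^sup>2) + (LBINT x. pd i f x * (N 2 x)\<^sup>2) + (LBINT x. pd i f x * (N 3 x - 1)\<^sup>2)"
    using i2[OF L2_N1 b(1)] i2[OF L2_N2 b(1)] i2[OF L2_N3 b(2)] by simp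
  finally have "(LBINT x. f x * P i 3 x) + (LBINT x. f x * (N 1 x * P i 1 x)) + (LBINT x. f x * (N 2 x * P i 2 x))
      + (LBINT x. f x * ((N 3 x - 1) * P i 3 x)) = 0"
    unfolding s[OF L2_N1] s[OF L2_N2] s3 using w3 by simp
  moreover have "(LBINT x. f x * ((N 3 x - 1) * P i 3 x)) = (LBINT x. f x * (N 3 x * P i 3 x)) - (LBINT x. f x * P i 3 x)"
    using iP[of 3] iP3 by (simp add: algebra_simps)
  ultimately show "(LBINT x. f x * (N 1 x * P i 1 x + N 2 x * P i 2 x + N 3 x * P i 3 x)) = 0"
    using iP[of 1] iP[of 2] iP[of 3] by (simp add: distrib_left)
qed

text \<open>Weak Stokes theorem for \<open>a1 dn2 - a2 dn1\<close> with
  \<open>aj = nj / (1 + n3)\<close>. There are two limits: removing the mollification from the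
  quotients \<open>aj\<close>, with a fixed compactly supported factor \<open>f\<close>, and then
  letting \<open>f\<close> run through the cutoffs. The second factor \<open>dnl\<close> stays a
  weak derivative throughout.\<close>

lemma degree_zero:
  assumes c: "c > 0" "\<And>x. c \<le> 1 + N 3 x"
  shows "(LBINT x. N 1 x * (P 1 2 x * P 2 3 x - P 1 3 x * P 2 2 x)
     + N 2 x * (P 1 3 x * P 2 1 x - P 1 1 x * P 2 3 x) + N 3 x * (P 1 1 x * P 2 2 x - P 1 2 x * P 2 1 x)) = 0"
proof -
  let ?m = "\<lambda>k. conv (moll k)"
  define M where "M x = 1 + N 3 x" for x
  define Mk where "Mk k x = 1 + ?m k (N 3) x" for k x
  have Mc: "c \<le> M x" for x using c(2) by (simp add: M_def)
  have Mkc: "c \<le> Mk k x" for k x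
  proof -
    have "c - 1 \<le> N 3 y" for y using c(2)[of y] by linarith
    then have "c - 1 \<le> ?m k (N 3) x" by (rule conv_moll_ge[OF locally_integrable_N])
    then show ?thesis by (simp add: Mk_def)
  qed
  have M0: "M x > 0" "Mk k x > 0" for k x using Mc[of x] Mkc[of k x] c by linarith+
  have Nk: "\<bar>?m k (N j) x\<bar> \<le> 1" for k j x by (rule conv_moll_bounded[OF locally_integrable_N N_le_1])
  have Nkc: "continuous_on UNIV (?m k (N j))" for k j by (rule conv_moll_continuous[OF locally_integrable_N])
  have Pkc: "continuous_on UNIV (?m k (P i j))" for k i j by (rule conv_moll_continuous[OF locally_integrable_P])
  have Mkcont: "continuous_on UNIV (Mk k)" for k unfolding Mk_def by (intro continuous_intros Nkc)
  have [measurable]: "?m k (N j) \<in> borel_measurable borel" "?m k (P i j) \<in> borel_measurable borel" 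
    "Mk k \<in> borel_measurable borel" for k i j
    using Nkc Pkc Mkcont by (auto simp: borel_measurable_continuous_onI)
  have [measurable]: "M \<in> borel_measurable borel" unfolding M_def[abs_def] by measurable
  define a where "a j x = N j x / M x" for j x
  define b where "b j x = N j x / (M x)\<^sup>2" for j x
  define ak where "ak k j x = ?m k (N j) x / Mk k x" for k j x
  define bk where "bk k j x = ?m k (N j) x / (Mk k x)\<^sup>2" for k j x
  have inv: "\<bar>y / z\<bar> \<le> 1 / c" "\<bar>y / z\<^sup>2\<bar> \<le> 1 / c\<^sup>2" if "\<bar>y\<bar> \<le> 1" "c \<le> z" for y z
  proof -
    show "\<bar>y / z\<bar> \<le> 1 / c" using that c unfolding abs_divide by (intro frac_le) auto
    have "c\<^sup>2 \<le> z\<^sup>2" using that c by (intro power_mono) auto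
    then show "\<bar>y / z\<^sup>2\<bar> \<le> 1 / c\<^sup>2" using that c unfolding abs_divide by (intro frac_le) auto
  qed
  have akb: "\<bar>ak k j x\<bar> \<le> 1 / c" "\<bar>bk k j x\<bar> \<le> 1 / c\<^sup>2" "\<bar>1 / Mk k x\<bar> \<le> 1 / c" for k j x
    unfolding ak_def bk_def using inv[OF Nk Mkc] inv(1)[of 1, OF _ Mkc] by auto
  have ab: "\<bar>a j x\<bar> \<le> 1 / c" "\<bar>b j x\<bar> \<le> 1 / c\<^sup>2" "\<bar>1 / M x\<bar> \<le> 1 / c" for j x
    unfolding a_def b_def using inv[OF N_le_1 Mc] inv(1)[of 1, OF _ Mc] by auto
  have Mlim: "(\<lambda>k. Mk k x) \<longlonglongrightarrow> M x" for x
    unfolding Mk_def M_def by (intro tendsto_intros conv_moll_tendsto N_continuous)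
  have lim: "(\<lambda>k. ak k j x) \<longlonglongrightarrow> a j x" "(\<lambda>k. bk k j x) \<longlonglongrightarrow> b j x" "(\<lambda>k. 1 / Mk k x) \<longlonglongrightarrow> 1 / M x" for j x
    unfolding ak_def bk_def a_def b_def using M0(1)[of x]
    by (auto intro!: tendsto_intros conv_moll_tendsto N_continuous Mlim)
  have [measurable]: "ak k j \<in> borel_measurable borel" "bk k j \<in> borel_measurable borel" 
     "a j \<in> borel_measurable borel" "b j \<in> borel_measurable borel" for k j
    unfolding ak_def[abs_def] bk_def[abs_def] a_def[abs_def] b_def[abs_def] by measurable

  \<comment> \<open>\<open>Gk\<close> is the classical gradient of the mollified quotient
    \<open>ak\<close>; \<open>G\<close> is its formal limit, the gradient of \<open>a\<close> given
    by the quotient rule. The integrals with \<open>Gk\<close> converge to those with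
    \<open>G\<close>, so \<open>G\<close> needs no separate verification as a weak
    derivative.\<close>
  define G where "G i j x = P i j x / M x - b j x * P i 3 x" for i j x
  define Gk where "Gk k i j x = ?m k (P i j) x / Mk k x - bk k j x * ?m k (P i 3) x" for k i j x
  have Gkc: "continuous_on UNIV (Gk k i j)" for k i j
    unfolding Gk_def bk_def by (intro continuous_intros Nkc Pkc Mkcont) (use M0 in \<open>auto simp: less_imp_neq[symmetric]\<close>)
  have akd: "(ak k j has_derivative (\<lambda>v. v $ 1 * Gk k 1 j x + v $ 2 * Gk k 2 j x)) (at x)" for k j x
  proof -
    note d = conv_moll_has_derivative[OF weak[of 1 j] weak[of 2 j], of k x]
    have dM: "(Mk k has_derivative (\<lambda>v. v $ 1 * ?m k (P 1 3) x + v $ 2 * ?m k (P 2 3) x)) (at x)"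
      unfolding Mk_def[abs_def]
      by (rule has_derivative_eq_rhs[OF has_derivative_add[OF has_derivative_const conv_moll_has_derivative[OF weak weak]]]) simp
    show ?thesis
      unfolding ak_def[abs_def]
    proof (rule has_derivative_eq_rhs[OF has_derivative_divide'[OF d dM]])
      show "Mk k x \<noteq> 0" using M0(2)[of k x] by simp
      show "(\<lambda>h. ((h $ 1 * ?m k (P 1 j) x + h $ 2 * ?m k (P 2 j) x) * Mk k x - ?m k (N j) x * (h $ 1 * ?m k (P 1 3) x + h $ 2 * ?m k (P 2 3) x)) / (Mk k x * Mk k x))
        = (\<lambda>v. v $ 1 * Gk k 1 j x + v $ 2 * Gk k 2 j x)"
        unfolding Gk_def bk_def using M0(2)[of k x] by (auto simp: fun_eq_iff field_simps power2_eq_square)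
    qed
  qed

  have iG: "integrable lborel (\<lambda>x. \<theta> x * (f x * g x))" 
    if "\<theta> \<in> borel_measurable borel" "\<And>x. \<bar>\<theta> x\<bar> \<le> B" "f \<in> L2" "g \<in> L2" for \<theta> f g :: "real^2 \<Rightarrow> real" and B
    using L2_mult_integrable[OF L2_bounded_mult[OF that(1,2,3)] that(4)] by (simp add: mult.assoc)

  \<comment> \<open>The Jacobian identity for the test function \<open>f * ak k j\<close> against
    \<open>N l\<close>, after the limit in \<open>k\<close>; the terms with \<open>pd i f\<close>
    come from differentiating the factor \<open>f\<close>.\<close>
  have key: "(LBINT x. f x * (G 1 j x * P 2 l x)) + (LBINT x. a j x * (pd 1 f x * P 2 l x))
     = (LBINT x. f x * (G 2 j x * P 1 l x)) + (LBINT x. a j x * (pd 2 f x * P 1 l x))"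
    if f: "C1c f" for f j l
  proof -
    have cf: "continuous_on UNIV f" "bounded_support f" using f C1c_continuous by (auto simp: C1c_def)
    obtain B where B: "\<And>x. \<bar>f x\<bar> \<le> B" using bounded_support_bounded[OF cf] by metis
    have [measurable]: "f \<in> borel_measurable borel" using cf by (simp add: borel_measurable_continuous_onI)
    note cm = C1c_mult[OF f akd Gkc Gkc]
    have fM: "\<bar>f x * (1 / Mk k x)\<bar> \<le> B * (1 / c)" "\<bar>f x * bk k j x\<bar> \<le> B * (1 / c\<^sup>2)" for k x
      unfolding abs_mult using order_trans[OF abs_ge_zero B] by (intro mult_mono B akb; simp)+
    have fM': "\<bar>f x * (1 / M x)\<bar> \<le> B * (1 / c)" "\<bar>f x * b j x\<bar> \<le> B * (1 / c\<^sup>2)" for x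
      unfolding abs_mult using order_trans[OF abs_ge_zero B] by (intro mult_mono B ab; simp)+
    have eqk: "(LBINT x. f x * (1 / Mk k x) * (?m k (P 1 j) x * P 2 l x)) - (LBINT x. f x * bk k j x * (?m k (P 1 3) x * P 2 l x))
        + (LBINT x. ak k j x * (pd 1 f x * P 2 l x))
      = (LBINT x. f x * (1 / Mk k x) * (?m k (P 2 j) x * P 1 l x)) - (LBINT x. f x * bk k j x * (?m k (P 2 3) x * P 1 l x))
        + (LBINT x. ak k j x * (pd 2 f x * P 1 l x))" for k
    proof -
      have e: "(LBINT x. (pd i f x * ak k j x + f x * Gk k i j x) * P i' l x)
        = (LBINT x. f x * (1 / Mk k x) * (?m k (P i j) x * P i' l x)) - (LBINT x. f x * bk k j x * (?m k (P i 3) x * P i' l x))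
        + (LBINT x. ak k j x * (pd i f x * P i' l x))" for i i'
      proof -
        have i: "integrable lborel (\<lambda>x. f x * (1 / Mk k x) * (?m k (P i j) x * P i' l x))"
          "integrable lborel (\<lambda>x. f x * bk k j x * (?m k (P i 3) x * P i' l x))"
          "integrable lborel (\<lambda>x. ak k j x * (pd i f x * P i' l x))"
          by (rule iG[OF _ fM(1) conv_L2(1)[OF L2_P] L2_P] iG[OF _ fM(2) conv_L2(1)[OF L2_P] L2_P] iG[OF _ akb(1) C1c_L2(2)[OF f] L2_P]; measurable)+
        have "(LBINT x. (pd i f x * ak k j x + f x * Gk k i j x) * P i' l x)
          = (LBINT x. f x * (1 / Mk k x) * (?m k (P i j) x * P i' l x) - f x * bk k j x * (?m k (P i 3) x * P i' l x)
             + ak k j x * (pd i f x * P i' l x))"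
          by (intro Bochner_Integration.integral_cong) (auto simp: Gk_def algebra_simps)
        then show ?thesis using i by simp
      qed
      show ?thesis
        using C1c_jacobian[OF weak[of 1 l] weak[of 2 l] cm(1)[of k j]] unfolding cm(2,3) e .
    qed
    have l1: "(\<lambda>k. (LBINT x. f x * (1 / Mk k x) * (?m k (P i j) x * P i' l x)) - (LBINT x. f x * bk k j x * (?m k (P i 3) x * P i' l x))
        + (LBINT x. ak k j x * (pd i f x * P i' l x))) \<longlonglongrightarrow> 
       (LBINT x. f x * (1 / M x) * (P i j x * P i' l x)) - (LBINT x. f x * b j x * (P i 3 x * P i' l x))
        + (LBINT x. a j x * (pd i f x * P i' l x))" for i i'
    proof (intro tendsto_add tendsto_diff)
      show "(\<lambda>k. LBINT x. f x * (1 / Mk k x) * (?m k (P i j) x * P i' l x)) \<longlonglongrightarrow> (LBINT x. f x * (1 / M x) * (P i j x * P i' l x))"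
        by (rule L2_limit_product[OF _ fM(1) tendsto_mult[OF tendsto_const lim(3)] conv_L2(1)[OF L2_P] L2_P conv_moll_L2_tendsto[OF L2_P] L2_P]) measurable
      show "(\<lambda>k. LBINT x. f x * bk k j x * (?m k (P i 3) x * P i' l x)) \<longlonglongrightarrow> (LBINT x. f x * b j x * (P i 3 x * P i' l x))"
        by (rule L2_limit_product[OF _ fM(2) tendsto_mult[OF tendsto_const lim(2)] conv_L2(1)[OF L2_P] L2_P conv_moll_L2_tendsto[OF L2_P] L2_P]) measurable
      show "(\<lambda>k. LBINT x. ak k j x * (pd i f x * P i' l x)) \<longlonglongrightarrow> (LBINT x. a j x * (pd i f x * P i' l x))"
        by (rule L2_limit_product[OF _ akb(1) lim(1) C1c_L2(2)[OF f] C1c_L2(2)[OF f] L2_limit_const L2_P]) measurable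
    qed
    have split: "(LBINT x. f x * (1 / M x) * (P i j x * P i' l x)) - (LBINT x. f x * b j x * (P i 3 x * P i' l x))
       = (LBINT x. f x * (G i j x * P i' l x))" for i i'
    proof -
      have i: "integrable lborel (\<lambda>x. f x * (1 / M x) * (P i j x * P i' l x))"
        "integrable lborel (\<lambda>x. f x * b j x * (P i 3 x * P i' l x))"
        by (rule iG[OF _ fM'(1) L2_P L2_P] iG[OF _ fM'(2) L2_P L2_P]; measurable)+
      have "(LBINT x. f x * (G i j x * P i' l x)) = (LBINT x. f x * (1 / M x) * (P i j x * P i' l x) - f x * b j x * (P i 3 x * P i' l x))"
        by (intro Bochner_Integration.integral_cong) (auto simp: G_def algebra_simps)
      then show ?thesis using i by simp
    qed
    show ?thesis
      using LIMSEQ_unique[OF l1[of 1 2] l1[of 2 1, folded eqk]] unfolding split .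
  qed

  have L2G: "G i j \<in> L2" for i j
  proof -
    have "(\<lambda>x. (1 / M x) * P i j x - b j x * P i 3 x) \<in> L2"
      by (intro L2_diff L2_bounded_mult[OF _ ab(3) L2_P] L2_bounded_mult[OF _ ab(2) L2_P]) measurable
    then show ?thesis by (simp add: G_def[abs_def])
  qed
  have iGP: "integrable lborel (\<lambda>x. G i j x * P i' l x)" for i j i' l
    by (rule L2_mult_integrable[OF L2G L2_P])
  obtain C where C: "\<And>i k x. \<bar>pd i (cutoff k) x\<bar> \<le> C" using cutoff_pd_bounded by metis
  \<comment> \<open>The terms with the gradient of the cutoff vanish in the limit because
    \<open>a j\<close> is square integrable; this holds for \<open>j = 1, 2\<close>, where
    \<open>N j\<close> is.\<close>
  have swap: "(LBINT x. G 1 j x * P 2 l x) = (LBINT x. G 2 j x * P 1 l x)" if "N j \<in> L2" for j l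
  proof -
    have "(\<lambda>x. (1 / M x) * N j x) \<in> L2" by (intro L2_bounded_mult[OF _ ab(3) that]) measurable
    then have L2a: "a j \<in> L2" by (simp add: a_def[abs_def])
    have lim: "(\<lambda>k. (LBINT x. cutoff k x * (G i j x * P i' l x)) + (LBINT x. pd i (cutoff k) x * (a j x * P i' l x)))
        \<longlonglongrightarrow> (LBINT x. bump 1 0 * (G i j x * P i' l x)) + (LBINT x. 0 * (a j x * P i' l x))" for i i'
      by (intro tendsto_add
          L2_limit_product[OF cutoff_measurable(1) cutoff_bounded cutoff_tendsto L2G L2G L2_limit_const L2_P]
          L2_limit_product[OF cutoff_measurable(2) C cutoff_pd_tendsto L2a L2a L2_limit_const L2_P])
    have "(LBINT x. cutoff k x * (G 1 j x * P 2 l x)) + (LBINT x. pd 1 (cutoff k) x * (a j x * P 2 l x))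
      = (LBINT x. cutoff k x * (G 2 j x * P 1 l x)) + (LBINT x. pd 2 (cutoff k) x * (a j x * P 1 l x))" for k
      using key[OF cutoff_C1c, of k j l] unfolding mult.left_commute[of "a j _"] .
    from LIMSEQ_unique[OF lim[of 1 2] lim[of 2 1, folded this]]
    show ?thesis using bump_0(2)[of 1] by simp
  qed
  define E where "E x = G 1 1 x * P 2 2 x - G 2 1 x * P 1 2 x - (G 1 2 x * P 2 1 x - G 2 2 x * P 1 1 x)" for x
  have [measurable]: "G i j \<in> borel_measurable borel" for i j using L2G by (simp add: L2_real)
  have [measurable]: "E \<in> borel_measurable borel" unfolding E_def[abs_def] by measurable
  have "(LBINT x. E x) = (LBINT x. G 1 1 x * P 2 2 x) - (LBINT x. G 2 1 x * P 1 2 x)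
      - ((LBINT x. G 1 2 x * P 2 1 x) - (LBINT x. G 2 2 x * P 1 1 x))"
    unfolding E_def using iGP by simp
  then have E0: "(LBINT x. E x) = 0" using swap[OF L2_N1] swap[OF L2_N2] by simp

  have "(LBINT x. E x) = (LBINT x. N 1 x * (P 1 2 x * P 2 3 x - P 1 3 x * P 2 2 x)
     + N 2 x * (P 1 3 x * P 2 1 x - P 1 1 x * P 2 3 x) + N 3 x * (P 1 1 x * P 2 2 x - P 1 2 x * P 2 1 x))"
  proof (rule integral_cong_AE)
    show "AE x in lborel. E x = N 1 x * (P 1 2 x * P 2 3 x - P 1 3 x * P 2 2 x)
     + N 2 x * (P 1 3 x * P 2 1 x - P 1 1 x * P 2 3 x) + N 3 x * (P 1 1 x * P 2 2 x - P 1 2 x * P 2 1 x)"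
      using tangent[of 1] tangent[of 2]
    proof eventually_elim
      fix x assume t: "N 1 x * P 1 1 x + N 2 x * P 1 2 x + N 3 x * P 1 3 x = 0"
        "N 1 x * P 2 1 x + N 2 x * P 2 2 x + N 3 x * P 2 3 x = 0"
      have "1 + N 3 x > 0" using M0(1)[of x] by (simp add: M_def)
      from area_form_identity[OF sphere this t]
      show "E x = N 1 x * (P 1 2 x * P 2 3 x - P 1 3 x * P 2 2 x)
     + N 2 x * (P 1 3 x * P 2 1 x - P 1 1 x * P 2 3 x) + N 3 x * (P 1 1 x * P 2 2 x - P 1 2 x * P 2 1 x)"
        by (simp add: E_def G_def b_def M_def)
    qed
  qed measurable
  with E0 show ?thesis by simp
qed

end

section \<open>Vector-valued weak derivatives\<close>

lemma borel_measurable_component: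
  fixes u :: "real^2 \<Rightarrow> real^3"
  assumes "u \<in> borel_measurable borel" shows "(\<lambda>x. u x $ j) \<in> borel_measurable borel"
  by (rule measurable_compose[OF assms])
     (intro borel_measurable_continuous_onI linear_continuous_on bounded_linear_vec_nth)

lemma locally_integrable_component:
  fixes u :: "real^2 \<Rightarrow> real^3"
  assumes "locally_integrable u" shows "locally_integrable (\<lambda>x. u x $ j)"
  unfolding locally_integrable_def set_integrable_def
proof safe
  have [measurable]: "u \<in> borel_measurable borel" using assms by (simp add: locally_integrable_def)
  show "(\<lambda>x. u x $ j) \<in> borel_measurable lborel" using borel_measurable_component[of u j] by simp
  fix K :: "(real^2) set" assume "compact K"
  then have "integrable lborel (\<lambda>x. indicator K x *\<^sub>R u x)"
    using assms unfolding locally_integrable_def set_integrable_def by auto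
  from integrable_bounded_linear[OF bounded_linear_vec_nth[of j] this]
  show "integrable lborel (\<lambda>x. indicator K x *\<^sub>R u x $ j)" by simp
qed

lemma has_weak_partial_component:
  fixes u :: "real^2 \<Rightarrow> real^3"
  assumes "has_weak_partial i u g"
  shows "has_weak_partial i (\<lambda>x. u x $ j) (\<lambda>x. g x $ j)"
  unfolding has_weak_partial_def
proof (intro conjI allI impI locally_integrable_component)
  show l: "locally_integrable u" "locally_integrable g" using assms by (auto simp: has_weak_partial_def)
  fix f assume f: "test_function f"
  note t = test_function_pd[OF f, of i]
  have 1: "integrable lborel (\<lambda>x. pd i f x *\<^sub>R u x)"
    by (rule integrable_test_function_scaleR[OF t t l(1)])
  have 2: "integrable lborel (\<lambda>x. f x *\<^sub>R g x)"
    by (rule integrable_test_function_scaleR[OF f f l(2)])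
  have "(LBINT x. pd i f x *\<^sub>R u x) = - (LBINT x. f x *\<^sub>R g x)"
    using assms f unfolding has_weak_partial_def pd_def by blast
  then have "(LBINT x. pd i f x *\<^sub>R u x) $ j = - ((LBINT x. f x *\<^sub>R g x) $ j)" by simp
  then show "(LBINT x. frechet_derivative f (at x) (axis i 1) *\<^sub>R (u x $ j)) = - (LBINT x. f x *\<^sub>R (g x $ j))"
    using integral_bounded_linear[OF bounded_linear_vec_nth[of j] 1] integral_bounded_linear[OF bounded_linear_vec_nth[of j] 2]
    by (simp add: pd_def)
qed

lemma weak_partial_unique_vec:
  fixes u :: "real^2 \<Rightarrow> real^3"
  assumes "has_weak_partial i u g" "has_weak_partial i u h"
  shows "AE x in lborel. g x = h x"
proof -
  have "AE x in lborel. g x $ j = h x $ j" for j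
    by (rule weak_partial_unique[OF has_weak_partial_component[OF assms(1)] has_weak_partial_component[OF assms(2)]])
  from this[of 1] this[of 2] this[of 3] show ?thesis
    by eventually_elim (simp add: vec_eq_iff forall_3)
qed

lemma has_weak_partial_cong_AE:
  fixes u v :: "real^2 \<Rightarrow> real^3"
  assumes "has_weak_partial i u g" "AE x in lborel. u x = v x" "locally_integrable v"
  shows "has_weak_partial i v g"
proof -
  have [measurable]: "u \<in> borel_measurable borel" "v \<in> borel_measurable borel"
    using assms by (auto simp: has_weak_partial_def locally_integrable_def)
  have "(LBINT x. frechet_derivative f (at x) (axis i 1) *\<^sub>R v x) = (LBINT x. frechet_derivative f (at x) (axis i 1) *\<^sub>R u x)"
    if f: "test_function f" for f
  proof (rule integral_cong_AE)
    have [measurable]: "(\<lambda>x. frechet_derivative f (at x) (axis i 1)) \<in> borel_measurable borel"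
      using test_function_continuous[OF test_function_frechet[OF f]] by (rule borel_measurable_continuous_onI)
    show "(\<lambda>x. frechet_derivative f (at x) (axis i 1) *\<^sub>R v x) \<in> borel_measurable lborel"
      "(\<lambda>x. frechet_derivative f (at x) (axis i 1) *\<^sub>R u x) \<in> borel_measurable lborel" by measurable
    show "AE x in lborel. frechet_derivative f (at x) (axis i 1) *\<^sub>R v x = frechet_derivative f (at x) (axis i 1) *\<^sub>R u x"
      using assms(2) by eventually_elim simp
  qed
  then show ?thesis using assms(1,3) unfolding has_weak_partial_def by simp
qed

lemma L2_cong_AE:
  fixes u v :: "real^2 \<Rightarrow> real^3"
  assumes "u \<in> L2" "AE x in lborel. u x = v x" "v \<in> borel_measurable lborel"
  shows "v \<in> L2"
proof -
  have [measurable]: "u \<in> borel_measurable borel" "v \<in> borel_measurable borel"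
    using assms by (auto simp: L2_def)
  have "integrable lborel (\<lambda>x. (norm (v x))\<^sup>2) \<longleftrightarrow> integrable lborel (\<lambda>x. (norm (u x))\<^sup>2)"
    by (rule integrable_cong_AE) (measurable, use assms(2) in eventually_elim, simp)
  then show ?thesis using assms by (simp add: L2_def)
qed

lemma locally_integrable_add:
  fixes u v :: "real^2 \<Rightarrow> 'b::euclidean_space"
  assumes "locally_integrable u" "locally_integrable v"
  shows "locally_integrable (\<lambda>x. u x + v x)"
  using assms unfolding locally_integrable_def set_integrable_def by (auto simp: scaleR_add_right)

lemma has_weak_partial_add_const:
  fixes u :: "real^2 \<Rightarrow> real^3"
  assumes "has_weak_partial i u g"
  shows "has_weak_partial i (\<lambda>x. u x + c) g"
  unfolding has_weak_partial_def
proof (intro conjI allI impI)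
  have l: "locally_integrable u" "locally_integrable g" using assms by (auto simp: has_weak_partial_def)
  show "locally_integrable g" by (rule l)
  have lc: "locally_integrable (\<lambda>x::real^2. c)" by (rule continuous_locally_integrable) simp
  show "locally_integrable (\<lambda>x. u x + c)" by (rule locally_integrable_add[OF l(1) lc])
  fix f assume f: "test_function f"
  note t = test_function_pd[OF f, of i]
  have 1: "integrable lborel (\<lambda>x. pd i f x *\<^sub>R u x)"
    by (rule integrable_test_function_scaleR[OF t t l(1)])
  have 2: "integrable lborel (\<lambda>x. pd i f x *\<^sub>R c)"
    by (rule integrable_test_function_scaleR[OF t t lc])
  have 3: "integrable lborel (pd i f)"
    using integrable_test_function_scaleR[OF t t locally_integrable_const[of 1]]
    by simp
  have "(LBINT x. pd i f x *\<^sub>R (u x + c)) = (LBINT x. pd i f x *\<^sub>R u x) + (LBINT x. pd i f x) *\<^sub>R c"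
    using 1 2 3 by (simp add: scaleR_add_right)
  also have "(LBINT x. pd i f x) = 0" by (rule C1c_integral_pd[OF test_function_C1c[OF f]])
  also have "(LBINT x. pd i f x *\<^sub>R u x) = - (LBINT x. f x *\<^sub>R g x)"
    using assms f unfolding has_weak_partial_def pd_def by blast
  finally show "(LBINT x. frechet_derivative f (at x) (axis i 1) *\<^sub>R (u x + c)) = - (LBINT x. f x *\<^sub>R g x)"
    by (simp add: pd_def)
qed

text \<open>The predicates for the two functions coincide, so \<open>SOME\<close> selects the same
  representative, and equality holds everywhere rather than almost everywhere.\<close>

lemma weak_partial_shift:
  fixes n :: "real^2 \<Rightarrow> real^3"
  shows "weak_partial i (\<lambda>x. n x - c) = weak_partial i n"
proof -
  have "has_weak_partial i (\<lambda>x. n x - c) = has_weak_partial i n"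
  proof (intro ext iffI)
    fix g assume "has_weak_partial i (\<lambda>x. n x - c) g"
    from has_weak_partial_add_const[OF this, of c] show "has_weak_partial i n g" by simp
  next
    fix g assume "has_weak_partial i n g"
    from has_weak_partial_add_const[OF this, of "- c"] show "has_weak_partial i (\<lambda>x. n x - c) g" by simp
  qed
  then show ?thesis by (simp add: weak_partial_def)
qed

text \<open>The representative chosen by \<open>SOME\<close> agrees only almost everywhere with the
  derivative supplied by \<open>H2\<close>; integrability and second derivatives are carried over
  along this equality.\<close>

lemma admissible_weak_partial:
  assumes "n \<in> admissible"
  shows "has_weak_partial i n (weak_partial i n)" "weak_partial i n \<in> L2"
    "has_weak_partial j (weak_partial i n) (weak_partial j (weak_partial i n))"
    "weak_partial j (weak_partial i n) \<in> L2"
proof -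
  obtain g where g: "g \<in> L2" "has_weak_partial i (\<lambda>x. n x - e3) g" "\<And>j. \<exists>h \<in> L2. has_weak_partial j g h"
    using assms unfolding admissible_def H2_def by blast
  from has_weak_partial_add_const[OF g(2), of e3] have gn: "has_weak_partial i n g" by simp
  then show p: "has_weak_partial i n (weak_partial i n)" unfolding weak_partial_def by (rule someI[of "has_weak_partial i n"])
  have ae: "AE x in lborel. g x = weak_partial i n x" by (rule weak_partial_unique_vec[OF gn p])
  have lp: "locally_integrable (weak_partial i n)" using p by (simp add: has_weak_partial_def)
  show "weak_partial i n \<in> L2"
    by (rule L2_cong_AE[OF g(1) ae]) (use lp in \<open>simp add: locally_integrable_def\<close>)
  obtain h where h: "h \<in> L2" "has_weak_partial j g h" using g(3) by blast
  have hp: "has_weak_partial j (weak_partial i n) h" by (rule has_weak_partial_cong_AE[OF h(2) ae lp])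
  then show q: "has_weak_partial j (weak_partial i n) (weak_partial j (weak_partial i n))"
    unfolding weak_partial_def[of j] by (rule someI[of "has_weak_partial j (weak_partial i n)"])
  show "weak_partial j (weak_partial i n) \<in> L2"
    by (rule L2_cong_AE[OF h(1) weak_partial_unique_vec[OF hp q]])
       (use q in \<open>simp add: has_weak_partial_def locally_integrable_def\<close>)
qed

lemma norm_square_vec3: "(norm v)\<^sup>2 = (v $ 1)\<^sup>2 + (v $ 2)\<^sup>2 + (v $ 3)\<^sup>2" for v :: "real^3"
  unfolding power2_norm_eq_inner by (simp add: inner_vec_def sum_3 power2_eq_square)

lemma L2_component:
  fixes u :: "real^2 \<Rightarrow> real^3"
  assumes "u \<in> L2" shows "(\<lambda>x. u x $ j) \<in> L2"
proof -
  have "u \<in> borel_measurable borel" using assms by (simp add: L2_def)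
  note [measurable] = borel_measurable_component[OF this, of j]
  have "integrable lborel (\<lambda>x. (u x $ j)\<^sup>2)"
  proof (rule Bochner_Integration.integrable_bound)
    show "integrable lborel (\<lambda>x. (norm (u x))\<^sup>2)" using assms by (simp add: L2_def)
    show "AE x in lborel. norm ((u x $ j)\<^sup>2) \<le> norm ((norm (u x))\<^sup>2)"
      by (rule AE_I2) (use component_le_norm_cart in \<open>simp add: abs_le_square_iff[symmetric]\<close>)
  qed measurable
  then show ?thesis by (simp add: L2_real)
qed

text \<open>The product rule with a cutoff as test function. The term with the gradient of the
  cutoff disappears in the limit, and the common factor \<open>bump 1 0\<close> cancels.\<close>

lemma integral_by_parts:
  fixes v p :: "real^2 \<Rightarrow> real"
  assumes v: "v \<in> L2" "has_weak_partial i v p" and p: "p \<in> L2"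
    and q: "has_weak_partial 1 p (q 1)" "has_weak_partial 2 p (q 2)" "\<And>i. q i \<in> L2"
  shows "(LBINT x. v x * q i x) = - (LBINT x. (p x)\<^sup>2)"
proof -
  obtain C where C: "\<And>k x. \<bar>pd i (cutoff k) x\<bar> \<le> C" using cutoff_pd_bounded by metis
  note bm = cutoff_measurable
  note step = weak_product_rule[OF v p p q cutoff_C1c]
  have "(\<lambda>r. (LBINT x. pd i (cutoff r) x * (p x * v x)) + (LBINT x. cutoff r x * (q i x * v x))) \<longlonglongrightarrow>
     (LBINT x. 0 * (p x * v x)) + (LBINT x. bump 1 0 * (q i x * v x))"
    by (intro tendsto_add L2_limit_product[OF bm(2) C cutoff_pd_tendsto p p L2_limit_const v(1)]
          L2_limit_product[OF bm(1) cutoff_bounded cutoff_tendsto q(3) q(3) L2_limit_const v(1)])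
  moreover have "(\<lambda>r. - (LBINT x. cutoff r x * (p x * p x))) \<longlonglongrightarrow> - (LBINT x. bump 1 0 * (p x * p x))"
    by (intro tendsto_minus L2_limit_product[OF bm(1) cutoff_bounded cutoff_tendsto p p L2_limit_const p])
  ultimately have "(LBINT x. 0 * (p x * v x)) + (LBINT x. bump 1 0 * (q i x * v x)) = - (LBINT x. bump 1 0 * (p x * p x))"
    unfolding step using LIMSEQ_unique by blast
  then have "bump 1 0 * (LBINT x. q i x * v x) = bump 1 0 * - (LBINT x. p x * p x)" by simp
  then have "(LBINT x. q i x * v x) = - (LBINT x. p x * p x)"
    using bump_0(2)[of 1] by (simp only: mult_cancel_left) auto
  then show ?thesis by (simp add: power2_eq_square mult.commute)
qed

text \<open>If \<open>|z x|\<close> were at least 1 far out, then \<open>|z|\<close> would be at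
  least 1/2 on a ball whose radius does not depend on \<open>x\<close>. This contributes at least
  \<open>V/4\<close> to an integral over the exterior region that is smaller than
  \<open>V/4\<close>.\<close>

lemma uniformly_continuous_L2_tail:
  fixes z :: "real^2 \<Rightarrow> real"
  assumes "uniformly_continuous_on UNIV z" "z \<in> L2"
  obtains R where "\<And>x. R < norm x \<Longrightarrow> \<bar>z x\<bar> < 1"
proof -
  have [measurable]: "z \<in> borel_measurable borel" using assms by (simp add: L2_real)
  obtain d where d: "d > 0" "\<And>x y. dist y x < d \<Longrightarrow> \<bar>z y - z x\<bar> < 1/2"
    using assms(1)[unfolded uniformly_continuous_on_def, rule_format, of "1/2"] by (auto simp: dist_real_def)
  define V where "V = measure lborel (ball (0::real^2) d)"
  have V: "V > 0" "measure lborel (ball x d) = V" for x :: "real^2"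
    using d(1) by (auto simp: V_def content_ball)
  have "(\<lambda>k::nat. LBINT x. indicator {x. real k < norm x} x * (z x)\<^sup>2) \<longlonglongrightarrow> (LINT x|(lborel::(real^2) measure). 0)"
  proof (rule integral_dominated_convergence[where w="\<lambda>x. (z x)\<^sup>2"])
    show "integrable lborel (\<lambda>x. (z x)\<^sup>2)" using assms by (simp add: L2_real)
    show "AE x in lborel. (\<lambda>k::nat. indicator {x. real k < norm x} x * (z x)\<^sup>2) \<longlonglongrightarrow> 0"
    proof (rule AE_I2)
      fix x :: "real^2"
      obtain k0 where k0: "norm x \<le> real k0" using real_arch_simple by blast
      have "\<forall>\<^sub>F k::nat in sequentially. indicator {x. real k < norm x} x * (z x)\<^sup>2 = 0"
        using eventually_ge_at_top[of k0] by eventually_elim (use k0 in auto)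
      then show "(\<lambda>k::nat. indicator {x. real k < norm x} x * (z x)\<^sup>2) \<longlonglongrightarrow> 0" by (rule tendsto_eventually)
    qed
    show "AE x in lborel. norm (indicator {x. real k < norm x} x * (z x)\<^sup>2) \<le> (z x)\<^sup>2" for k :: nat
      by (rule AE_I2) (auto simp: indicator_def)
  qed measurable
  then have "\<forall>\<^sub>F k in sequentially. (LBINT x. indicator {x. real k < norm x} x * (z x)\<^sup>2) < V / 4"
    by (rule order_tendstoD) (use V in simp)
  then obtain k where k: "(LBINT x. indicator {x. real k < norm x} x * (z x)\<^sup>2) < V / 4"
    using eventually_happens'[OF sequentially_bot] by blast
  show thesis
  proof (rule that[of "real k + d"])
    fix x :: "real^2" assume x: "real k + d < norm x"
    show "\<bar>z x\<bar> < 1"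
    proof (rule ccontr)
      assume "\<not> \<bar>z x\<bar> < 1"
      have ib: "integrable lborel (\<lambda>y. 1/4 * indicator (ball x d) y :: real)"
        by (intro integrable_mult_right integrable_real_indicator) (use emeasure_bounded_finite in auto)
      have iz: "integrable lborel (\<lambda>y. indicator {x. real k < norm x} y * (z y)\<^sup>2)"
      proof (rule Bochner_Integration.integrable_bound)
        show "integrable lborel (\<lambda>x. (z x)\<^sup>2)" using assms by (simp add: L2_real)
        show "AE y in lborel. norm (indicator {x. real k < norm x} y * (z y)\<^sup>2) \<le> norm ((z y)\<^sup>2)"
          by (rule AE_I2) (auto simp: indicator_def)
      qed measurable
      have "V / 4 = (LBINT y. 1/4 * indicator (ball x d) y)" using V(2)[of x] by simp
      also have "\<dots> \<le> (LBINT y. indicator {x. real k < norm x} y * (z y)\<^sup>2)"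
      proof (rule integral_mono)
        fix y
        show "1/4 * indicator (ball x d) y \<le> indicator {x. real k < norm x} y * (z y)\<^sup>2"
        proof (cases "y \<in> ball x d")
          case True
          then have yd: "dist y x < d" by (simp add: dist_commute)
          have "1/2 \<le> \<bar>z y\<bar>" using d(2)[OF yd] \<open>\<not> \<bar>z x\<bar> < 1\<close> by linarith
          then have "(1/2)\<^sup>2 \<le> \<bar>z y\<bar>\<^sup>2" by (intro power_mono) auto
          moreover have "real k < norm y" using yd x norm_triangle_ineq2[of x y] by (simp add: dist_norm norm_minus_commute)
          ultimately show ?thesis using True by (simp add: power_divide)
        qed simp
      qed (use ib iz in auto)
      finally show False using k by simp
    qed
  qed
qed

section \<open>Bessel functions of order zero\<close>

text \<open>In the variable \<open>t = r\<^sup>2\<close> Bessel's equation of order zero reads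
  \<open>4 (t y')' + y = 0\<close>. One solution is \<open>besJ t = J\<^sub>0 (sqrt t)\<close>; the Frobenius ansatz
  \<open>besJ t * ln t / 2 + besR t\<close> for a second one gives the coefficients of \<open>besR\<close>, which are
  those of \<open>- besJ\<close> multiplied by harmonic numbers.\<close>

definition besJ_coeff :: "nat \<Rightarrow> real" where "besJ_coeff m = (-1) ^ m / (4 ^ m * (fact m)\<^sup>2)"
definition besR_coeff :: "nat \<Rightarrow> real" where "besR_coeff m = - (besJ_coeff m * (\<Sum>i<m. 1 / real (Suc i)))"

definition besJ :: "real \<Rightarrow> real" where "besJ t = (\<Sum>m. besJ_coeff m * t ^ m)"
definition besJ1 :: "real \<Rightarrow> real" where "besJ1 t = (\<Sum>m. diffs besJ_coeff m * t ^ m)"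
definition besJ2 :: "real \<Rightarrow> real" where "besJ2 t = (\<Sum>m. diffs (diffs besJ_coeff) m * t ^ m)"
definition besR :: "real \<Rightarrow> real" where "besR t = (\<Sum>m. besR_coeff m * t ^ m)"
definition besR1 :: "real \<Rightarrow> real" where "besR1 t = (\<Sum>m. diffs besR_coeff m * t ^ m)"
definition besR2 :: "real \<Rightarrow> real" where "besR2 t = (\<Sum>m. diffs (diffs besR_coeff) m * t ^ m)"

lemma besJ_coeff_Suc: "4 * (real (Suc m))\<^sup>2 * besJ_coeff (Suc m) = - besJ_coeff m"
proof -
  have "besJ_coeff (Suc m) = - (((-1) ^ m) / (4 * 4 ^ m * ((real (Suc m))\<^sup>2 * (fact m)\<^sup>2)))"
    unfolding besJ_coeff_def fact_Suc power_mult_distrib by (simp add: of_nat_Suc)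
  then show ?thesis by (simp add: besJ_coeff_def field_simps del: of_nat_Suc)
qed

lemma besJ_coeff_bound: "\<bar>besJ_coeff m\<bar> \<le> 1 / fact m"
proof -
  have "fact m * 1 \<le> (fact m * (4 ^ m * fact m) :: real)"
    by (intro mult_left_mono) (auto simp: fact_ge_1 intro!: order_trans[OF _ mult_mono[of 1 "4^m" 1 "fact m"]])
  then show ?thesis
    by (simp add: besJ_coeff_def abs_mult power2_eq_square field_simps)
qed

lemma besR_coeff_bound: "\<bar>besR_coeff m\<bar> \<le> real m / fact m"
proof -
  have "0 \<le> (\<Sum>i<m. 1 / real (Suc i))" by (intro sum_nonneg) auto
  moreover have "(\<Sum>i<m. 1 / real (Suc i)) \<le> (\<Sum>i<m. 1)" by (intro sum_mono) auto
  ultimately have "\<bar>\<Sum>i<m. 1 / real (Suc i)\<bar> \<le> real m" by simp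
  then have "\<bar>besJ_coeff m\<bar> * \<bar>\<Sum>i<m. 1 / real (Suc i)\<bar> \<le> (1 / fact m) * real m"
    by (intro mult_mono besJ_coeff_bound) auto
  then show ?thesis by (simp add: besR_coeff_def abs_mult)
qed

lemma summable_besJ: "summable (\<lambda>m. besJ_coeff m * t ^ m)"
proof (rule summable_comparison_test'[of "\<lambda>m. \<bar>t\<bar> ^ m / fact m" 0])
  show "summable (\<lambda>m. \<bar>t\<bar> ^ m / fact m)" using summable_exp[of "\<bar>t\<bar>"] by (simp add: field_simps)
  show "norm (besJ_coeff n * t ^ n) \<le> \<bar>t\<bar> ^ n / fact n" for n
    using mult_right_mono[OF besJ_coeff_bound[of n], of "\<bar>t\<bar> ^ n"] by (simp add: abs_mult power_abs)
qed

lemma summable_besR: "summable (\<lambda>m. besR_coeff m * t ^ m)"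
proof (rule summable_comparison_test'[of "\<lambda>m. (2 * \<bar>t\<bar>) ^ m / fact m" 0])
  show "summable (\<lambda>m. (2 * \<bar>t\<bar>) ^ m / fact m)" using summable_exp[of "2 * \<bar>t\<bar>"] by (simp add: field_simps)
  fix n
  have "real n \<le> 2 ^ n" using of_nat_less_two_power[of n, where 'a=real] by simp
  then have "real n / fact n \<le> 2 ^ n / fact n" by (intro divide_right_mono) auto
  then have "\<bar>besR_coeff n\<bar> \<le> 2 ^ n / fact n" using besR_coeff_bound[of n] by linarith
  from mult_right_mono[OF this, of "\<bar>t\<bar> ^ n"]
  show "norm (besR_coeff n * t ^ n) \<le> (2 * \<bar>t\<bar>) ^ n / fact n" by (simp add: abs_mult power_abs power_mult_distrib)
qed

lemma besJ_deriv: "(besJ has_real_derivative besJ1 t) (at t)"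
  unfolding besJ_def[abs_def] besJ1_def by (rule termdiffs_strong_converges_everywhere) (rule summable_besJ)

lemma besJ1_deriv: "(besJ1 has_real_derivative besJ2 t) (at t)"
  unfolding besJ1_def[abs_def] besJ2_def
  by (rule termdiffs_strong_converges_everywhere) (rule termdiff_converges_all[OF summable_besJ])

lemma besR_deriv: "(besR has_real_derivative besR1 t) (at t)"
  unfolding besR_def[abs_def] besR1_def by (rule termdiffs_strong_converges_everywhere) (rule summable_besR)

lemma besR1_deriv: "(besR1 has_real_derivative besR2 t) (at t)"
  unfolding besR1_def[abs_def] besR2_def
  by (rule termdiffs_strong_converges_everywhere) (rule termdiff_converges_all[OF summable_besR])


text \<open>The operator \<open>4 (t y')'\<close> multiplies the coefficient of index
  \<open>m + 1\<close> by \<open>4 (m + 1)^2\<close> and lowers the index by one. Bessel's equation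
  thus becomes a recursion for the coefficients.\<close>

lemma euler_sum:
  fixes c :: "nat \<Rightarrow> real"
  assumes s: "\<And>t. summable (\<lambda>m. c m * t ^ m)"
  shows "4 * (t * (\<Sum>m. diffs (diffs c) m * t ^ m) + (\<Sum>m. diffs c m * t ^ m))
    = (\<Sum>m. 4 * (real (Suc m))\<^sup>2 * c (Suc m) * t ^ m)"
    "summable (\<lambda>m. 4 * (real (Suc m))\<^sup>2 * c (Suc m) * t ^ m)"
proof -
  have s1: "summable (\<lambda>m. diffs c m * t ^ m)" by (rule termdiff_converges_all[OF s])
  have s2: "summable (\<lambda>m. diffs (diffs c) m * t ^ m)" by (rule termdiff_converges_all[OF termdiff_converges_all[OF s]])
  have a: "(\<lambda>m. real (Suc m) * diffs c (Suc m) * t ^ Suc m) sums (t * (\<Sum>m. diffs (diffs c) m * t ^ m))"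
    using sums_mult[OF summable_sums[OF s2], of t] by (simp add: diffs_def mult_ac)
  have "(\<lambda>m. real m * diffs c m * t ^ m) sums (t * (\<Sum>m. diffs (diffs c) m * t ^ m))"
    using sums_Suc[OF a] by simp
  from sums_mult[OF sums_add[OF this summable_sums[OF s1]], of 4]
  have "(\<lambda>m. 4 * (real m * diffs c m * t ^ m + diffs c m * t ^ m)) sums
    (4 * (t * (\<Sum>m. diffs (diffs c) m * t ^ m) + (\<Sum>m. diffs c m * t ^ m)))" .
  moreover have "4 * (real m * diffs c m * t ^ m + diffs c m * t ^ m) = 4 * (real (Suc m))\<^sup>2 * c (Suc m) * t ^ m" for m
    by (simp add: diffs_def power2_eq_square algebra_simps)
  ultimately have "(\<lambda>m. 4 * (real (Suc m))\<^sup>2 * c (Suc m) * t ^ m) sums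
    (4 * (t * (\<Sum>m. diffs (diffs c) m * t ^ m) + (\<Sum>m. diffs c m * t ^ m)))" by (simp only:)
  then show "4 * (t * (\<Sum>m. diffs (diffs c) m * t ^ m) + (\<Sum>m. diffs c m * t ^ m))
    = (\<Sum>m. 4 * (real (Suc m))\<^sup>2 * c (Suc m) * t ^ m)"
    "summable (\<lambda>m. 4 * (real (Suc m))\<^sup>2 * c (Suc m) * t ^ m)"
    by (auto simp: sums_iff)
qed

lemma besJ_ode: "4 * (t * besJ2 t + besJ1 t) + besJ t = 0"
proof -
  have "4 * (t * besJ2 t + besJ1 t) = (\<Sum>m. - (besJ_coeff m * t ^ m))"
    unfolding besJ1_def besJ2_def euler_sum(1)[OF summable_besJ] besJ_coeff_Suc by simp
  also have "\<dots> = - besJ t" unfolding besJ_def by (rule suminf_minus[OF summable_besJ])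
  finally show ?thesis by simp
qed

lemma besR_coeff_Suc: "4 * (real (Suc m))\<^sup>2 * besR_coeff (Suc m) = - besR_coeff m - 4 * diffs besJ_coeff m"
proof -
  have "4 * (real (Suc m))\<^sup>2 * besR_coeff (Suc m) = - (4 * (real (Suc m))\<^sup>2 * besJ_coeff (Suc m)) * (\<Sum>i<m. 1 / real (Suc i)) 
      - (4 * (real (Suc m))\<^sup>2 * besJ_coeff (Suc m)) * (1 / real (Suc m))"
    by (simp add: besR_coeff_def algebra_simps del: of_nat_Suc)
  also have "(4 * (real (Suc m))\<^sup>2 * besJ_coeff (Suc m)) * (1 / real (Suc m)) = 4 * diffs besJ_coeff m"
    by (simp add: diffs_def power2_eq_square del: of_nat_Suc)
  also have "- (4 * (real (Suc m))\<^sup>2 * besJ_coeff (Suc m)) * (\<Sum>i<m. 1 / real (Suc i)) = - besR_coeff m"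
    unfolding besJ_coeff_Suc by (simp add: besR_coeff_def)
  finally show ?thesis .
qed

text \<open>The right-hand side cancels the term \<open>4 J'\<close> that arises when the operator
  hits the logarithm in \<open>besJ t * ln t / 2\<close>; in the coefficients it is the last summand
  of the harmonic sum.\<close>

lemma besR_ode: "4 * (t * besR2 t + besR1 t) + besR t = - 4 * besJ1 t"
proof -
  have s1: "summable (\<lambda>m. diffs besJ_coeff m * t ^ m)" by (rule termdiff_converges_all[OF summable_besJ])
  have "4 * (t * besR2 t + besR1 t) = (\<Sum>m. (- besR_coeff m - 4 * diffs besJ_coeff m) * t ^ m)"
    unfolding besR1_def besR2_def euler_sum(1)[OF summable_besR] besR_coeff_Suc by simp
  also have "\<dots> = (\<Sum>m. - (besR_coeff m * t ^ m) - 4 * (diffs besJ_coeff m * t ^ m))" by (simp add: algebra_simps)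
  also have "\<dots> = - besR t - 4 * besJ1 t" unfolding besR_def besJ1_def
    by (rule sums_unique[symmetric]) (intro sums_diff sums_minus sums_mult summable_sums s1 summable_besR)
  finally show ?thesis by simp
qed

lemma besJ_0: "besJ 0 = 1" and besJ1_0: "besJ1 0 = - 1/4"
  unfolding besJ_def besJ1_def powser_zero by (simp_all add: besJ_coeff_def diffs_def)

lemma isCont_bes: "isCont besJ t" "isCont besJ1 t" "isCont besR t" "isCont besR1 t"
  using besJ_deriv besJ1_deriv besR_deriv besR1_deriv DERIV_isCont by blast+

section \<open>The singular solution of Bessel's equation, normalised like ln r\<close>

definition phi :: "real \<Rightarrow> real \<Rightarrow> real" where
  "phi c t = besJ t * ln t / 2 + besR t + c * besJ t"
definition phi1 :: "real \<Rightarrow> real \<Rightarrow> real" where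
  "phi1 c t = besJ1 t * ln t / 2 + besJ t / (2 * t) + besR1 t + c * besJ1 t"
text \<open>Bessel's equation solved for the second derivative; \<open>phi1_deriv\<close> justifies
  the name.\<close>

definition phi2 :: "real \<Rightarrow> real \<Rightarrow> real" where
  "phi2 c t = - (4 * phi1 c t + phi c t) / (4 * t)"

lemma phi_deriv: "t > 0 \<Longrightarrow> (phi c has_real_derivative phi1 c t) (at t)"
  unfolding phi_def[abs_def] phi1_def
  by (auto intro!: derivative_eq_intros besJ_deriv besR_deriv simp: field_simps)

lemma phi1_deriv:
  assumes "t > 0" shows "(phi1 c has_real_derivative phi2 c t) (at t)"
proof -
  have "(phi1 c has_real_derivative besJ2 t * ln t / 2 + besJ1 t / t - besJ t / (2 * t\<^sup>2) + besR2 t + c * besJ2 t) (at t)"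
    using assms unfolding phi1_def[abs_def]
    by (auto intro!: derivative_eq_intros besJ_deriv besJ1_deriv besR1_deriv simp: field_simps power2_eq_square)
  moreover have "besJ2 t * ln t / 2 + besJ1 t / t - besJ t / (2 * t\<^sup>2) + besR2 t + c * besJ2 t = phi2 c t"
  proof -
    have j: "t * besJ2 t = - besJ1 t - besJ t / 4" using besJ_ode[of t] by (simp add: algebra_simps)
    have k: "t * besR2 t = - besJ1 t - besR1 t - besR t / 4" using besR_ode[of t] by (simp add: algebra_simps)
    have "t * (besJ2 t * ln t / 2 + besJ1 t / t - besJ t / (2 * t\<^sup>2) + besR2 t + c * besJ2 t)
       = (t * besJ2 t) * (ln t / 2 + c) + besJ1 t - besJ t / (2 * t) + t * besR2 t"
      using assms by (simp add: field_simps power2_eq_square)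
    also have "\<dots> = t * phi2 c t"
      unfolding j k phi2_def phi1_def phi_def using assms by (simp add: field_simps)
    finally show ?thesis using assms by simp
  qed
  ultimately show ?thesis by simp
qed

lemma phi_ode: "t > 0 \<Longrightarrow> 4 * (t * phi2 c t + phi1 c t) + phi c t = 0"
  by (simp add: phi2_def field_simps)

lemma phi_continuous:
  "continuous_on {0<..} (phi c)" "continuous_on {0<..} (phi1 c)" "continuous_on {0<..} (phi2 c)"
proof -
  show 1: "continuous_on {0<..} (phi c)" "continuous_on {0<..} (phi1 c)"
    using phi_deriv phi1_deriv by (auto intro!: continuous_at_imp_continuous_on DERIV_isCont)
  show "continuous_on {0<..} (phi2 c)"
    unfolding phi2_def[abs_def] by (intro continuous_intros 1) auto
qed

lemma sqrt_ln_tendsto_0: "((\<lambda>t::real. sqrt t * ln t) \<longlongrightarrow> 0) (at_right 0)"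
proof -
  have "((\<lambda>s::real. ln (sqrt s) / sqrt s) \<longlongrightarrow> 0) at_top"
    by (rule filterlim_compose[OF ln_x_over_x_tendsto_0 sqrt_at_top])
  then have "((\<lambda>s::real. - 2 * (ln (sqrt s) / sqrt s)) \<longlongrightarrow> - 2 * 0) at_top" by (intro tendsto_intros)
  then have "((\<lambda>t::real. - 2 * (ln (sqrt (inverse t)) / sqrt (inverse t))) \<longlongrightarrow> - 2 * 0) (at_right 0)"
    by (rule filterlim_compose[OF _ filterlim_inverse_at_top_right])
  then have l: "((\<lambda>t::real. - 2 * (ln (sqrt (inverse t)) / sqrt (inverse t))) \<longlongrightarrow> 0) (at_right 0)" by simp
  have "- 2 * (ln (sqrt (inverse t)) / sqrt (inverse t)) = sqrt t * ln t" if "t > 0" for t :: real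
    using that by (simp add: ln_sqrt ln_inverse real_sqrt_inverse) (simp only: divide_inverse inverse_inverse_eq mult.commute)
  then show ?thesis
    by (intro Lim_transform_eventually[OF l]) (auto simp: eventually_at_right_field intro!: exI[of _ 1])
qed

lemma at_right_tendsto:
  assumes "isCont f (0::real)" shows "(f \<longlongrightarrow> f 0) (at_right 0)"
  using assms unfolding isCont_def by (rule tendsto_mono[rotated]) (simp add: at_le)

lemma sqrt_phi_tendsto_0: "((\<lambda>t. sqrt t * phi c t) \<longlongrightarrow> 0) (at_right 0)"
proof -
  have s: "((\<lambda>t::real. sqrt t) \<longlongrightarrow> 0) (at_right 0)"
    using at_right_tendsto[of sqrt] isCont_real_sqrt[of 0] by simp
  have "((\<lambda>t. besJ t * (sqrt t * ln t) / 2 + sqrt t * besR t + sqrt t * (c * besJ t)) \<longlongrightarrow> besJ 0 * 0 / 2 + 0 * besR 0 + 0 * (c * besJ 0)) (at_right 0)"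
    by (intro tendsto_intros at_right_tendsto isCont_bes s sqrt_ln_tendsto_0) simp_all
  then show ?thesis by (simp add: phi_def algebra_simps)
qed

text \<open>The strength of the logarithmic pole. In terms of \<open>t = r^2\<close> the flux
  through a small circle is 4 pi times this expression, so the limit 1/2 stands for a point mass 2
  pi at the centre.\<close>

lemma t_phi1_tendsto: "((\<lambda>t. t * phi1 c t) \<longlongrightarrow> 1/2) (at_right 0)"
proof -
  have s: "((\<lambda>t::real. sqrt t) \<longlongrightarrow> 0) (at_right 0)"
    using at_right_tendsto[of sqrt] isCont_real_sqrt[of 0] by simp
  have "((\<lambda>t. sqrt t * (besJ1 t * (sqrt t * ln t) / 2) + besJ t / 2 + t * (besR1 t + c * besJ1 t)) \<longlongrightarrow> 
      0 * (besJ1 0 * 0 / 2) + besJ 0 / 2 + 0 * (besR1 0 + c * besJ1 0)) (at_right 0)"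
    by (intro tendsto_intros at_right_tendsto isCont_bes s sqrt_ln_tendsto_0) simp_all
  then have l: "((\<lambda>t. sqrt t * (besJ1 t * (sqrt t * ln t) / 2) + besJ t / 2 + t * (besR1 t + c * besJ1 t)) \<longlongrightarrow> 1/2) (at_right 0)"
    by (simp add: besJ_0)
  show ?thesis
  proof (rule Lim_transform_eventually[OF l])
    have "sqrt t * (besJ1 t * (sqrt t * ln t) / 2) + besJ t / 2 + t * (besR1 t + c * besJ1 t) = t * phi1 c t" if "t > 0" for t
    proof -
      have "sqrt t * (besJ1 t * (sqrt t * ln t) / 2) = (sqrt t * sqrt t) * (besJ1 t * ln t / 2)" by simp
      also have "\<dots> = t * (besJ1 t * ln t / 2)" using that by simp
      finally show ?thesis using that by (simp add: phi1_def field_simps)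
    qed
    then show "\<forall>\<^sub>F t in at_right 0. sqrt t * (besJ1 t * (sqrt t * ln t) / 2) + besJ t / 2 + t * (besR1 t + c * besJ1 t) = t * phi1 c t"
      unfolding eventually_at_right_field by (intro exI[of _ 1]) auto
  qed
qed

lemma t_phi_tendsto: "((\<lambda>t. t * phi c t) \<longlongrightarrow> 0) (at_right 0)"
proof -
  have s: "((\<lambda>t::real. sqrt t) \<longlongrightarrow> 0) (at_right 0)"
    using at_right_tendsto[of sqrt] isCont_real_sqrt[of 0] by simp
  have l: "((\<lambda>t. sqrt t * (sqrt t * phi c t)) \<longlongrightarrow> 0) (at_right 0)"
    using tendsto_mult[OF s sqrt_phi_tendsto_0] by simp
  have "sqrt t * (sqrt t * phi c t) = t * phi c t" if "t > 0" for t
    using that by (simp add: mult.assoc[symmetric])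
  then show ?thesis
    by (intro Lim_transform_eventually[OF l]) (auto simp: eventually_at_right_field intro!: exI[of _ 1])
qed

text \<open>The antiderivative of \<open>phi\<^sup>2\<close> behind Lommel's integral.\<close>

definition lommel :: "real \<Rightarrow> real \<Rightarrow> real" where
  "lommel c t = t * (phi c t)\<^sup>2 + 4 * (t * phi1 c t)\<^sup>2"

lemma lommel_deriv:
  assumes "t > 0" shows "(lommel c has_real_derivative (phi c t)\<^sup>2) (at t)"
proof -
  have "(lommel c has_real_derivative (phi c t)\<^sup>2 + 2 * t * phi c t * phi1 c t + 8 * (t * phi1 c t) * (phi1 c t + t * phi2 c t)) (at t)"
    unfolding lommel_def[abs_def] using assms
    by (auto intro!: derivative_eq_intros phi_deriv phi1_deriv simp: power2_eq_square algebra_simps)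
  moreover have "8 * (t * phi1 c t) * (phi1 c t + t * phi2 c t) = - 2 * t * phi c t * phi1 c t"
  proof -
    have "phi1 c t + t * phi2 c t = - phi c t / 4" using phi_ode[OF assms, of c] by (simp add: algebra_simps)
    then show ?thesis by simp
  qed
  ultimately show ?thesis by simp
qed

text \<open>The limit is \<open>4 * (1/2)^2\<close>, contributed by the pole alone. It is the origin
  of the summand -1 in \<open>1 / alpha^2 - 1\<close>, the integral of \<open>phi\<^sup>2\<close>
  from 0 to its zero.\<close>

lemma lommel_tendsto: "(lommel c \<longlongrightarrow> 1) (at_right 0)"
proof -
  have "((\<lambda>t. (sqrt t * phi c t)\<^sup>2 + 4 * (t * phi1 c t)\<^sup>2) \<longlongrightarrow> 0\<^sup>2 + 4 * (1/2)\<^sup>2) (at_right 0)"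
    by (intro tendsto_intros sqrt_phi_tendsto_0 t_phi1_tendsto)
  then have l: "((\<lambda>t. (sqrt t * phi c t)\<^sup>2 + 4 * (t * phi1 c t)\<^sup>2) \<longlongrightarrow> 1) (at_right 0)"
    by (simp add: power2_eq_square)
  show ?thesis
    by (rule Lim_transform_eventually[OF l])
       (auto simp: eventually_at_right_field lommel_def power_mult_distrib intro!: exI[of _ 1])
qed

text \<open>Both functions solve the same self-adjoint equation, so the expression is constant on
  the positive axis; its value is the limit at 0, where \<open>besJ\<close> is 1 and
  \<open>t * phi1 c t\<close> tends to 1/2.\<close>

lemma wronskian: 
  assumes "t > 0" shows "t * (besJ t * phi1 c t - phi c t * besJ1 t) = 1/2"
proof -
  define W where "W t = t * (besJ t * phi1 c t - phi c t * besJ1 t)" for t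
  have "(W has_real_derivative 0) (at t)" if "t > 0" for t
  proof -
    have "(W has_real_derivative (besJ t * phi1 c t - phi c t * besJ1 t) + t * (besJ t * phi2 c t - phi c t * besJ2 t)) (at t)"
      unfolding W_def[abs_def] using that
      by (auto intro!: derivative_eq_intros phi_deriv phi1_deriv besJ_deriv besJ1_deriv simp: algebra_simps)
    moreover have "(besJ t * phi1 c t - phi c t * besJ1 t) + t * (besJ t * phi2 c t - phi c t * besJ2 t) 
       = besJ t * (4 * (t * phi2 c t + phi1 c t) + phi c t) / 4 - phi c t * (4 * (t * besJ2 t + besJ1 t) + besJ t) / 4"
      by (simp add: field_simps)
    ultimately show ?thesis by (simp only: phi_ode[OF that] besJ_ode) simp
  qed
  then have const: "W s = W t" if "s > 0" for s
    using that assms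
    by (intro DERIV_isconst3[of 0 "s + t + 1" s t W]) auto
  have "((\<lambda>t. besJ t * (t * phi1 c t) - (t * phi c t) * besJ1 t) \<longlongrightarrow> besJ 0 * (1/2) - 0 * besJ1 0) (at_right 0)"
    by (intro tendsto_intros at_right_tendsto isCont_bes t_phi1_tendsto t_phi_tendsto)
  then have "(W \<longlongrightarrow> 1/2) (at_right 0)"
    by (simp add: W_def[abs_def] besJ_0 algebra_simps)
  moreover have "(W \<longlongrightarrow> W t) (at_right 0)"
    by (rule Lim_transform_eventually[OF tendsto_const])
       (auto simp: eventually_at_right_field const[symmetric] intro!: exI[of _ 1])
  ultimately show ?thesis
    using tendsto_unique[of "at_right (0::real)"] by (metis W_def trivial_limit_at_right_real)
qed

text \<open>By the equation, \<open>phi2\<close> has the sign opposite to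
  \<open>4 phi1 + phi\<close>, and \<open>t\<close> times the latter tends to 2. This sign makes the
  defect of the regularisation non-negative near the centre.\<close>

lemma phi2_neg_near_0: "\<forall>\<^sub>F t in at_right 0. phi2 c t < 0"
proof -
  have "((\<lambda>t. 4 * (t * phi1 c t) + t * phi c t) \<longlongrightarrow> 4 * (1/2) + 0) (at_right 0)"
    by (intro tendsto_intros t_phi1_tendsto t_phi_tendsto)
  then have "\<forall>\<^sub>F t in at_right 0. 4 * (t * phi1 c t) + t * phi c t > 0"
    by (rule order_tendstoD) simp
  moreover have "\<forall>\<^sub>F t in at_right (0::real). t > 0"
    by (auto simp: eventually_at_right_field intro!: exI[of _ 1])
  ultimately show ?thesis
  proof eventually_elim
    fix t :: real assume a: "0 < 4 * (t * phi1 c t) + t * phi c t" "0 < t"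
    then have "0 < t * (4 * phi1 c t + phi c t)" by (simp add: algebra_simps)
    then have "0 < 4 * phi1 c t + phi c t" using a(2) by (simp add: zero_less_mult_iff)
    then show "phi2 c t < 0" using a(2) by (simp add: phi2_def divide_neg_pos)
  qed
qed

section \<open>The first zero of J_1 and the sign of J_0 there\<close>

lemma bessel_J0: "bessel_J 0 r = besJ (r\<^sup>2)"
proof -
  have "(-1) ^ m / (fact m * fact (m + 0)) * (r / 2) ^ (2 * m + 0) = besJ_coeff m * (r\<^sup>2) ^ m" for m
    by (simp add: besJ_coeff_def power_mult power_divide power2_eq_square)
  then show ?thesis unfolding bessel_J_def besJ_def by presburger
qed

lemma bessel_J1: "bessel_J 1 r = - 2 * r * besJ1 (r\<^sup>2)"
proof -
  have "(-1) ^ m / (fact m * fact (m + 1)) * (r / 2) ^ (2 * m + 1) = - 2 * r * (diffs besJ_coeff m * (r\<^sup>2) ^ m)" for m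
    by (simp add: besJ_coeff_def diffs_def power_mult power_divide power2_eq_square divide_simps)
  moreover have "(\<lambda>m. - 2 * r * (diffs besJ_coeff m * (r\<^sup>2) ^ m)) sums (- 2 * r * besJ1 (r\<^sup>2))"
    unfolding besJ1_def by (intro sums_mult summable_sums termdiff_converges_all[OF summable_besJ])
  ultimately show ?thesis unfolding bessel_J_def by (simp add: sums_iff)
qed

text \<open>Supplies the sign change that proves a positive zero of J_1 to exist; 16 corresponds to
  r = 4. The first five terms add up to 1/180, and the remaining ones, dominated by a geometric
  series of ratio 1/4, to at most 1/250 in absolute value.\<close>

lemma besJ1_16_pos: "besJ1 16 > 0"
proof -
  define f where "f m = diffs besJ_coeff m * 16 ^ m" for m
  have s: "summable f" unfolding f_def by (rule termdiff_converges_all[OF summable_besJ])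
  have f: "f m = - ((-1) ^ m * 4 ^ m / (4 * (fact m * fact (Suc m))))" for m
  proof -
    have "(16::real) ^ m = 4 ^ m * 4 ^ m" by (simp flip: power_mult_distrib)
    then show ?thesis by (simp add: f_def diffs_def besJ_coeff_def power2_eq_square divide_simps)
  qed
  have b: "\<bar>f (m + 5)\<bar> \<le> 4 ^ 5 / (4 * (fact 5 * fact 6)) * (1/4) ^ m" for m
  proof (induction m)
    case 0 then show ?case by (simp add: f abs_mult)
  next
    case (Suc m)
    have "\<bar>f (Suc n)\<bar> = \<bar>f n\<bar> * (4 / ((real n + 1) * (real n + 2)))" for n
      by (simp add: f abs_mult divide_simps) (simp add: algebra_simps)
    note st = this
    have "Suc m + 5 = Suc (m + 5)" "real (m + 5) + 1 = real m + 6" "real (m + 5) + 2 = real m + 7" by simp_all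
    with st[of "m + 5"] have "\<bar>f (Suc m + 5)\<bar> = \<bar>f (m + 5)\<bar> * (4 / ((real m + 6) * (real m + 7)))"
      by (simp only:)
    also have "\<dots> \<le> \<bar>f (m + 5)\<bar> * (1/4)"
    proof (intro mult_left_mono)
      have "16 \<le> (real m + 6) * (real m + 7)" using mult_mono[of 6 "real m + 6" 7 "real m + 7"] by simp
      then have "4 / ((real m + 6) * (real m + 7)) \<le> 4 / 16" by (intro divide_left_mono) auto
      then show "4 / ((real m + 6) * (real m + 7)) \<le> 1/4" by simp
    qed simp
    finally show ?case using Suc by simp
  qed
  have g: "(\<lambda>m. 4 ^ 5 / (4 * (fact 5 * fact 6)) * (1/4) ^ m) sums (4 ^ 5 / (4 * (fact 5 * fact 6)) * (1 / (1 - 1/4 :: real)))"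
    by (intro sums_mult geometric_sums) simp
  have "\<bar>\<Sum>m. f (m + 5)\<bar> \<le> (\<Sum>m. 4 ^ 5 / (4 * (fact 5 * fact 6)) * (1/4) ^ m :: real)"
    by (rule norm_suminf_le[where f="\<lambda>m. f (m + 5)", simplified]) (use b g in \<open>auto simp: sums_iff\<close>)
  also have "\<dots> = 4 ^ 5 / (4 * (fact 5 * fact 6)) * (1 / (1 - 1/4))" using g by (simp add: sums_iff)
  finally have t: "\<bar>\<Sum>m. f (m + 5)\<bar> \<le> 1/250" by (simp add: fact_numeral)
  have "besJ1 16 = (\<Sum>m. f (m + 5)) + (\<Sum>m<5. f m)"
    unfolding besJ1_def f_def[symmetric] by (rule suminf_split_initial_segment[OF s])
  moreover have "(\<Sum>m<5. f m) = 1/180"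
    by (simp add: f numeral_eq_Suc lessThan_Suc)
  ultimately show ?thesis using t by simp
qed

text \<open>The zeros in \<open>[0, 16]\<close> form a non-empty compact set, and 0 is not among
  them because \<open>besJ1 0\<close> is -1/4; so the smallest one is positive. It shows that the
  \<open>LEAST\<close> in \<open>r_star\<close> is attained.\<close>

lemma first_zero_besJ1:
  obtains T where "T > 0" "besJ1 T = 0" "\<And>t. 0 < t \<Longrightarrow> besJ1 t = 0 \<Longrightarrow> T \<le> t"
proof -
  have c: "continuous_on A besJ1" for A
    using isCont_bes(2) by (simp add: continuous_at_imp_continuous_on)
  define Z where "Z = {t \<in> {0..16}. besJ1 t = 0}"
  have "\<exists>x\<ge>0. x \<le> 16 \<and> besJ1 x = 0"
    by (rule IVT'[OF _ _ _ c]) (use besJ1_0 besJ1_16_pos in auto)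
  then have "Z \<noteq> {}" by (auto simp: Z_def)
  moreover have "compact Z"
  proof -
    have "closed {t \<in> {0..16::real}. besJ1 t \<in> {0}}"
      by (rule continuous_closed_preimage[OF c, unfolded vimage_def, simplified Int_def, simplified]) auto
    then have "closed Z" by (simp add: Z_def)
    moreover have "bounded Z" by (rule bounded_subset[of "{0..16}"]) (auto simp: Z_def)
    ultimately show ?thesis by (simp add: compact_eq_bounded_closed)
  qed
  ultimately obtain T where T: "T \<in> Z" "\<And>t. t \<in> Z \<Longrightarrow> T \<le> t"
    using compact_attains_inf[of Z] by auto
  show thesis
  proof (rule that[of T])
    show "besJ1 T = 0" using T by (simp add: Z_def)
    show "T > 0" using T besJ1_0 by (cases "T = 0") (auto simp: Z_def)
    fix t :: real assume "0 < t" "besJ1 t = 0"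
    then show "T \<le> t" using T by (cases "t \<le> 16") (auto simp: Z_def)
  qed
qed

lemma r_star:
  shows "0 < r_star\<^sup>2" "besJ1 (r_star\<^sup>2) = 0" "\<And>t. 0 < t \<Longrightarrow> besJ1 t = 0 \<Longrightarrow> r_star\<^sup>2 \<le> t"
proof -
  obtain T where T: "T > 0" "besJ1 T = 0" "\<And>t. 0 < t \<Longrightarrow> besJ1 t = 0 \<Longrightarrow> T \<le> t" using first_zero_besJ1 by metis
  have "r_star = sqrt T" unfolding r_star_def
  proof (rule Least_equality)
    show "0 < sqrt T \<and> bessel_J 1 (sqrt T) = 0" using T by (simp add: bessel_J1[unfolded One_nat_def])
    fix r :: real assume r: "0 < r \<and> bessel_J 1 r = 0"
    then have "T \<le> r\<^sup>2" by (intro T(3)) (auto simp: bessel_J1[unfolded One_nat_def])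
    then show "sqrt T \<le> r" using r by (simp add: real_le_lsqrt)
  qed
  then have "r_star\<^sup>2 = (sqrt T)\<^sup>2" by (simp only:)
  also have "\<dots> = T" using T(1) by simp
  finally have "r_star\<^sup>2 = T" .
  then show "0 < r_star\<^sup>2" "besJ1 (r_star\<^sup>2) = 0" "\<And>t. 0 < t \<Longrightarrow> besJ1 t = 0 \<Longrightarrow> r_star\<^sup>2 \<le> t"
    using T by auto
qed

lemma besJ_r_star: "besJ (r_star\<^sup>2) = - alpha"
  by (simp add: alpha_def bessel_J0)

text \<open>Before its first zero \<open>T\<close>, \<open>besJ1\<close> is negative, so
  \<open>besJ\<close> decreases. If \<open>besJ T\<close> were non-negative, \<open>besJ\<close>
  would be positive before \<open>T\<close>; then \<open>t * besJ1 t\<close>, whose derivative is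
  \<open>- besJ t / 4\<close>, would decrease strictly from 0, contradicting
  \<open>besJ1 T = 0\<close>.\<close>

lemma alpha_pos: "alpha > 0"
proof (rule ccontr)
  assume "\<not> alpha > 0"
  define T where "T = r_star\<^sup>2"
  have T: "T > 0" "besJ1 T = 0" "\<And>t. 0 < t \<Longrightarrow> besJ1 t = 0 \<Longrightarrow> T \<le> t" using r_star by (auto simp: T_def)
  have jT: "besJ T \<ge> 0" using \<open>\<not> alpha > 0\<close> by (simp add: T_def besJ_r_star)
  have c: "continuous_on A besJ1" for A
    using isCont_bes(2) by (simp add: continuous_at_imp_continuous_on)
  have neg: "besJ1 t < 0" if "0 < t" "t < T" for t
  proof (rule ccontr)
    assume "\<not> besJ1 t < 0"
    then have "\<exists>x\<ge>0. x \<le> t \<and> besJ1 x = 0"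
      by (intro IVT'[OF _ _ _ c]) (use besJ1_0 that in auto)
    then obtain x where "x \<ge> 0" "x \<le> t" "besJ1 x = 0" by auto
    then show False using T(3)[of x] that besJ1_0 by (cases "x = 0") auto
  qed
  have pos: "besJ t > 0" if "0 < t" "t < T" for t
  proof -
    have "besJ T < besJ t"
    proof (rule DERIV_neg_imp_decreasing_open[OF that(2)])
      show "\<exists>y. (besJ has_real_derivative y) (at x) \<and> y < 0" if "t < x" "x < T" for x
        using besJ_deriv neg[of x] that \<open>0 < t\<close> by auto
      show "continuous_on {t..T} besJ" using isCont_bes(1) by (simp add: continuous_at_imp_continuous_on)
    qed
    then show ?thesis using jT by simp
  qed
  have d: "((\<lambda>t. t * besJ1 t) has_real_derivative - besJ t / 4) (at t)" for t
  proof -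
    have "((\<lambda>t. t * besJ1 t) has_real_derivative besJ1 t + t * besJ2 t) (at t)"
      by (auto intro!: derivative_eq_intros besJ1_deriv)
    moreover have "besJ1 t + t * besJ2 t = - besJ t / 4" using besJ_ode[of t] by simp
    ultimately show ?thesis by simp
  qed
  have "T * besJ1 T < 0 * besJ1 0"
  proof (rule DERIV_neg_imp_decreasing_open[OF T(1)])
    show "\<exists>y. ((\<lambda>t. t * besJ1 t) has_real_derivative y) (at x) \<and> y < 0" if "0 < x" "x < T" for x
      using d[of x] pos[OF that] by (intro exI[of _ "- besJ x / 4"]) auto
    show "continuous_on {0..T} (\<lambda>t. t * besJ1 t)" by (intro continuous_intros c)
  qed
  then show False using T by simp
qed

text \<open>The free multiple \<open>c\<close> of \<open>besJ\<close> is adjusted so that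
  \<open>phi\<close> vanishes at \<open>r_star^2\<close>; the Wronskian then determines the slope,
  and the slope determines \<open>lommel\<close>.\<close>

lemma alpha_solution:
  obtains c where "phi c (r_star\<^sup>2) = 0" "r_star\<^sup>2 * phi1 c (r_star\<^sup>2) = - 1 / (2 * alpha)"
    "lommel c (r_star\<^sup>2) = 1 / alpha\<^sup>2"
proof -
  define T where "T = r_star\<^sup>2"
  have T: "T > 0" "besJ1 T = 0" "besJ T = - alpha" using r_star besJ_r_star by (auto simp: T_def)
  define c where "c = (besJ T * ln T / 2 + besR T) / alpha"
  have p: "phi c T = 0" using T alpha_pos by (simp add: phi_def c_def)
  \<comment> \<open>The product \<open>phi * besJ1\<close> of the Wronskian drops out because
    \<open>phi\<close> vanishes at \<open>T\<close>.\<close>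
  have "T * (besJ T * phi1 c T) = 1/2" using wronskian[OF T(1), of c] p by simp
  then have q: "T * phi1 c T = - 1 / (2 * alpha)" using T alpha_pos by (simp add: field_simps)
  have "lommel c T = 1 / alpha\<^sup>2" unfolding lommel_def p q by (simp add: power2_eq_square)
  then show thesis using that[of c] p q by (simp add: T_def)
qed

text \<open>The disc of radius \<open>sqrt t\<close> has area \<open>pi * t\<close>, so squared
  distance pushes planar Lebesgue measure forward to \<open>pi\<close> times Lebesgue measure on the
  half-line. Polar coordinates are thereby avoided; comparing half-lines suffices.\<close>

lemma distr_radial:
  "distr lborel borel (\<lambda>x::real^2. (norm (x - a))\<^sup>2) = density lborel (\<lambda>t. ennreal (pi * indicator {0..} t))"
proof (rule measure_eqI_generator_eq[where E="range (\<lambda>a::real. {..a})" and \<Omega>=UNIV and A="\<lambda>i. {..real i}"])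
  have eq: "emeasure (distr lborel borel (\<lambda>x::real^2. (norm (x - a))\<^sup>2)) {..t} = ennreal (pi * max 0 t)
     \<and> emeasure (density lborel (\<lambda>t. ennreal (pi * indicator {0..} t))) {..t} = ennreal (pi * max 0 t)" for t
  proof
    have "emeasure (distr lborel borel (\<lambda>x::real^2. (norm (x - a))\<^sup>2)) {..t} = emeasure lborel {x::real^2. (norm (x - a))\<^sup>2 \<le> t}"
      by (subst emeasure_distr) (auto simp: vimage_def)
    also have "\<dots> = ennreal (pi * max 0 t)"
    proof (cases "t \<ge> 0")
      case True
      have "{x::real^2. (norm (x - a))\<^sup>2 \<le> t} = cball a (sqrt t)"
      proof -
        have "norm (x - a) \<le> sqrt t \<longleftrightarrow> (norm (x - a))\<^sup>2 \<le> t" for x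
          using real_sqrt_le_iff[of "(norm (x - a))\<^sup>2" t] unfolding real_sqrt_abs abs_norm_cancel .
        then show ?thesis by (simp add: set_eq_iff dist_norm norm_minus_commute[of a])
      qed
      then show ?thesis using True by (simp add: emeasure_cball unit_ball_vol_2)
    next
      case False
      then have "{x::real^2. (norm (x - a))\<^sup>2 \<le> t} = {}"
        using order_trans[OF zero_le_power2] by auto
      then show ?thesis using False by simp
    qed
    finally show "emeasure (distr lborel borel (\<lambda>x::real^2. (norm (x - a))\<^sup>2)) {..t} = ennreal (pi * max 0 t)" .
    have "emeasure (density lborel (\<lambda>t. ennreal (pi * indicator {0..} t))) {..t} 
      = (\<integral>\<^sup>+s. ennreal (pi * indicator {0..} s) * indicator {..t} s \<partial>lborel)"
      by (subst emeasure_density) auto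
    also have "\<dots> = (\<integral>\<^sup>+s. ennreal pi * indicator {0..t} s \<partial>lborel)"
      by (intro nn_integral_cong) (auto simp: indicator_def)
    also have "\<dots> = ennreal (pi * max 0 t)"
      by (subst nn_integral_cmult_indicator) (auto simp: ennreal_mult max_def)
    finally show "emeasure (density lborel (\<lambda>t. ennreal (pi * indicator {0..} t))) {..t} = ennreal (pi * max 0 t)" .
  qed
  show "Int_stable (range (\<lambda>a::real. {..a}))"
  proof (rule Int_stableI_image)
    fix i j :: real show "\<exists>k\<in>UNIV. {..i} \<inter> {..j} = {..k}"
      by (intro bexI[of _ "min i j"]) auto
  qed
  show "emeasure (distr lborel borel (\<lambda>x::real^2. (norm (x - a))\<^sup>2)) X = emeasure (density lborel (\<lambda>t. ennreal (pi * indicator {0..} t))) X"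
    if "X \<in> range (\<lambda>a. {..a})" for X using that eq by auto
  show "sets (distr lborel borel (\<lambda>x::real^2. (norm (x - a))\<^sup>2)) = sigma_sets UNIV (range (\<lambda>a::real. {..a}))"
    "sets (density lborel (\<lambda>t. ennreal (pi * indicator {0..} t))) = sigma_sets UNIV (range (\<lambda>a::real. {..a}))"
    by (simp_all add: borel_eq_atMost)
  show "range (\<lambda>i. {..real i}) \<subseteq> range (\<lambda>a::real. {..a})" by auto
  show "(\<Union>i. {..real i}) = UNIV" using real_arch_simple by auto
  show "emeasure (distr lborel borel (\<lambda>x::real^2. (norm (x - a))\<^sup>2)) {..real i} \<noteq> \<infinity>" for i
    using eq[of "real i"] by simp
qed auto

lemma radial_integral:
  fixes F :: "real \<Rightarrow> real"
  assumes [measurable]: "F \<in> borel_measurable borel"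
  shows "(LBINT x. F ((norm (x - (a::real^2)))\<^sup>2)) = pi * (LBINT t. indicator {0..} t * F t)"
    and "integrable lborel (\<lambda>x. F ((norm (x - a))\<^sup>2)) \<longleftrightarrow> integrable lborel (\<lambda>t. indicator {0..} t * F t)"
proof -
  have m: "(\<lambda>x::real^2. (norm (x - a))\<^sup>2) \<in> lborel \<rightarrow>\<^sub>M borel" by measurable
  have "(LBINT x. F ((norm (x - a))\<^sup>2)) = (LINT t|density lborel (\<lambda>t. ennreal (pi * indicator {0..} t)). F t)"
    unfolding distr_radial[of a, symmetric] by (subst integral_distr[OF m]) auto
  also have "\<dots> = (LBINT t. (pi * indicator {0..} t) *\<^sub>R F t)"
    by (rule integral_density) auto
  also have "\<dots> = pi * (LBINT t. indicator {0..} t * F t)" by (simp add: mult.assoc)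
  finally show "(LBINT x. F ((norm (x - a))\<^sup>2)) = pi * (LBINT t. indicator {0..} t * F t)" .
  have "integrable lborel (\<lambda>x. F ((norm (x - a))\<^sup>2)) \<longleftrightarrow> integrable (density lborel (\<lambda>t. ennreal (pi * indicator {0..} t))) F"
    unfolding distr_radial[of a, symmetric] by (subst integrable_distr_eq[OF m]) auto
  also have "\<dots> \<longleftrightarrow> integrable lborel (\<lambda>t. (pi * indicator {0..} t) *\<^sub>R F t)"
    by (rule integrable_density) auto
  also have "\<dots> \<longleftrightarrow> integrable lborel (\<lambda>t. indicator {0..} t * F t)"
    by (simp add: mult.assoc)
  finally show "integrable lborel (\<lambda>x. F ((norm (x - a))\<^sup>2)) \<longleftrightarrow> integrable lborel (\<lambda>t. indicator {0..} t * F t)" .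
qed

section \<open>A radial test function\<close>

lemma max0_power_deriv:
  "((\<lambda>s::real. max 0 s ^ Suc (Suc n)) has_real_derivative real (Suc (Suc n)) * max 0 s ^ Suc n) (at s)"
proof -
  consider "s > 0" | "s < 0" | "s = 0" by linarith
  then show ?thesis
  proof cases
    case 1
    have "((\<lambda>s::real. s ^ Suc (Suc n)) has_real_derivative real (Suc (Suc n)) * max 0 s ^ Suc n) (at s)"
      using 1 DERIV_pow[of "Suc (Suc n)" s] by (simp add: max_def)
    then show ?thesis
      by (rule has_field_derivative_transform_within_open[of _ _ _ "{0<..}"]) (use 1 in \<open>auto simp: max_def\<close>)
  next
    case 2
    have "((\<lambda>s::real. 0) has_real_derivative real (Suc (Suc n)) * max 0 s ^ Suc n) (at s)"
      using 2 by (auto simp: max_def)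
    then show ?thesis
      by (rule has_field_derivative_transform_within_open[of _ _ _ "{..<0}"]) (use 2 in \<open>auto simp: max_def\<close>)
  next
    case 3
    have "((\<lambda>h::real. max 0 h ^ Suc n) \<longlongrightarrow> max 0 0 ^ Suc n) (at 0)" by (intro tendsto_intros)
    then have "((\<lambda>h::real. max 0 h ^ Suc n) \<longlongrightarrow> 0) (at 0)" by simp
    moreover have "\<forall>\<^sub>F h in at (0::real). max 0 h ^ Suc n = (max 0 (0 + h) ^ Suc (Suc n) - max 0 0 ^ Suc (Suc n)) / h"
      unfolding eventually_at by (intro exI[of _ 1]) (auto simp: max_def)
    ultimately have "((\<lambda>h::real. (max 0 (0 + h) ^ Suc (Suc n) - max 0 0 ^ Suc (Suc n)) / h) \<longlongrightarrow> 0) (at 0)"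
      by (rule Lim_transform_eventually)
    then show ?thesis using 3 by (simp add: DERIV_def)
  qed
qed

text \<open>A twice continuously differentiable substitute for the positive part of \<open>s\<close>.\<close>

definition ramp :: "real \<Rightarrow> real \<Rightarrow> real" where
  "ramp k s = (k * max 0 s ^ 3 - max 0 s ^ 4 / 2 + k * max 0 (s - k) ^ 3 + max 0 (s - k) ^ 4 / 2) / k ^ 3"
definition ramp1 :: "real \<Rightarrow> real \<Rightarrow> real" where
  "ramp1 k s = (3 * k * max 0 s ^ 2 - 2 * max 0 s ^ 3 + 3 * k * max 0 (s - k) ^ 2 + 2 * max 0 (s - k) ^ 3) / k ^ 3"
text \<open>On \<open>[0, k]\<close> this is the parabola \<open>6 s (k - s) / k^3\<close> of
  integral 1; the terms in \<open>s - k\<close> cancel it beyond \<open>k\<close>. Accordingly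
  \<open>ramp1\<close> rises smoothly from 0 to 1, and from \<open>k\<close> on \<open>ramp\<close>
  is the identity delayed by \<open>k/2\<close>.\<close>

definition ramp2 :: "real \<Rightarrow> real \<Rightarrow> real" where
  "ramp2 k s = (6 * k * max 0 s - 6 * max 0 s ^ 2 + 6 * k * max 0 (s - k) + 6 * max 0 (s - k) ^ 2) / k ^ 3"

lemma max0_power_derivs:
  "((\<lambda>s::real. max 0 (s - a) ^ 2) has_real_derivative 2 * max 0 (s - a)) (at s)"
  "((\<lambda>s::real. max 0 (s - a) ^ 3) has_real_derivative 3 * max 0 (s - a) ^ 2) (at s)"
  "((\<lambda>s::real. max 0 (s - a) ^ 4) has_real_derivative 4 * max 0 (s - a) ^ 3) (at s)"
proof -
  have d: "((\<lambda>s. s - a) has_real_derivative 1) (at s)" by (auto intro!: derivative_eq_intros)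
  have e: "((\<lambda>s::real. max 0 (s - a) ^ Suc (Suc n)) has_real_derivative real (Suc (Suc n)) * max 0 (s - a) ^ Suc n * 1) (at s)" for n
    by (rule DERIV_chain2[OF max0_power_deriv d])
  show "((\<lambda>s::real. max 0 (s - a) ^ 2) has_real_derivative 2 * max 0 (s - a)) (at s)"
    "((\<lambda>s::real. max 0 (s - a) ^ 3) has_real_derivative 3 * max 0 (s - a) ^ 2) (at s)"
    "((\<lambda>s::real. max 0 (s - a) ^ 4) has_real_derivative 4 * max 0 (s - a) ^ 3) (at s)"
    using e[of 0] e[of 1] e[of 2] by (simp_all add: numeral_eq_Suc)
qed

lemma ramp_deriv: "(ramp k has_real_derivative ramp1 k s) (at s)"
  unfolding ramp_def[abs_def] ramp1_def
  by (rule DERIV_cong[OF DERIV_cdivide[OF DERIV_add[OF DERIV_add[OF DERIV_diff[OF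
        DERIV_cmult[OF max0_power_derivs(2)[of 0]] DERIV_cdivide[OF max0_power_derivs(3)[of 0]]]
        DERIV_cmult[OF max0_power_derivs(2)]] DERIV_cdivide[OF max0_power_derivs(3)]], simplified]]) simp

lemma ramp1_deriv: "(ramp1 k has_real_derivative ramp2 k s) (at s)"
  unfolding ramp1_def[abs_def] ramp2_def
  by (rule DERIV_cong[OF DERIV_cdivide[OF DERIV_add[OF DERIV_add[OF DERIV_diff[OF
        DERIV_cmult[OF max0_power_derivs(1)[of 0]] DERIV_cmult[OF max0_power_derivs(2)[of 0]]]
        DERIV_cmult[OF max0_power_derivs(1)]] DERIV_cmult[OF max0_power_derivs(2)]], simplified]]) simp

lemma ramp2_continuous: "continuous_on A (ramp2 k)"
  unfolding ramp2_def[abs_def] divide_inverse by (intro continuous_intros)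

lemma ramp_nonpos: "s \<le> 0 \<Longrightarrow> k > 0 \<Longrightarrow> ramp k s = 0 \<and> ramp1 k s = 0 \<and> ramp2 k s = 0"
  by (simp add: ramp_def ramp1_def ramp2_def max_def)

lemma ramp_ge:
  assumes "s \<ge> k" "k > 0" shows "ramp k s = s - k / 2" "ramp1 k s = 1" "ramp2 k s = 0"
proof -
  have m: "max 0 s = s" "max 0 (s - k) = s - k" using assms by auto
  have "2 * k * s ^ 3 - s ^ 4 + 2 * k * (s - k) ^ 3 + (s - k) ^ 4 = (2 * s - k) * k ^ 3"
    by (simp add: power_numeral_reduce algebra_simps)
  then have "k * s ^ 3 - s ^ 4 / 2 + k * (s - k) ^ 3 + (s - k) ^ 4 / 2 = (s - k / 2) * k ^ 3"
    by (simp add: field_simps)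
  then show "ramp k s = s - k / 2" using assms by (simp add: ramp_def m)
  have "3 * k * s ^ 2 - 2 * s ^ 3 + 3 * k * (s - k) ^ 2 + 2 * (s - k) ^ 3 = k ^ 3"
    by (simp add: power_numeral_reduce algebra_simps)
  then show "ramp1 k s = 1" using assms by (simp add: ramp1_def m)
  have "6 * k * s - 6 * s ^ 2 + 6 * k * (s - k) + 6 * (s - k) ^ 2 = 0"
    by (simp add: power_numeral_reduce algebra_simps)
  then show "ramp2 k s = 0" by (simp add: ramp2_def m)
qed

lemma ramp_mid:
  assumes "0 \<le> s" "s \<le> k" "k > 0"
  shows "0 \<le> ramp k s" "ramp k s \<le> s" "0 \<le> ramp1 k s" "ramp1 k s \<le> 1" "0 \<le> ramp2 k s"
proof -
  have m: "max 0 s = s" "max 0 (s - k) = 0" using assms by auto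
  define p where "p = s / k"
  have p: "0 \<le> p" "p \<le> 1" "s = p * k" using assms by (auto simp: p_def)
  have r: "ramp k s = s * (p\<^sup>2 * (1 - p / 2))"
    using assms unfolding ramp_def m p(3) by (simp add: field_simps power_numeral_reduce)
  have r1: "ramp1 k s = p\<^sup>2 * (3 - 2 * p)"
    using assms unfolding ramp1_def m p(3) by (simp add: field_simps power_numeral_reduce)
  have r2: "ramp2 k s = 6 * (p * (1 - p)) / k"
    using assms unfolding ramp2_def m p(3) by (simp add: field_simps power_numeral_reduce)
  have p2: "0 \<le> p\<^sup>2" "p\<^sup>2 \<le> 1" using p by (auto simp: power_le_one)
  show "0 \<le> ramp k s" unfolding r using p assms by (intro mult_nonneg_nonneg) auto
  have "p\<^sup>2 * (1 - p / 2) \<le> 1 * 1" using p p2 by (intro mult_mono) auto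
  then show "ramp k s \<le> s" unfolding r using mult_left_mono[of "p\<^sup>2 * (1 - p / 2)" 1 s] assms by simp
  show "0 \<le> ramp1 k s" unfolding r1 using p by (intro mult_nonneg_nonneg) auto
  have "0 \<le> (1 - p)\<^sup>2 * (1 + 2 * p)" using p by (intro mult_nonneg_nonneg) auto
  then show "ramp1 k s \<le> 1" unfolding r1 by (simp add: power2_eq_square algebra_simps)
  show "0 \<le> ramp2 k s" unfolding r2 using p assms by (intro divide_nonneg_pos mult_nonneg_nonneg) auto
qed

text \<open>The singular solution \<open>phi\<close>, stopped at its zero \<open>T\<close>, is made twice continuously
  differentiable by a change of time \<open>tau\<close>: shifting the argument by \<open>k/2\<close> near the origin
  regularises the logarithm, and \<open>tau\<close> comes to rest smoothly at \<open>T\<close>.\<close>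

locale profile =
  fixes c T k :: real
  assumes k: "0 < k" "k < T" and phi_T: "phi c T = 0"
begin

definition tau :: "real \<Rightarrow> real" where "tau t = T - ramp k (T - t)"
definition tau1 :: "real \<Rightarrow> real" where "tau1 t = ramp1 k (T - t)"
definition tau2 :: "real \<Rightarrow> real" where "tau2 t = - ramp2 k (T - t)"

definition g :: "real \<Rightarrow> real" where "g t = phi c (tau t)"
definition g1 :: "real \<Rightarrow> real" where "g1 t = phi1 c (tau t) * tau1 t"
definition g2 :: "real \<Rightarrow> real" where "g2 t = phi2 c (tau t) * (tau1 t)\<^sup>2 + phi1 c (tau t) * tau2 t"
text \<open>The Helmholtz operator in the variable \<open>t = r^2\<close>: the defect of the
  regularised function. For \<open>phi\<close> itself in place of \<open>g\<close> it would vanish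
  at positive \<open>t\<close>.\<close>

definition mu :: "real \<Rightarrow> real" where "mu t = 4 * t * g2 t + 4 * g1 t + g t"

lemma tau_deriv: "(tau has_real_derivative tau1 t) (at t)"
proof -
  have "((\<lambda>t. T - t) has_real_derivative - 1) (at t)" by (auto intro!: derivative_eq_intros)
  from DERIV_chain2[OF ramp_deriv this, of k] 
  have "((\<lambda>t. T - ramp k (T - t)) has_real_derivative 0 - ramp1 k (T - t) * - 1) (at t)"
    by (intro DERIV_diff DERIV_const)
  then show ?thesis by (simp add: tau_def[abs_def] tau1_def)
qed

lemma tau1_deriv: "(tau1 has_real_derivative tau2 t) (at t)"
proof -
  have "((\<lambda>t. T - t) has_real_derivative - 1) (at t)" by (auto intro!: derivative_eq_intros)
  from DERIV_chain2[OF ramp1_deriv this, of k] show ?thesis by (simp add: tau1_def[abs_def] tau2_def)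
qed

lemma tau_left: "t \<le> T - k \<Longrightarrow> tau t = t + k / 2 \<and> tau1 t = 1 \<and> tau2 t = 0"
  using k by (simp add: tau_def tau1_def tau2_def ramp_ge)

lemma tau_right: "T \<le> t \<Longrightarrow> tau t = T \<and> tau1 t = 0 \<and> tau2 t = 0"
  using ramp_nonpos[of "T - t" k] k by (simp add: tau_def tau1_def tau2_def)

lemma tau_mid:
  assumes "T - k \<le> t" "t \<le> T"
  shows "t \<le> tau t" "tau t \<le> T" "0 \<le> tau1 t" "tau1 t \<le> 1" "tau2 t \<le> 0"
  using ramp_mid[of "T - t" k] assms k by (auto simp: tau_def tau1_def tau2_def)

text \<open>The range of \<open>t\<close> reaches below 0, so that the derivatives of
  \<open>g\<close> are two-sided at \<open>t = 0\<close> and the radial function is differentiable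
  at its centre as well.\<close>

lemma tau_pos: assumes "- (k / 2) < t" shows "tau t > 0"
proof -
  consider "t \<le> T - k" | "T - k \<le> t" "t \<le> T" | "T \<le> t" by linarith
  then show ?thesis
    using tau_left[of t] tau_mid(1)[of t] tau_right[of t] k assms by cases auto
qed

lemma g_deriv: "- (k / 2) < t \<Longrightarrow> (g has_real_derivative g1 t) (at t)"
  unfolding g_def[abs_def] g1_def by (rule DERIV_chain2[OF phi_deriv[OF tau_pos] tau_deriv])

lemma g1_deriv: "- (k / 2) < t \<Longrightarrow> (g1 has_real_derivative g2 t) (at t)"
  unfolding g1_def[abs_def] g2_def
  by (rule DERIV_cong[OF DERIV_mult[OF DERIV_chain2[OF phi1_deriv[OF tau_pos] tau_deriv] tau1_deriv]])
     (auto simp: power2_eq_square)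

lemma g2_continuous: "continuous_on {- (k / 2)<..} g2"
proof -
  have ct: "continuous_on A tau" "continuous_on A tau1" for A
    using tau_deriv tau1_deriv by (auto intro!: continuous_at_imp_continuous_on DERIV_isCont)
  have ct2: "continuous_on A tau2" for A
    unfolding tau2_def[abs_def] by (intro continuous_intros continuous_on_compose2[OF ramp2_continuous[of UNIV]]) auto
  have "continuous_on {- (k / 2)<..} (\<lambda>t. phi1 c (tau t))" "continuous_on {- (k / 2)<..} (\<lambda>t. phi2 c (tau t))"
    by (rule continuous_on_compose2[OF phi_continuous(2)]; use ct tau_pos in auto)
       (rule continuous_on_compose2[OF phi_continuous(3)]; use ct tau_pos in auto)
  then show ?thesis unfolding g2_def[abs_def] by (intro continuous_intros ct ct2)
qed

lemma g_right: "T \<le> t \<Longrightarrow> g t = 0 \<and> g1 t = 0 \<and> g2 t = 0 \<and> mu t = 0"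
  using tau_right[of t] by (simp add: g_def g1_def g2_def mu_def phi_T)

lemma mu_eq:
  assumes "0 \<le> t"
  shows "mu t = 4 * phi2 c (tau t) * (t * (tau1 t)\<^sup>2 - tau t) + 4 * phi1 c (tau t) * (tau1 t - 1) + 4 * t * phi1 c (tau t) * tau2 t"
proof -
  have "tau t > 0" using tau_pos[of t] k assms by simp
  from phi_ode[OF this, of c] have "phi c (tau t) = - 4 * (tau t * phi2 c (tau t) + phi1 c (tau t))" by simp
  then show ?thesis unfolding mu_def g_def g1_def g2_def by (simp add: algebra_simps)
qed

text \<open>On this range \<open>tau\<close> is a shift by \<open>k/2\<close>, and only the mismatch
  between \<open>t\<close> and \<open>t + k/2\<close> in Bessel's equation survives. As
  \<open>k\<close> tends to 0 it concentrates at the centre, with mass tending to 2 pi in the plane,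
  and is O(k) elsewhere.\<close>

lemma mu_left:
  assumes "0 \<le> t" "t \<le> T - k" shows "mu t = - 2 * k * phi2 c (t + k / 2)"
  using tau_left[OF assms(2)] mu_eq[OF assms(1)] by (simp add: algebra_simps)

text \<open>A one-sided bound uniform in \<open>k\<close> is possible and sufficient: this part of
  the defect approximates a positive measure on the circle, where the function integrated against it
  is non-positive.\<close>

lemma mu_mid:
  assumes "T - k \<le> t" "t \<le> T" and neg: "\<And>s. T - k \<le> s \<Longrightarrow> s \<le> T \<Longrightarrow> phi1 c s \<le> 0"
    and C: "\<And>s. T - k \<le> s \<Longrightarrow> s \<le> T \<Longrightarrow> \<bar>phi1 c s\<bar> \<le> C \<and> \<bar>phi2 c s\<bar> \<le> C"
  shows "- (8 * T * C + 4 * C) \<le> mu t"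
proof -
  have t: "0 \<le> t" using assms k by linarith
  note m = tau_mid[OF assms(1,2)]
  have ta: "T - k \<le> tau t" "tau t \<le> T" "0 \<le> tau t" using m assms t by linarith+
  have C0: "C \<ge> 0" using C[OF ta(1,2)] by linarith
  have "(tau1 t)\<^sup>2 \<le> 1" using m by (simp add: power_le_one)
  then have "t * (tau1 t)\<^sup>2 \<le> t * 1" using t by (intro mult_left_mono)
  moreover have "0 \<le> t * (tau1 t)\<^sup>2" using t by simp
  ultimately have "\<bar>t * (tau1 t)\<^sup>2 - tau t\<bar> \<le> 2 * T" using ta assms(2) k by linarith
  then have "\<bar>phi2 c (tau t)\<bar> * \<bar>t * (tau1 t)\<^sup>2 - tau t\<bar> \<le> C * (2 * T)"
    using C[OF ta(1,2)] C0 by (intro mult_mono) auto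
  then have 1: "\<bar>phi2 c (tau t) * (t * (tau1 t)\<^sup>2 - tau t)\<bar> \<le> C * (2 * T)" by (simp add: abs_mult)
  have "\<bar>phi1 c (tau t)\<bar> * \<bar>tau1 t - 1\<bar> \<le> C * 1"
    using C[OF ta(1,2)] C0 m by (intro mult_mono) auto
  then have 2: "\<bar>phi1 c (tau t) * (tau1 t - 1)\<bar> \<le> C" by (simp add: abs_mult)
  \<comment> \<open>Here \<open>tau2\<close> reaches size 1/k, so the term has no bound uniform in
    \<open>k\<close>; but \<open>phi1\<close> and \<open>tau2\<close> are both non-positive.\<close>
  have "0 \<le> t * (phi1 c (tau t) * tau2 t)"
    using neg[OF ta(1,2)] m(5) t by (intro mult_nonneg_nonneg mult_nonpos_nonpos) auto
  then show ?thesis using 1 2 unfolding mu_eq[OF t] by (simp add: abs_le_iff algebra_simps)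
qed

end

section \<open>Radial functions on the plane\<close>

lemma dist_square_has_derivative:
  fixes a x :: "real^2"
  shows "((\<lambda>x. (norm (x - a))\<^sup>2) has_derivative (\<lambda>v. v $ 1 * (2 * (x $ 1 - a $ 1)) + v $ 2 * (2 * (x $ 2 - a $ 2)))) (at x)"
proof -
  have e: "(norm (y - a))\<^sup>2 = (y $ 1 - a $ 1)\<^sup>2 + (y $ 2 - a $ 2)\<^sup>2" for y
    unfolding power2_norm_eq_inner by (simp add: inner_vec_def sum_2 power2_eq_square)
  have p: "((\<lambda>y. y $ i) has_derivative (\<lambda>v. v $ i)) (at x)" for i
    by (rule bounded_linear_imp_has_derivative) (rule bounded_linear_vec_nth)
  show ?thesis unfolding e
    by (rule has_derivative_eq_rhs[OF has_derivative_add[OF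
          has_derivative_power[OF has_derivative_diff[OF p has_derivative_const]]
          has_derivative_power[OF has_derivative_diff[OF p has_derivative_const]]]])
       (auto simp: fun_eq_iff algebra_simps)
qed

lemma dist_square_decomp: "(norm (x - a))\<^sup>2 = (x $ 1 - a $ 1)\<^sup>2 + (x $ 2 - a $ 2)\<^sup>2" for x a :: "real^2"
  unfolding power2_norm_eq_inner by (simp add: inner_vec_def sum_2 power2_eq_square)

lemma radial_has_derivative:
  fixes a x :: "real^2"
  assumes "(h has_real_derivative h') (at ((norm (x - a))\<^sup>2))"
  shows "((\<lambda>x. h ((norm (x - a))\<^sup>2)) has_derivative
     (\<lambda>v. v $ 1 * (h' * (2 * (x $ 1 - a $ 1))) + v $ 2 * (h' * (2 * (x $ 2 - a $ 2))))) (at x)"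
  by (rule has_derivative_eq_rhs[OF has_derivative_compose[OF dist_square_has_derivative assms[unfolded has_field_derivative_def]]])
     (auto simp: fun_eq_iff algebra_simps)

context profile
begin

lemma sq_gt: "- (k / 2) < (norm (x - a))\<^sup>2"
proof -
  have "0 \<le> (norm (x - a))\<^sup>2" by simp
  then show ?thesis using k by linarith
qed

lemma far: 
  assumes "norm a + T + 1 < norm x" shows "T \<le> (norm (x - a))\<^sup>2"
proof -
  have "T + 1 \<le> norm (x - a)" using assms norm_triangle_ineq2[of x a] by linarith
  then have "(T + 1)\<^sup>2 \<le> (norm (x - a))\<^sup>2" using k by (intro power_mono) auto
  moreover have "T \<le> (T + 1)\<^sup>2" using k by (simp add: power2_eq_square algebra_simps)
  ultimately show ?thesis by linarith
qed

lemma radial_bounded_support: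
  assumes "\<And>t. T \<le> t \<Longrightarrow> h t = 0"
  shows "bounded_support (\<lambda>x. h ((norm (x - a))\<^sup>2))"
proof -
  have "h ((norm (x - a))\<^sup>2) = 0" if "norm a + T + 1 < norm x" for x
    by (rule assms[OF far[OF that]])
  then show ?thesis unfolding bounded_support_def by blast
qed

lemma radial_continuous:
  fixes a :: "real^2"
  assumes "continuous_on {- (k / 2)<..} h" shows "continuous_on UNIV (\<lambda>x. h ((norm (x - a))\<^sup>2))"
proof (rule continuous_on_compose2[OF assms])
  show "continuous_on UNIV (\<lambda>x. (norm (x - a))\<^sup>2)" by (intro continuous_intros)
  show "range (\<lambda>x. (norm (x - a))\<^sup>2) \<subseteq> {- (k / 2)<..}" using sq_gt[of _ a] by blast
qed

lemma g_continuous: "continuous_on {- (k / 2)<..} g" "continuous_on {- (k / 2)<..} g1"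
proof -
  show "continuous_on {- (k / 2)<..} g"
    by (intro continuous_at_imp_continuous_on ballI, rule DERIV_isCont[OF g_deriv]) simp
  show "continuous_on {- (k / 2)<..} g1"
    by (intro continuous_at_imp_continuous_on ballI, rule DERIV_isCont[OF g1_deriv]) simp
qed

definition Phi :: "real^2 \<Rightarrow> real^2 \<Rightarrow> real" where "Phi a x = g ((norm (x - a))\<^sup>2)"

lemma Phi_C1c:
  shows "C1c (Phi a)" "pd i (Phi a) = (\<lambda>x. g1 ((norm (x - a))\<^sup>2) * (2 * (x $ i - a $ i)))"
proof -
  have b: "bounded_support (\<lambda>x. g ((norm (x - a))\<^sup>2))" by (rule radial_bounded_support) (simp add: g_right)
  have c: "continuous_on UNIV (\<lambda>x. g1 ((norm (x - a))\<^sup>2) * (2 * (x $ j - a $ j)))" for j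
    by (intro continuous_intros radial_continuous g_continuous)
  note * = C1c_I[OF radial_has_derivative[OF g_deriv[OF sq_gt]] c c b]
  show "C1c (Phi a)" unfolding Phi_def[abs_def] by (rule *(1))
  show "pd i (Phi a) = (\<lambda>x. g1 ((norm (x - a))\<^sup>2) * (2 * (x $ i - a $ i)))"
    using *(2,3) exhaust_2[of i] unfolding Phi_def[abs_def] by auto
qed

lemma Phi_pd_C1c:
  shows "C1c (pd i (Phi a))" 
    "pd i (pd i (Phi a)) = (\<lambda>x. g2 ((norm (x - a))\<^sup>2) * (2 * (x $ i - a $ i))\<^sup>2 + 2 * g1 ((norm (x - a))\<^sup>2))"
proof -
  have p: "((\<lambda>y. 2 * (y $ i - a $ i)) has_derivative (\<lambda>v. 2 * v $ i)) (at x)" for x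
    by (rule has_derivative_eq_rhs[OF has_derivative_mult_right[OF has_derivative_diff[OF
          bounded_linear_imp_has_derivative[OF bounded_linear_vec_nth] has_derivative_const]]]) simp
  define D where "D j x = g2 ((norm (x - a))\<^sup>2) * (2 * (x $ j - a $ j)) * (2 * (x $ i - a $ i)) + (if i = j then 2 * g1 ((norm (x - a))\<^sup>2) else 0)" for j x
  have d: "((\<lambda>x. g1 ((norm (x - a))\<^sup>2) * (2 * (x $ i - a $ i))) has_derivative (\<lambda>v. v $ 1 * D 1 x + v $ 2 * D 2 x)) (at x)" for x
    by (rule has_derivative_eq_rhs[OF has_derivative_mult[OF radial_has_derivative[OF g1_deriv[OF sq_gt]] p]])
       (use exhaust_2[of i] in \<open>auto simp: D_def fun_eq_iff algebra_simps\<close>)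
  have b: "bounded_support (\<lambda>x. g1 ((norm (x - a))\<^sup>2) * (2 * (x $ i - a $ i)))"
    by (intro bounded_support_mult radial_bounded_support) (simp add: g_right)
  have c: "continuous_on UNIV (D j)" for j
    unfolding D_def[abs_def] by (cases "i = j") (auto intro!: continuous_intros radial_continuous g_continuous g2_continuous)
  note * = C1c_I[OF d c c b]
  show "C1c (pd i (Phi a))" unfolding Phi_C1c(2) by (rule *(1))
  show "pd i (pd i (Phi a)) = (\<lambda>x. g2 ((norm (x - a))\<^sup>2) * (2 * (x $ i - a $ i))\<^sup>2 + 2 * g1 ((norm (x - a))\<^sup>2))"
    using *(2,3) exhaust_2[of i] unfolding Phi_C1c(2) by (auto simp: D_def fun_eq_iff power2_eq_square)
qed

text \<open>Summing the second derivatives of \<open>g (r^2)\<close> over both coordinates gives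
  \<open>4 r^2 g'' + 4 g'\<close>, because the squared coordinate differences add up to
  \<open>r^2\<close>.\<close>

lemma helmholtz_Phi: "pd 1 (pd 1 (Phi a)) x + pd 2 (pd 2 (Phi a)) x + Phi a x = mu ((norm (x - a))\<^sup>2)"
proof -
  define t p q where "t = (norm (x - a))\<^sup>2" and "p = (x $ 1 - a $ 1)\<^sup>2" and "q = (x $ 2 - a $ 2)\<^sup>2"
  have t: "t = p + q" by (simp add: t_def p_def q_def dist_square_decomp)
  have e: "(2 * (x $ 1 - a $ 1))\<^sup>2 = 4 * p" "(2 * (x $ 2 - a $ 2))\<^sup>2 = 4 * q"
    by (simp_all only: p_def q_def power_mult_distrib) simp_all
  have "g2 t * (4 * p) + 2 * g1 t + (g2 t * (4 * q) + 2 * g1 t) + g t = 4 * (p + q) * g2 t + 4 * g1 t + g t"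
    by (simp add: algebra_simps)
  then show ?thesis unfolding Phi_pd_C1c(2) mu_def Phi_def e t_def[symmetric] t[symmetric] .
qed

lemma helmholtz_Phi_C1c: "continuous_on UNIV (\<lambda>x. mu ((norm (x - a))\<^sup>2))" "bounded_support (\<lambda>x. mu ((norm (x - a))\<^sup>2))"
proof -
  show "bounded_support (\<lambda>x. mu ((norm (x - a))\<^sup>2))" by (rule radial_bounded_support) (simp add: g_right)
  show "continuous_on UNIV (\<lambda>x. mu ((norm (x - a))\<^sup>2))"
    by (rule radial_continuous) (auto simp: mu_def[abs_def] intro!: continuous_intros g_continuous g2_continuous)
qed

text \<open>The integrand is compared with a radial majorant on three ranges of \<open>t\<close>.
  Near the centre \<open>mu \<ge> 0\<close> and \<open>w \<le> - d\<close>, and \<open>mu\<close> is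
  integrated exactly; in between \<open>mu\<close> is O(k); in the transition layer the one-sided
  bound of \<open>mu_mid\<close> is used, and the layer has width \<open>k\<close>.\<close>

lemma integral_upper_bound:
  fixes w :: "real^2 \<Rightarrow> real" and a :: "real^2"
  assumes w: "continuous_on UNIV w" "\<And>x. - 2 \<le> w x" "\<And>x. w x \<le> 0"
    and t0: "0 < t0" "t0 < T - k" and near: "\<And>x. (norm (x - a))\<^sup>2 \<le> t0 \<Longrightarrow> w x \<le> - d" and d: "0 \<le> d"
    and neg2: "\<And>t. 0 < t \<Longrightarrow> t \<le> t0 + k / 2 \<Longrightarrow> phi2 c t \<le> 0"
    and neg1: "\<And>s. T - k \<le> s \<Longrightarrow> s \<le> T \<Longrightarrow> phi1 c s \<le> 0"
    and C: "\<And>s. t0 \<le> s \<Longrightarrow> s \<le> T \<Longrightarrow> \<bar>phi1 c s\<bar> \<le> C \<and> \<bar>phi2 c s\<bar> \<le> C"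
  shows "(LBINT x. w x * mu ((norm (x - a))\<^sup>2)) \<le>
     pi * (- d * (2 * k * phi1 c (k / 2) - 2 * k * phi1 c (t0 + k / 2)) + k * (4 * C * T + 2 * (8 * T * C + 4 * C)))"
proof -
  \<comment> \<open>The constants are products of \<open>|w| \<le> 2\<close> with the bound
    \<open>2 * k * C\<close> for \<open>|mu|\<close> outside the layer and the bound of
    \<open>mu_mid\<close> inside it. The last two terms are non-negative and may overlap the other
    ranges.\<close>
  define H where "H t = - d * ((- 2 * k * phi2 c (t + k / 2)) * indicator {0..t0} t) + 4 * k * C * indicator {0..T} t
      + 2 * (8 * T * C + 4 * C) * indicator {T - k..T} t" for t
  have "\<bar>phi1 c t0\<bar> \<le> C" using C[of t0] t0 k by simp
  then have C0: "C \<ge> 0" by linarith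
  have T0: "T > 0" using k by simp
  have "has_bochner_integral lborel (\<lambda>t. (- 2 * k * phi2 c (t + k / 2)) * indicator {0..t0} t)
     ((- 2 * k * phi1 c (t0 + k / 2)) - (- 2 * k * phi1 c (0 + k / 2)))"
  proof (rule has_bochner_integral_FTC_Icc_real)
    show "0 \<le> t0" using t0 by simp
    fix t assume t: "0 \<le> t" "t \<le> t0"
    have "((\<lambda>t. t + k / 2) has_real_derivative 1) (at t)" by (auto intro!: derivative_eq_intros)
    from DERIV_chain2[OF phi1_deriv this, of c] 
    have "((\<lambda>t. phi1 c (t + k / 2)) has_real_derivative phi2 c (t + k / 2) * 1) (at t)" using t k by simp
    from DERIV_cmult[OF this, of "- 2 * k"]
    show "((\<lambda>t. - 2 * k * phi1 c (t + k / 2)) has_real_derivative - 2 * k * phi2 c (t + k / 2)) (at t)" by simp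
    have "isCont (phi2 c) (t + k / 2)" using phi_continuous(3)[of c] t k by (simp add: continuous_on_eq_continuous_at)
    then have "isCont (\<lambda>t. phi2 c (t + k / 2)) t" by (rule isCont_o2[of t "\<lambda>t. t + k / 2", rotated]) simp
    then show "isCont (\<lambda>t. - 2 * k * phi2 c (t + k / 2)) t" by (intro continuous_intros)
  qed
  then have 1: "has_bochner_integral lborel (\<lambda>t. (- 2 * k * phi2 c (t + k / 2)) * indicator {0..t0} t)
     (2 * k * phi1 c (k / 2) - 2 * k * phi1 c (t0 + k / 2))" by simp
  have ind: "has_bochner_integral lborel (\<lambda>t. b * indicator {l..u} t) (b * (u - l))" if "l \<le> u" for l u b :: real
    using has_bochner_integral_real_indicator[of "{l..u}" lborel] that
    by (intro has_bochner_integral_mult_right) auto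
  have hH: "has_bochner_integral lborel H (- d * (2 * k * phi1 c (k / 2) - 2 * k * phi1 c (t0 + k / 2)) + 4 * k * C * (T - 0) + 2 * (8 * T * C + 4 * C) * (T - (T - k)))"
    unfolding H_def[abs_def] using T0 k
    by (intro has_bochner_integral_add has_bochner_integral_mult_right 1 ind) auto
  have H_supp: "indicator {0..} t * H t = H t" for t
    using k t0 by (auto simp: H_def indicator_def)
  have Hm: "H \<in> borel_measurable borel" using hH by (auto dest: has_bochner_integral_integrable)
  have iH: "integrable lborel (\<lambda>x. H ((norm (x - a))\<^sup>2))"
    using radial_integral(2)[OF Hm, of a] hH by (simp add: H_supp has_bochner_integral_iff)
  have IH: "(LBINT x. H ((norm (x - a))\<^sup>2)) = pi * (LBINT t. H t)"
    using radial_integral(1)[OF Hm, of a] by (simp add: H_supp)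
  have "(LBINT x. w x * mu ((norm (x - a))\<^sup>2)) \<le> (LBINT x. H ((norm (x - a))\<^sup>2))"
  proof (rule integral_mono)
    show "integrable lborel (\<lambda>x. H ((norm (x - a))\<^sup>2))" by (rule iH)
    have "integrable lborel (\<lambda>x. mu ((norm (x - a))\<^sup>2) * w x)"
      by (rule integrable_bounded_support_mult[OF helmholtz_Phi_C1c continuous_locally_integrable[OF w(1)]])
    then show "integrable lborel (\<lambda>x. w x * mu ((norm (x - a))\<^sup>2))" by (simp add: mult.commute)
    fix x
    define t where "t = (norm (x - a))\<^sup>2"
    have tn: "0 \<le> t" by (simp add: t_def)
    have pos: "0 \<le> 4 * k * C" "0 \<le> 2 * (8 * T * C + 4 * C)" using k C0 T0 by auto
    consider "t \<le> t0" | "t0 < t" "t < T - k" | "T - k \<le> t" "t \<le> T" | "T < t" "t0 < t" by linarith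
    then have "w x * mu t \<le> H t"
    proof cases
      case 1
      have m: "mu t = - 2 * k * phi2 c (t + k / 2)" using mu_left[OF tn] 1 t0 by simp
      have "0 \<le> mu t" unfolding m using neg2[of "t + k / 2"] 1 tn k by (simp add: mult_nonneg_nonpos)
      then have "w x * mu t \<le> - d * mu t" using near 1 by (intro mult_right_mono) (auto simp: t_def)
      also have "\<dots> \<le> H t" unfolding H_def using 1 tn pos k by (auto simp: m indicator_def)
      finally show ?thesis .
    next
      case 2
      have m: "mu t = - 2 * k * phi2 c (t + k / 2)" using mu_left[OF tn] 2 by simp
      have "\<bar>phi2 c (t + k / 2)\<bar> \<le> C" using C[of "t + k / 2"] 2 k by auto
      then have "\<bar>mu t\<bar> \<le> 2 * k * C" unfolding m using k by (simp add: abs_mult)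
      moreover have "\<bar>w x\<bar> \<le> 2" using w(2,3)[of x] by linarith
      ultimately have "\<bar>w x\<bar> * \<bar>mu t\<bar> \<le> 2 * (2 * k * C)" by (intro mult_mono) auto
      then have "w x * mu t \<le> 4 * k * C" unfolding abs_mult[symmetric] by linarith
      also have "\<dots> \<le> H t" unfolding H_def using 2 tn pos k t0 by (auto simp: indicator_def)
      finally show ?thesis .
    next
      case 3
      have "- (8 * T * C + 4 * C) \<le> mu t"
        by (rule mu_mid[OF 3 neg1]) (use C t0 in auto)
      then have "- (mu t) * (- w x) \<le> (8 * T * C + 4 * C) * (- w x)" using w(3)[of x] by (intro mult_right_mono) auto
      also have "\<dots> \<le> (8 * T * C + 4 * C) * 2" using w(2)[of x] pos by (intro mult_left_mono) auto
      finally have "w x * mu t \<le> 2 * (8 * T * C + 4 * C)" by (simp add: mult.commute)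
      also have "\<dots> \<le> H t" unfolding H_def using 3 tn pos k t0 by (auto simp: indicator_def)
      finally show ?thesis .
    next
      case 4
      then show ?thesis using g_right[of t] k t0 by (auto simp: H_def indicator_def)
    qed
    then show "w x * mu ((norm (x - a))\<^sup>2) \<le> H ((norm (x - a))\<^sup>2)" by (simp add: t_def)
  qed
  also have "\<dots> = pi * (- d * (2 * k * phi1 c (k / 2) - 2 * k * phi1 c (t0 + k / 2)) + k * (4 * C * T + 2 * (8 * T * C + 4 * C)))"
    unfolding IH has_bochner_integral_integral_eq[OF hH] by (simp add: algebra_simps)
  finally show ?thesis .
qed

text \<open>Up to the layer the function is the shifted solution, so the integral is a difference of
  values of \<open>lommel\<close> at \<open>T - k/2\<close> and \<open>k/2\<close>; the layer of
  width \<open>k\<close> costs \<open>k * C\<^sup>2\<close>.\<close>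

lemma Phi_L2_bound:
  assumes C: "\<And>s. T - k \<le> s \<Longrightarrow> s \<le> T \<Longrightarrow> \<bar>phi c s\<bar> \<le> C"
  shows "(LBINT x. (Phi a x)\<^sup>2) \<le> pi * (lommel c (T - k / 2) - lommel c (k / 2) + k * C\<^sup>2)"
proof -
  define H where "H t = (phi c (t + k / 2))\<^sup>2 * indicator {0..T - k} t + C\<^sup>2 * indicator {T - k..T} t" for t
  have "has_bochner_integral lborel (\<lambda>t. (phi c (t + k / 2))\<^sup>2 * indicator {0..T - k} t)
     (lommel c (T - k + k / 2) - lommel c (0 + k / 2))"
  proof (rule has_bochner_integral_FTC_Icc_real)
    show "0 \<le> T - k" using k by simp
    fix t assume t: "0 \<le> t" "t \<le> T - k"
    have "((\<lambda>t. t + k / 2) has_real_derivative 1) (at t)" by (auto intro!: derivative_eq_intros)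
    from DERIV_chain2[OF lommel_deriv this, of c]
    show "((\<lambda>t. lommel c (t + k / 2)) has_real_derivative (phi c (t + k / 2))\<^sup>2) (at t)" using t k by simp
    have "isCont (phi c) (t + k / 2)" using phi_continuous(1)[of c] t k by (simp add: continuous_on_eq_continuous_at)
    then have "isCont (\<lambda>t. phi c (t + k / 2)) t" by (rule isCont_o2[of t "\<lambda>t. t + k / 2", rotated]) simp
    then show "isCont (\<lambda>t. (phi c (t + k / 2))\<^sup>2) t" by (intro continuous_intros)
  qed
  moreover have "has_bochner_integral lborel (\<lambda>t. C\<^sup>2 * indicator {T - k..T} t) (C\<^sup>2 * k)"
    using has_bochner_integral_real_indicator[of "{T - k..T}" lborel] k
    by (intro has_bochner_integral_mult_right) auto
  ultimately have hH: "has_bochner_integral lborel H (lommel c (T - k / 2) - lommel c (k / 2) + C\<^sup>2 * k)"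
    unfolding H_def[abs_def] using has_bochner_integral_add by fastforce
  have H_supp: "indicator {0..} t * H t = H t" for t
    using k by (auto simp: H_def indicator_def)
  have Hm: "H \<in> borel_measurable borel" using hH by (auto dest: has_bochner_integral_integrable)
  have iH: "integrable lborel (\<lambda>x. H ((norm (x - a))\<^sup>2))"
    using radial_integral(2)[OF Hm, of a] hH by (simp add: H_supp has_bochner_integral_iff)
  have IH: "(LBINT x. H ((norm (x - a))\<^sup>2)) = pi * (LBINT t. H t)"
    using radial_integral(1)[OF Hm, of a] by (simp add: H_supp)
  have "(LBINT x. (Phi a x)\<^sup>2) \<le> (LBINT x. H ((norm (x - a))\<^sup>2))"
  proof (rule integral_mono)
    show "integrable lborel (\<lambda>x. H ((norm (x - a))\<^sup>2))" by (rule iH)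
    have "Phi a \<in> L2" by (rule C1c_L2(1)[OF Phi_C1c(1)])
    then show "integrable lborel (\<lambda>x. (Phi a x)\<^sup>2)" unfolding L2_real by blast
    fix x
    define t where "t = (norm (x - a))\<^sup>2"
    have tn: "0 \<le> t" by (simp add: t_def)
    have "(g t)\<^sup>2 \<le> H t"
    proof -
      consider "t \<le> T - k" | "T - k < t" "t \<le> T" | "T < t" by linarith
      then show ?thesis
      proof cases
        case 1 then show ?thesis using tau_left[of t] tn by (auto simp: g_def H_def indicator_def)
      next
        case 2
        then have "\<bar>g t\<bar> \<le> C" unfolding g_def using tau_mid[of t] by (intro C) auto
        then have "(g t)\<^sup>2 \<le> C\<^sup>2" using abs_le_square_iff[of "g t" C] by simp
        then show ?thesis using 2 tn by (auto simp: H_def indicator_def)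
      next
        case 3 then show ?thesis using g_right[of t] by (auto simp: H_def indicator_def)
      qed
    qed
    then show "(Phi a x)\<^sup>2 \<le> H ((norm (x - a))\<^sup>2)" by (simp add: t_def Phi_def)
  qed
  also have "\<dots> = pi * (lommel c (T - k / 2) - lommel c (k / 2) + k * C\<^sup>2)"
    unfolding IH has_bochner_integral_integral_eq[OF hH] by (simp add: mult.commute)
  finally show ?thesis .
qed

end

section \<open>Vanishing regularisation and the sharp constant\<close>

lemma half_at_right: "filterlim (\<lambda>k::real. k / 2) (at_right 0) (at_right 0)"
  unfolding filterlim_at
proof
  show "\<forall>\<^sub>F x in at_right 0. x / 2 \<in> {0<..} \<and> x / 2 \<noteq> (0::real)"
    by (auto simp: eventually_at_right_field intro!: exI[of _ 1])
  have "((\<lambda>k::real. k / 2) \<longlongrightarrow> 0 / 2) (at_right 0)" by (intro tendsto_intros) simp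
  then show "((\<lambda>k::real. k / 2) \<longlongrightarrow> 0) (at_right 0)" by simp
qed

lemma phi_bound:
  assumes "0 < t0" "t0 \<le> T"
  obtains C where "\<And>s. t0 \<le> s \<Longrightarrow> s \<le> T \<Longrightarrow> \<bar>phi c s\<bar> \<le> C \<and> \<bar>phi1 c s\<bar> \<le> C \<and> \<bar>phi2 c s\<bar> \<le> C"
proof -
  have "\<exists>B. \<forall>s\<in>{t0..T}. \<bar>f s\<bar> \<le> B" if "continuous_on {0<..} f" for f :: "real \<Rightarrow> real"
  proof -
    have "continuous_on {t0..T} f" by (rule continuous_on_subset[OF that]) (use assms in auto)
    then have "bounded (f ` {t0..T})" using compact_continuous_image compact_imp_bounded compact_Icc by blast
    then show ?thesis unfolding bounded_iff by auto
  qed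
  from this[OF phi_continuous(1)[of c]] this[OF phi_continuous(2)[of c]] this[OF phi_continuous(3)[of c]]
  obtain B0 B1 B2 where "\<forall>s\<in>{t0..T}. \<bar>phi c s\<bar> \<le> B0" "\<forall>s\<in>{t0..T}. \<bar>phi1 c s\<bar> \<le> B1" "\<forall>s\<in>{t0..T}. \<bar>phi2 c s\<bar> \<le> B2"
    by blast
  then show thesis by (intro that[of "max B0 (max B1 B2)"]) (auto simp: le_max_iff_disj)
qed

text \<open>The weak equation tested with the regularised function gives, after Cauchy-Schwarz, an
  inequality for each small \<open>k\<close>. As \<open>k\<close> tends to 0 its left side tends to
  \<open>(2 pi d)^2\<close> and the squared norm of the test function to at most
  \<open>pi (1/alpha^2 - 1)\<close>.\<close>

lemma helmholtz_lower_bound_aux: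
  fixes w f :: "real^2 \<Rightarrow> real"
  assumes w: "continuous_on UNIV w" "\<And>x. - 2 \<le> w x" "\<And>x. w x \<le> 0" "w a = - 2" and f: "f \<in> L2"
    and eq: "\<And>p. C1c p \<Longrightarrow> (\<And>i. C1c (pd i p)) \<Longrightarrow>
      (LBINT x. w x * (pd 1 (pd 1 p) x + pd 2 (pd 2 p) x + p x)) = (LBINT x. f x * p x)"
    and d: "0 < d" "d < 2"
  shows "4 * pi * d\<^sup>2 \<le> (LBINT x. (f x)\<^sup>2) * (1 / alpha\<^sup>2 - 1)"
proof -
  define T where "T = r_star\<^sup>2"
  have T: "T > 0" using r_star(1) by (simp add: T_def)
  obtain c where c: "phi c T = 0" "T * phi1 c T = - 1 / (2 * alpha)" "lommel c T = 1 / alpha\<^sup>2"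
    using alpha_solution unfolding T_def by metis
  have "T * phi1 c T < 0" using alpha_pos unfolding c(2) by simp
  then have pT: "phi1 c T < 0" using T by (simp add: mult_less_0_iff)
  have cont: "isCont (phi c) t" "isCont (phi1 c) t" "isCont (lommel c) t" if "t > 0" for t
    using phi_deriv[OF that] phi1_deriv[OF that] lommel_deriv[OF that] DERIV_isCont by blast+
  obtain \<delta> where \<delta>: "\<delta> > 0" "\<And>x. norm (x - a) < \<delta> \<Longrightarrow> w x < - d"
  proof -
    have "isCont w a" using w(1) by (simp add: continuous_on_eq_continuous_at)
    then have "\<forall>\<^sub>F x in at a. w x < - d" unfolding isCont_def using w(4) d by (intro order_tendstoD) auto
    then obtain r where "r > 0" "\<And>x. x \<noteq> a \<Longrightarrow> dist x a < r \<Longrightarrow> w x < - d" unfolding eventually_at by blast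
    moreover from this have "w x < - d" if "norm (x - a) < r" for x
      using that w(4) d by (cases "x = a") (auto simp: dist_norm)
    ultimately show thesis using that by blast
  qed
  obtain b where b: "b > 0" "\<And>t. 0 < t \<Longrightarrow> t < b \<Longrightarrow> phi2 c t < 0"
    using phi2_neg_near_0[of c] unfolding eventually_at_right_field by blast
  obtain e where e: "e > 0" "\<And>s. \<bar>s - T\<bar> < e \<Longrightarrow> phi1 c s < 0"
  proof -
    have "\<forall>\<^sub>F x in at T. phi1 c x < 0" using cont(2)[OF T] pT unfolding isCont_def by (rule order_tendstoD)
    then obtain r where "r > 0" "\<And>x. x \<noteq> T \<Longrightarrow> dist x T < r \<Longrightarrow> phi1 c x < 0" unfolding eventually_at by blast
    moreover from this have "phi1 c s < 0" if "\<bar>s - T\<bar> < r" for s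
      using that pT by (cases "s = T") (auto simp: dist_real_def)
    ultimately show thesis using that by blast
  qed
  \<comment> \<open>\<open>T/4\<close> keeps \<open>t0\<close> below \<open>T - k\<close> for
    \<open>k < T/2\<close>; \<open>\<delta>\<^sup>2/4\<close> puts the disc inside the region where
    \<open>w < - d\<close>; \<open>b/4\<close> together with \<open>k < b/2\<close> keeps
    \<open>t0 + k/2\<close> in the range where \<open>phi2\<close> is negative.\<close>
  define t0 where "t0 = min (T / 4) (min (\<delta>\<^sup>2 / 4) (b / 4))"
  have t0: "0 < t0" "t0 \<le> T / 4" "t0 \<le> \<delta>\<^sup>2 / 4" "t0 \<le> b / 4" using T \<delta> b by (auto simp: t0_def)
  have near: "w x \<le> - d" if "(norm (x - a))\<^sup>2 \<le> t0" for x
  proof -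
    have "(norm (x - a))\<^sup>2 \<le> (\<delta> / 2)\<^sup>2" using that t0(3) by (simp add: power_divide)
    then have "norm (x - a) \<le> \<delta> / 2" by (rule power2_le_imp_le) (use \<delta>(1) in auto)
    then show ?thesis using \<delta> by (intro less_imp_le) auto
  qed
  have t0T: "t0 \<le> T" using t0 T by simp
  obtain C where C: "\<And>s. t0 \<le> s \<Longrightarrow> s \<le> T \<Longrightarrow> \<bar>phi c s\<bar> \<le> C \<and> \<bar>phi1 c s\<bar> \<le> C \<and> \<bar>phi2 c s\<bar> \<le> C"
    using phi_bound[OF t0(1) t0T] by metis
  define A where "A = (LBINT x. (f x)\<^sup>2)"
  have A0: "A \<ge> 0" by (simp add: A_def)
  define K where "K = 4 * C * T + 2 * (8 * T * C + 4 * C)"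
  define M where "M k = d * (2 * k * phi1 c (k / 2) - 2 * k * phi1 c (t0 + k / 2)) - k * K" for k
  define U where "U k = A * (pi * (lommel c (T - k / 2) - lommel c (k / 2) + k * C\<^sup>2))" for k
  have main: "(pi * M k)\<^sup>2 \<le> U k" if kk: "0 < k" "k < T / 2" "k < e" "k < b / 2" and M: "0 \<le> M k" for k
  proof -
    interpret profile c T k by unfold_locales (use kk c T in auto)
    define X where "X = (LBINT x. f x * Phi a x)"
    have "X = (LBINT x. w x * mu ((norm (x - a))\<^sup>2))"
      unfolding X_def eq[OF Phi_C1c(1) Phi_pd_C1c(1), symmetric] helmholtz_Phi ..
    also have "\<dots> \<le> pi * (- d * (2 * k * phi1 c (k / 2) - 2 * k * phi1 c (t0 + k / 2)) + k * (4 * C * T + 2 * (8 * T * C + 4 * C)))"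
    proof (rule integral_upper_bound[OF w(1-3) t0(1) _ near])
      show "t0 < T - k" using t0 kk T by linarith
      show "0 \<le> d" using d by simp
      show "phi2 c t \<le> 0" if "0 < t" "t \<le> t0 + k / 2" for t using b(2)[of t] that t0 kk b(1) by (intro less_imp_le) auto
      show "phi1 c s \<le> 0" if "T - k \<le> s" "s \<le> T" for s using e(2)[of s] that kk by (intro less_imp_le) auto
      show "\<bar>phi1 c s\<bar> \<le> C \<and> \<bar>phi2 c s\<bar> \<le> C" if "t0 \<le> s" "s \<le> T" for s using C[OF that] by simp
    qed
    also have "\<dots> = - (pi * M k)" unfolding M_def K_def by (simp add: algebra_simps)
    finally have "pi * M k \<le> - X" by simp
    \<comment> \<open>The non-negativity of \<open>M k\<close> is essential here: squaring preserves
      the inequality only between non-negative numbers.\<close>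
    then have "(pi * M k)\<^sup>2 \<le> (- X)\<^sup>2" using M by (intro power_mono) auto
    also have "\<dots> = X\<^sup>2" by simp
    also have "\<dots> \<le> A * (LBINT x. (Phi a x)\<^sup>2)"
      unfolding X_def A_def by (rule L2_Cauchy_Schwarz[OF f C1c_L2(1)[OF Phi_C1c(1)]])
    also have "\<dots> \<le> U k" unfolding U_def
    proof (intro mult_left_mono A0 Phi_L2_bound)
      show "\<bar>phi c s\<bar> \<le> C" if "T - k \<le> s" "s \<le> T" for s using C[of s] that kk t0 T by simp
    qed
    finally show ?thesis .
  qed
  \<comment> \<open>The mass of the defect at the centre, read off from the strength of the
    logarithmic pole.\<close>
  have "((\<lambda>k. 4 * (k / 2 * phi1 c (k / 2))) \<longlongrightarrow> 4 * (1 / 2)) (at_right 0)"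
    by (intro tendsto_mult tendsto_const filterlim_compose[OF t_phi1_tendsto half_at_right])
  then have l1: "((\<lambda>k. 2 * k * phi1 c (k / 2)) \<longlongrightarrow> 2) (at_right 0)" by (simp add: mult.assoc)
  have l2: "((\<lambda>k. phi1 c (t0 + k / 2)) \<longlongrightarrow> phi1 c (t0 + 0 / 2)) (at_right 0)"
    by (rule isCont_tendsto_compose[of _ "phi1 c"]) (use cont(2)[OF t0(1)] in \<open>auto intro!: tendsto_eq_intros\<close>)
  have k0: "((\<lambda>k::real. k) \<longlongrightarrow> 0) (at_right 0)" by (rule tendsto_ident_at)
  have "(M \<longlongrightarrow> d * (2 - 2 * 0 * phi1 c (t0 + 0 / 2)) - 0 * K) (at_right 0)"
    unfolding M_def[abs_def] by (intro tendsto_diff tendsto_mult tendsto_const l1 l2 k0)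
  then have lM: "(M \<longlongrightarrow> 2 * d) (at_right 0)" by (simp add: mult.commute)
  have l3: "((\<lambda>k. lommel c (T - k / 2)) \<longlongrightarrow> lommel c (T - 0 / 2)) (at_right 0)"
    by (rule isCont_tendsto_compose[of _ "lommel c"]) (use cont(3)[OF T] in \<open>auto intro!: tendsto_eq_intros\<close>)
  have "(U \<longlongrightarrow> A * (pi * (lommel c (T - 0 / 2) - 1 + 0 * C\<^sup>2))) (at_right 0)"
    unfolding U_def[abs_def]
    by (intro tendsto_add tendsto_diff tendsto_mult tendsto_const l3 k0 filterlim_compose[OF lommel_tendsto half_at_right])
  then have lU: "(U \<longlongrightarrow> A * (pi * (1 / alpha\<^sup>2 - 1))) (at_right 0)" by (simp add: c)
  have "\<forall>\<^sub>F k in at_right 0. 0 < M k" by (rule order_tendstoD(1)[OF lM]) (use d in simp)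
  moreover have "\<forall>\<^sub>F k in at_right 0. 0 < k \<and> k < min (T / 2) (min e (b / 2))"
    unfolding eventually_at_right_field using T e b by (intro exI[of _ "min (T / 2) (min e (b / 2))"]) auto
  ultimately have ev: "\<forall>\<^sub>F k in at_right 0. (pi * M k)\<^sup>2 \<le> U k"
    by eventually_elim (rule main; simp)
  have "((\<lambda>k. (pi * M k)\<^sup>2) \<longlongrightarrow> (pi * (2 * d))\<^sup>2) (at_right 0)" by (intro tendsto_intros lM)
  from tendsto_le[OF trivial_limit_at_right_real lU this ev]
  have "(pi * (2 * d))\<^sup>2 \<le> A * (pi * (1 / alpha\<^sup>2 - 1))" .
  then have "pi * (4 * pi * d\<^sup>2) \<le> pi * (A * (1 / alpha\<^sup>2 - 1))"
    by (simp add: power2_eq_square mult_ac)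
  then show ?thesis unfolding A_def by (rule mult_left_le_imp_le) simp
qed

text \<open>The bound for every \<open>d\<close> in \<open>(0, 2)\<close> passes to the limit
  \<open>d = 2\<close>, because \<open>C\<close> and the other \<open>d\<close>-dependent choices of
  the preceding lemma no longer occur in its conclusion.\<close>

lemma helmholtz_lower_bound:
  fixes w f :: "real^2 \<Rightarrow> real"
  assumes w: "continuous_on UNIV w" "\<And>x. - 2 \<le> w x" "\<And>x. w x \<le> 0" "w a = - 2" and f: "f \<in> L2"
    and eq: "\<And>p. C1c p \<Longrightarrow> (\<And>i. C1c (pd i p)) \<Longrightarrow>
      (LBINT x. w x * (pd 1 (pd 1 p) x + pd 2 (pd 2 p) x + p x)) = (LBINT x. f x * p x)"
  shows "1/2 * (LBINT x. (f x)\<^sup>2) \<ge> 8 * pi * alpha\<^sup>2 / (1 - alpha\<^sup>2)"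
proof -
  define A where "A = (LBINT x. (f x)\<^sup>2)"
  have "((\<lambda>d. 4 * pi * d\<^sup>2) \<longlongrightarrow> 4 * pi * 2\<^sup>2) (at_left 2)" by (intro tendsto_intros)
  moreover have "\<forall>\<^sub>F d in at_left 2. 4 * pi * d\<^sup>2 \<le> A * (1 / alpha\<^sup>2 - 1)"
    unfolding eventually_at_left_field A_def
    by (intro exI[of _ 0] conjI allI impI helmholtz_lower_bound_aux[OF w f eq]) auto
  ultimately have B: "4 * pi * 2\<^sup>2 \<le> A * (1 / alpha\<^sup>2 - 1)"
    by (rule tendsto_upperbound) simp
  have a0: "0 < alpha\<^sup>2" using alpha_pos by simp
  have A0: "A \<ge> 0" by (simp add: A_def)
  have "0 < A * (1 / alpha\<^sup>2 - 1)" using B pi_gt_zero by (intro less_le_trans[OF _ B]) simp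
  \<comment> \<open>That \<open>alpha\<close> is below 1 comes out of the estimate itself: the left
    side of \<open>B\<close> is positive and \<open>A \<ge> 0\<close>, so the other factor must be
    positive.\<close>
  then have "1 / alpha\<^sup>2 - 1 > 0" using A0 by (simp add: zero_less_mult_iff)
  then have a1: "alpha\<^sup>2 < 1" using a0 by (simp add: field_simps)
  have "16 * pi * alpha\<^sup>2 \<le> A * (1 / alpha\<^sup>2 - 1) * alpha\<^sup>2" using B a0 by (intro mult_right_mono) auto
  also have "\<dots> = A * (1 - alpha\<^sup>2)" using a0 by (simp add: field_simps)
  finally have "8 * pi * alpha\<^sup>2 / (1 - alpha\<^sup>2) \<le> 1/2 * A" using a1 by (simp add: field_simps)
  then show ?thesis by (simp add: A_def)
qed

section \<open>The lower bounds\<close>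

lemma sphere_map_admissible:
  assumes "n \<in> admissible"
  shows "sphere_map (\<lambda>j x. n x $ j) (\<lambda>i j x. weak_partial i n x $ j)"
proof
  fix i :: 2 and j :: 3 and x :: "real^2"
  have u: "uniformly_continuous_on UNIV n" "(\<lambda>x. n x - e3) \<in> L2" "norm (n x) = 1"
    using assms by (auto simp: admissible_def H2_def)
  have L: "(\<lambda>x. (n x - e3) $ j) \<in> L2" for j by (rule L2_component[OF u(2)])
  have e: "e3 $ 1 = 0" "e3 $ 2 = 0" "e3 $ 3 = 1" by (simp_all add: e3_def)
  show "continuous_on UNIV (\<lambda>x. n x $ j)"
    using uniformly_continuous_imp_continuous[OF u(1)] by (intro continuous_intros)
  show "(n x $ 1)\<^sup>2 + (n x $ 2)\<^sup>2 + (n x $ 3)\<^sup>2 = 1"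
    using norm_square_vec3[of "n x"] u(3) by simp
  show "(\<lambda>x. n x $ 1) \<in> L2" "(\<lambda>x. n x $ 2) \<in> L2" "(\<lambda>x. n x $ 3 - 1) \<in> L2"
    using L[of 1] L[of 2] L[of 3] by (simp_all add: e)
  show "(\<lambda>x. weak_partial i n x $ j) \<in> L2"
    by (rule L2_component[OF admissible_weak_partial(2)[OF assms]])
  show "has_weak_partial i (\<lambda>x. n x $ j) (\<lambda>x. weak_partial i n x $ j)"
    by (rule has_weak_partial_component[OF admissible_weak_partial(1)[OF assms]])
qed

text \<open>If the pole is avoided, \<open>1 + n3\<close> has a positive minimum on a large ball by
  compactness and exceeds 1 outside it by decay at infinity. This uniform lower bound is the
  hypothesis of \<open>degree_zero\<close>.\<close>

lemma admissible_reaches_south_pole: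
  assumes n: "n \<in> admissible" and Q: "top_degree n \<noteq> 0"
  obtains a where "n a $ 3 = - 1"
proof -
  interpret sphere_map "\<lambda>j x. n x $ j" "\<lambda>i j x. weak_partial i n x $ j"
    by (rule sphere_map_admissible[OF n])
  have "\<exists>a. n a $ 3 = - 1"
  proof (rule ccontr)
    assume "\<not> (\<exists>a. n a $ 3 = - 1)"
    then have pos: "0 < 1 + n x $ 3" for x
      using N_le_1[of x 3] by (smt (verit))
    have "uniformly_continuous_on UNIV (\<lambda>x. n x $ 3 - 1)"
    proof -
      have "uniformly_continuous_on UNIV n" using n by (simp add: admissible_def)
      then show ?thesis
        by (intro uniformly_continuous_on_diff uniformly_continuous_on_const
             bounded_linear.uniformly_continuous_on[OF bounded_linear_vec_nth])
    qed
    then obtain R where R: "\<And>x. R < norm x \<Longrightarrow> \<bar>n x $ 3 - 1\<bar> < 1"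
      using uniformly_continuous_L2_tail[OF _ L2_N3] by metis
    have "\<exists>y\<in>cball 0 (max R 0). \<forall>x\<in>cball 0 (max R 0). 1 + n y $ 3 \<le> 1 + n x $ 3"
      by (intro continuous_attains_inf continuous_intros continuous_on_subset[OF N_continuous]) auto
    then obtain y where "\<forall>x\<in>cball 0 (max R 0). 1 + n y $ 3 \<le> 1 + n x $ 3" by blast
    then have y: "1 + n y $ 3 \<le> 1 + n x $ 3" if "norm x \<le> max R 0" for x using that by simp
    define c where "c = min (1 + n y $ 3) 1"
    have "c > 0" using pos[of y] by (simp add: c_def)
    moreover have "c \<le> 1 + n x $ 3" for x
    proof (cases "norm x \<le> max R 0")
      case True then show ?thesis using y[of x] by (simp add: c_def)
    next
      case False
      then have "\<bar>n x $ 3 - 1\<bar> < 1" by (intro R) auto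
      then show ?thesis by (simp add: c_def)
    qed
    ultimately have "(LBINT x. n x $ 1 * (weak_partial 1 n x $ 2 * weak_partial 2 n x $ 3 - weak_partial 1 n x $ 3 * weak_partial 2 n x $ 2)
     + n x $ 2 * (weak_partial 1 n x $ 3 * weak_partial 2 n x $ 1 - weak_partial 1 n x $ 1 * weak_partial 2 n x $ 3)
     + n x $ 3 * (weak_partial 1 n x $ 1 * weak_partial 2 n x $ 2 - weak_partial 1 n x $ 2 * weak_partial 2 n x $ 1)) = 0"
      by (rule degree_zero)
    moreover have "n x \<bullet> cross3 (weak_partial 1 n x) (weak_partial 2 n x) = n x $ 1 * (weak_partial 1 n x $ 2 * weak_partial 2 n x $ 3 - weak_partial 1 n x $ 3 * weak_partial 2 n x $ 2)
     + n x $ 2 * (weak_partial 1 n x $ 3 * weak_partial 2 n x $ 1 - weak_partial 1 n x $ 1 * weak_partial 2 n x $ 3)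
     + n x $ 3 * (weak_partial 1 n x $ 1 * weak_partial 2 n x $ 2 - weak_partial 1 n x $ 2 * weak_partial 2 n x $ 1)" for x
      by (simp add: inner_vec_def sum_3 cross_components mult.commute)
    ultimately show False using Q by (simp add: top_degree_def)
  qed
  then show thesis using that by blast
qed

text \<open>Pointwise, the triple product with a unit vector is at most the product of the two
  gradient norms, hence at most half the sum of their squares.\<close>

lemma degree_le_gradient:
  assumes n: "n \<in> admissible"
  shows "8 * pi * \<bar>top_degree n\<bar> \<le> (LBINT x. (\<Sum>i\<in>UNIV. (norm (weak_partial i n x))\<^sup>2))"
proof -
  define F where "F x = n x \<bullet> cross3 (weak_partial 1 n x) (weak_partial 2 n x)" for x
  define G where "G x = (\<Sum>i\<in>UNIV. (norm (weak_partial i n x))\<^sup>2)" for x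
  have iG: "integrable lborel G"
    unfolding G_def[abs_def] sum_2 using admissible_weak_partial(2)[OF n] by (auto simp: L2_def)
  have le: "\<bar>F x\<bar> \<le> 1/2 * G x" for x
  proof -
    let ?p = "weak_partial 1 n x" and ?q = "weak_partial 2 n x"
    have "norm (n x) = 1" using n by (simp add: admissible_def)
    then have "\<bar>F x\<bar> \<le> norm (cross3 ?p ?q)" unfolding F_def using Cauchy_Schwarz_ineq2[of "n x"] by simp
    also have "\<dots> \<le> norm ?p * norm ?q"
    proof (rule power2_le_imp_le)
      show "(norm (cross3 ?p ?q))\<^sup>2 \<le> (norm ?p * norm ?q)\<^sup>2" using norm_cross_dot[of ?p ?q] zero_le_power2[of "?p \<bullet> ?q"] by linarith
    qed simp
    also have "\<dots> \<le> 1/2 * G x" using sum_squares_bound[of "norm ?p" "norm ?q"] by (simp add: G_def sum_2)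
    finally show ?thesis .
  qed
  have "\<bar>LBINT x. F x\<bar> \<le> 1/2 * (LBINT x. G x)"
  proof (cases "integrable lborel F")
    case True
    have "\<bar>LBINT x. F x\<bar> \<le> (LBINT x. \<bar>F x\<bar>)" by (rule integral_abs_bound)
    also have "\<dots> \<le> (LBINT x. 1/2 * G x)"
      by (rule integral_mono) (use True iG le in auto)
    finally show ?thesis by simp
  next
    \<comment> \<open>The integral of a non-integrable function is 0 by convention, so the estimate
      holds trivially in this case.\<close>
    case False
    have "0 \<le> (LBINT x. G x)" by (intro integral_nonneg_AE AE_I2) (simp add: G_def sum_nonneg)
    then show ?thesis using False by (simp add: not_integrable_integral_eq)
  qed
  moreover have "(LBINT x. F x) = 4 * pi * top_degree n" by (simp add: top_degree_def F_def[abs_def])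
  ultimately show ?thesis by (simp add: abs_mult G_def[abs_def])
qed

lemma weak_laplacian_shift: "weak_laplacian (\<lambda>y. n y - e3) = weak_laplacian n" for n :: "real^2 \<Rightarrow> real^3"
  by (simp add: weak_laplacian_def[abs_def] weak_partial_shift)

lemma admissible_L2:
  assumes n: "n \<in> admissible"
  shows "weak_laplacian n \<in> L2" "(\<lambda>x. n x - e3) \<in> L2" "helmholtz_residual n \<in> L2"
proof -
  show 1: "weak_laplacian n \<in> L2" unfolding weak_laplacian_def[abs_def] sum_2
    by (intro L2_add admissible_weak_partial(4)[OF n])
  show 2: "(\<lambda>x. n x - e3) \<in> L2" using n by (simp add: admissible_def H2_def)
  show "helmholtz_residual n \<in> L2" unfolding helmholtz_residual_def[abs_def] weak_laplacian_shift
    by (intro L2_add 1 2)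
qed

text \<open>Expanding the square of \<open>\<Delta>u + u\<close> leaves the cross term, twice the
  integral of \<open>u\<close> against its Laplacian, which is minus twice the Dirichlet integral.
  The integration by parts is done for each component and direction.\<close>

lemma residual_energy:
  assumes n: "n \<in> admissible"
  shows "(LBINT x. (norm (helmholtz_residual n x))\<^sup>2)
    = (LBINT x. (norm (weak_laplacian n x))\<^sup>2) + (LBINT x. (norm (n x - e3))\<^sup>2)
      - 2 * (LBINT x. (\<Sum>i\<in>UNIV. (norm (weak_partial i n x))\<^sup>2))"
proof -
  let ?p = "\<lambda>i. weak_partial i n" and ?q = "\<lambda>i. weak_partial i (weak_partial i n)"
  let ?u = "\<lambda>x. n x - e3"
  note w = admissible_weak_partial[OF n]
  note L = admissible_L2[OF n]
  have wu: "has_weak_partial i ?u (?p i)" for i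
    using has_weak_partial_add_const[OF w(1), of i "- e3"] by simp
  have c: "(LBINT x. ?u x $ j * ?q i x $ j) = - (LBINT x. (?p i x $ j)\<^sup>2)" for i j
    by (rule integral_by_parts[where q="\<lambda>k x. weak_partial k (?p i) x $ j",
          OF L2_component[OF L(2)] has_weak_partial_component[OF wu] L2_component[OF w(2)]
          has_weak_partial_component[OF w(3)] has_weak_partial_component[OF w(3)] L2_component[OF w(4)]])
  have i1: "integrable lborel (\<lambda>x. ?u x $ j * ?q i x $ j)" for i j
    by (rule L2_mult_integrable[OF L2_component[OF L(2)] L2_component[OF w(4)]])
  have i2: "integrable lborel (\<lambda>x. (?p i x $ j)\<^sup>2)" for i j
    using L2_component[OF w(2)] by (simp add: L2_real)
  have i3: "integrable lborel (\<lambda>x. (norm (weak_laplacian n x))\<^sup>2)" "integrable lborel (\<lambda>x. (norm (?u x))\<^sup>2)"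
    using L by (auto simp: L2_def)
  have ip: "?u x \<bullet> weak_laplacian n x = (?u x $ 1 * ?q 1 x $ 1 + ?u x $ 2 * ?q 1 x $ 2 + ?u x $ 3 * ?q 1 x $ 3)
      + (?u x $ 1 * ?q 2 x $ 1 + ?u x $ 2 * ?q 2 x $ 2 + ?u x $ 3 * ?q 2 x $ 3)" for x
    unfolding weak_laplacian_def sum_2 inner_add_right by (simp add: inner_vec_def sum_3)
  have iip: "integrable lborel (\<lambda>x. ?u x \<bullet> weak_laplacian n x)"
    unfolding ip by (intro Bochner_Integration.integrable_add i1)
  have g: "(LBINT x. (\<Sum>i\<in>UNIV. (norm (?p i x))\<^sup>2)) = - (LBINT x. ?u x \<bullet> weak_laplacian n x)"
  proof -
    have "(LBINT x. ?u x \<bullet> weak_laplacian n x) = 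
        ((LBINT x. ?u x $ 1 * ?q 1 x $ 1) + (LBINT x. ?u x $ 2 * ?q 1 x $ 2) + (LBINT x. ?u x $ 3 * ?q 1 x $ 3))
      + ((LBINT x. ?u x $ 1 * ?q 2 x $ 1) + (LBINT x. ?u x $ 2 * ?q 2 x $ 2) + (LBINT x. ?u x $ 3 * ?q 2 x $ 3))"
      unfolding ip by (simp only: Bochner_Integration.integral_add Bochner_Integration.integrable_add i1)
    then show ?thesis unfolding c sum_2 norm_square_vec3
      by (simp only: Bochner_Integration.integral_add Bochner_Integration.integrable_add i2)
  qed
  have "(LBINT x. (norm (helmholtz_residual n x))\<^sup>2) = (LBINT x. (norm (weak_laplacian n x))\<^sup>2 + (norm (?u x))\<^sup>2 + 2 * (?u x \<bullet> weak_laplacian n x))"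
    unfolding helmholtz_residual_def weak_laplacian_shift power2_norm_eq_inner
    by (intro Bochner_Integration.integral_cong) (auto simp: inner_add_left inner_add_right inner_commute)
  also have "\<dots> = (LBINT x. (norm (weak_laplacian n x))\<^sup>2) + (LBINT x. (norm (?u x))\<^sup>2) + 2 * (LBINT x. ?u x \<bullet> weak_laplacian n x)"
    using i3 iip by simp
  finally show ?thesis unfolding g by simp
qed

text \<open>The scalar estimate is applied to the third component only; discarding the other two can
  only decrease the norm of the residual.\<close>

lemma residual_lower_bound:
  assumes n: "n \<in> admissible" and Q: "top_degree n \<noteq> 0"
  shows "1/2 * (LBINT x. (norm (helmholtz_residual n x))\<^sup>2) \<ge> 8 * pi * alpha\<^sup>2 / (1 - alpha\<^sup>2)"
proof -
  interpret sphere_map "\<lambda>j x. n x $ j" "\<lambda>i j x. weak_partial i n x $ j"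
    by (rule sphere_map_admissible[OF n])
  obtain a where a: "n a $ 3 = - 1" using admissible_reaches_south_pole[OF n Q] .
  note L = admissible_L2[OF n]
  define w where "w x = n x $ 3 - 1" for x
  define f where "f x = helmholtz_residual n x $ 3" for x
  have fL: "f \<in> L2" unfolding f_def[abs_def] by (rule L2_component[OF L(3)])
  have wL: "w \<in> L2" unfolding w_def[abs_def] by (rule L2_N3)
  have f_eq: "f x = weak_partial 1 (weak_partial 1 n) x $ 3 + weak_partial 2 (weak_partial 2 n) x $ 3 + w x" for x
    unfolding f_def helmholtz_residual_def weak_laplacian_shift by (simp add: weak_laplacian_def sum_2 w_def e3_def)
  have "1/2 * (LBINT x. (f x)\<^sup>2) \<ge> 8 * pi * alpha\<^sup>2 / (1 - alpha\<^sup>2)"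
  proof (rule helmholtz_lower_bound[of w a])
    show "continuous_on UNIV w" unfolding w_def[abs_def] by (intro continuous_intros N_continuous)
    show "- 2 \<le> w x" "w x \<le> 0" for x using N_le_1[of x 3] by (auto simp: w_def)
    show "w a = - 2" by (simp add: w_def a)
    show "f \<in> L2" by (rule fL)
    fix p assume p: "C1c p" "\<And>i. C1c (pd i p)"
    let ?q = "\<lambda>i x. weak_partial i (weak_partial i n) x $ 3"
    have qL: "?q i \<in> L2" for i by (rule L2_component[OF admissible_weak_partial(4)[OF n]])
    \<comment> \<open>Two integrations by parts, with the test functions \<open>pd i p\<close> and
      \<open>p\<close>; this is why both are required to be of class \<open>C1c\<close>.\<close>
    have e: "(LBINT x. w x * pd i (pd i p) x) = (LBINT x. ?q i x * p x)" for i
    proof -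
      have "(LBINT x. pd i (pd i p) x * w x) = - (LBINT x. pd i p x * weak_partial i n x $ 3)"
        unfolding w_def by (rule weak_partial_C1c[OF weak_N3 p(2)])
      also have "(LBINT x. pd i p x * weak_partial i n x $ 3) = - (LBINT x. p x * ?q i x)"
        by (rule weak_partial_C1c[OF has_weak_partial_component[OF admissible_weak_partial(3)[OF n]] p(1)])
      finally show ?thesis by (simp add: mult.commute)
    qed
    have i: "integrable lborel (\<lambda>x. w x * pd i (pd i p) x)" "integrable lborel (\<lambda>x. w x * p x)"
      "integrable lborel (\<lambda>x. ?q i x * p x)" for i
      by (rule L2_mult_integrable[OF wL C1c_L2(2)[OF p(2)]] L2_mult_integrable[OF wL C1c_L2(1)[OF p(1)]]
          L2_mult_integrable[OF qL C1c_L2(1)[OF p(1)]])+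
    have "(LBINT x. w x * (pd 1 (pd 1 p) x + pd 2 (pd 2 p) x + p x)) = 
       (LBINT x. w x * pd 1 (pd 1 p) x) + (LBINT x. w x * pd 2 (pd 2 p) x) + (LBINT x. w x * p x)"
      using i by (simp add: distrib_left)
    also have "\<dots> = (LBINT x. f x * p x)" unfolding e f_eq using i by (simp add: distrib_right)
    finally show "(LBINT x. w x * (pd 1 (pd 1 p) x + pd 2 (pd 2 p) x + p x)) = (LBINT x. f x * p x)" .
  qed
  also have "(LBINT x. (f x)\<^sup>2) \<le> (LBINT x. (norm (helmholtz_residual n x))\<^sup>2)"
  proof (rule integral_mono)
    show "integrable lborel (\<lambda>x. (f x)\<^sup>2)" using fL by (simp add: L2_real)
    show "integrable lborel (\<lambda>x. (norm (helmholtz_residual n x))\<^sup>2)" using L(3) by (simp add: L2_def)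
    show "(f x)\<^sup>2 \<le> (norm (helmholtz_residual n x))\<^sup>2" for x
      unfolding f_def norm_square_vec3 by simp
  qed
  finally show ?thesis by simp
qed

theorem lemma2p5:
  fixes n :: "real^2 \<Rightarrow> real^3"
  assumes "n \<in> admissible"
    and "top_degree n \<noteq> 0"
  shows "1 / 2 * (L2_norm (helmholtz_residual n))\<^sup>2 \<ge> b_star
    \<and> b_star = 8 * pi * alpha\<^sup>2 / (1 - alpha\<^sup>2)
    \<and> (\<forall>\<epsilon>::real. 0 \<le> \<epsilon> \<and> \<epsilon> \<le> 2 \<longrightarrow>
          energy \<epsilon> n \<ge> b_star + 8 * pi * (1 - \<epsilon> / 2) * \<bar>top_degree n\<bar>)"
proof (intro conjI allI impI)
  define R G where "R = (LBINT x. (norm (helmholtz_residual n x))\<^sup>2)"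
    and "G = (LBINT x. (\<Sum>i\<in>UNIV. (norm (weak_partial i n x))\<^sup>2))"
  show b: "b_star = 8 * pi * alpha\<^sup>2 / (1 - alpha\<^sup>2)" by (simp add: b_star_def alpha_def)
  have R: "b_star \<le> 1/2 * R" using residual_lower_bound[OF assms] unfolding b R_def .
  have "(L2_norm (helmholtz_residual n))\<^sup>2 = R" by (simp add: L2_norm_def R_def)
  then show "1 / 2 * (L2_norm (helmholtz_residual n))\<^sup>2 \<ge> b_star" using R by simp
  fix \<epsilon> :: real assume \<epsilon>: "0 \<le> \<epsilon> \<and> \<epsilon> \<le> 2"
  have i: "integrable lborel (\<lambda>x. (norm (weak_laplacian n x))\<^sup>2)" "integrable lborel (\<lambda>x. (norm (n x - e3))\<^sup>2)"
    "integrable lborel (\<lambda>x. (\<Sum>i\<in>UNIV. (norm (weak_partial i n x))\<^sup>2))"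
    using admissible_L2[OF assms(1)] admissible_weak_partial(2)[OF assms(1)] by (auto simp: L2_def)
  have "energy \<epsilon> n = 1/2 * ((LBINT x. (norm (weak_laplacian n x))\<^sup>2) + (LBINT x. (norm (n x - e3))\<^sup>2) - \<epsilon> * G)"
    unfolding energy_def G_def using i by simp
  also have "\<dots> = 1/2 * R + (1 - \<epsilon> / 2) * G"
    unfolding R_def residual_energy[OF assms(1)] G_def by (simp add: algebra_simps)
  finally have E: "energy \<epsilon> n = 1/2 * R + (1 - \<epsilon> / 2) * G" .
  \<comment> \<open>The condition \<open>\<epsilon> \<le> 2\<close> enters here: it makes the weight
    of the Dirichlet integral non-negative.\<close>
  have "(1 - \<epsilon> / 2) * (8 * pi * \<bar>top_degree n\<bar>) \<le> (1 - \<epsilon> / 2) * G"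
    unfolding G_def using \<epsilon> by (intro mult_left_mono degree_le_gradient assms) auto
  then show "energy \<epsilon> n \<ge> b_star + 8 * pi * (1 - \<epsilon> / 2) * \<bar>top_degree n\<bar>"
    unfolding E using R by (simp add: mult_ac)
qed

end
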